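(* Let $0\le\kappa<1$ and let $V(z)$ belong to the generalized Donoghue class $\mathfrak{M}_\kappa$. Then $V(z)$ can be realized as the impedance function $V_{\Theta_\kappa}(z)$ of an L-system $$\Theta_\kappa=\begin{pmatrix}\mathbb{A}&K&1\\ \mathcal{H}_+\subset\mathcal{H}\subset\mathcal{H}_-& &\mathbb{C}\end{pmatrix}$$ with symmetric operator $\dot A$ and main operator $T$ such that the triple $(\dot A,T,\hat A)$ satisfies the Hypothesis (H) (see context) with von Neumann parameter $\kappa$ and reference operator $A=\hat A$, the quasi-kernel of $\operatorname{Re}\mathbb{A}$. Moreover, $$V(z)=V_{\Theta_\kappa}(z)=\frac{1-\kappa}{1+\kappa}\,M(\dot A,\hat A)(z),\qquad z\in\mathbb{C}_+,$$ where $M(\dot A,\hat A)(z)$ is the Weyl-Titchmarsh function associated with the pair $(\dot A,\hat A)$.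
   Context: Rigged space. $\dot A$ is a closed densely defined symmetric operator with deficiency indices $(1,1)$ in a Hilbert space $\mathcal{H}$ with inner product $(\cdot,\cdot)$ (linear in the first argument). $\mathcal{H}_+=\mathrm{Dom}(\dot A^* )$ with $(f,g)_+=(f,g)+(\dot A^*f,\dot A^*g)$; $\mathcal{H}_-$ is the space dual to $\mathcal{H}_+$ with respect to $\mathcal{H}$, so $\mathcal{H}_+\subset\mathcal{H}\subset\mathcal{H}_-$, and $(u,f)$ denotes the value of $f\in\mathcal{H}_-$ at $u\in\mathcal{H}_+$ (equal to the $\mathcal{H}$-inner product if $f\in\mathcal{H}$). $[X,Y]$ is the set of bounded linear operators $X\to Y$. Spaces dual to $\mathcal{H}_\pm$ are identified with $\mathcal{H}_\mp$, so $\mathbb{A}\in[\mathcal{H}_+,\mathcal{H}_-]$ has adjoint $\mathbb{A}^*\in[\mathcal{H}_+,\mathcal{H}_-]$; $\operatorname{Re}\mathbb{A}=(\mathbb{A}+\mathbb{A}^* )/2$, $\operatorname{Im}\mathbb{A}=(\mathbb{A}-\mathbb{A}^* )/(2i)$. L-systems. For $\mathbb{B}=\mathbb{B}^*\in[\mathcal{H}_+,\mathcal{H}_-]$ with $\mathbb{B}\supset\dot A$, its quasi-kernel is the restriction of $\mathbb{B}$ to $\{f\in\mathcal{H}_+:\mathbb{B}f\in\mathcal{H}\}$; $\mathbb{B}$ is a t-self-adjoint bi-extension of $\dot A$ if its quasi-kernel is a self-adjoint operator in $\mathcal{H}$. The class $\Lambda(\dot A)$ consists of operators $T$ with $\dot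 A\subset T\subset\dot A^*$, $\rho(T)\neq\emptyset$ and $\mathrm{Dom}(\dot A)=\mathrm{Dom}(T)\cap\mathrm{Dom}(T^* )$. A $( * )$-extension of $T\in\Lambda(\dot A)$ is $\mathbb{A}\in[\mathcal{H}_+,\mathcal{H}_-]$ with $\dot A\subset T\subset\mathbb{A}$, $\dot A\subset T^*\subset\mathbb{A}^*$ such that $\operatorname{Re}\mathbb{A}$ is a t-self-adjoint bi-extension of $\dot A$. The array $\Theta_\kappa$ is an L-system (with $E=\mathbb{C}$, $J=1$) if $\mathbb{A}$ is a $( * )$-extension of some $T\in\Lambda(\dot A)$, $K\in[\mathbb{C},\mathcal{H}_-]$, $K^*\in[\mathcal{H}_+,\mathbb{C}]$, $\operatorname{Im}\mathbb{A}=KK^*$ and $\mathrm{Ran}(K)=\mathrm{Ran}(\operatorname{Im}\mathbb{A})$. $T$, the restriction of $\mathbb{A}$ to $\{f\in\mathcal{H}_+:\mathbb{A}f\in\mathcal{H}\}$, is the main operator. With $\hat A$ the quasi-kernel of $\operatorname{Re}\mathbb{A}$, the impedance function of an L-system $\Theta$ is $V_\Theta(z)=K^*(\operatorname{Re}\mathbb{A}-zI)^{-1}K$, $z\in\rho(\hat A)$ (well defined since $\mathrm{Ran}(\operatorname{Re}\mathbb{A}-zI)\supset\mathrm{Ran}(K)$). Hypothesis (H), for a triple $(\dot A,T,A)$ and a parameter $\kappa$: $T\ne T^*$ is a maximal dissipative extension of $\dot A$ (dissipative: $\operatorname{Im}(Tf,f)\ge0$ for $f\in\mathrm{Dom}(T)$),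 $A$ is a self-adjoint (reference) extension of $\dot A$, and there are deficiency elements $g_\pm\in\mathrm{Ker}(\dot A^*\mp iI)$, $\|g_\pm\|=1$, with $g_+-g_-\in\mathrm{Dom}(A)$ and $g_+-\kappa g_-\in\mathrm{Dom}(T)$. The number $\kappa$ is called the von Neumann parameter of $T$. Weyl-Titchmarsh function. For a self-adjoint extension $A$ of $\dot A$, $M(\dot A,A)(z)=((Az+I)(A-zI)^{-1}g_+,g_+)$, $z\in\mathbb{C}_+$, where $g_+\in\mathrm{Ker}(\dot A^*-iI)$, $\|g_+\|=1$. Generalized Donoghue class. For $0\le\kappa<1$, $\mathfrak{M}_\kappa$ is the class of analytic maps $V:\mathbb{C}_+\to\mathbb{C}_+$ admitting a representation $V(z)=\int_{\mathbb{R}}\left(\frac{1}{\lambda-z}-\frac{\lambda}{1+\lambda^2}\right)d\mu(\lambda)$ with an infinite Borel measure $\mu$ (i.e. $\mu(\mathbb{R})=\infty$) such that $\int_{\mathbb{R}}\frac{d\mu(\lambda)}{1+\lambda^2}=\frac{1-\kappa}{1+\kappa}$ (equivalently $V(i)=i\frac{1-\kappa}{1+\kappa}$). *)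

theory Defs
  imports "HOL-Analysis.Analysis" "HOL-Algebra.Module"
begin

section \<open>Complex Hilbert spaces with explicit carriers\<close>

text \<open>
  Hilbert spaces are modules over the field of complex numbers that carry a complete inner
  product, linear in the first argument. Explicit carriers are used because the main theorem
  asserts that some Hilbert space exists. The multiplication and the unit that the record
  inherits from rings play no role.
\<close>

definition complex_ring :: "complex ring" where
  "complex_ring = \<lparr>carrier = UNIV, mult = (*), one = 1, zero = 0, add = (+)\<rparr>"

record 'a inner_module = "(complex, 'a) module" +
  ip :: "'a \<Rightarrow> 'a \<Rightarrow> complex"

definition hnorm :: "'a inner_module \<Rightarrow> 'a \<Rightarrow> real" where
  "hnorm H x = sqrt (Re (ip H x x))"

text \<open>The value off the carrier is irrelevant; it makes the function symmetric everywhere, as the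
  locale \<^locale>\<open>Metric_space\<close> demands.\<close>

definition hdist :: "'a inner_module \<Rightarrow> 'a \<Rightarrow> 'a \<Rightarrow> real" where
  "hdist H x y = (if x \<in> carrier H \<and> y \<in> carrier H then hnorm H (x \<ominus>\<^bsub>H\<^esub> y) else 0)"

definition htop :: "'a inner_module \<Rightarrow> 'a topology" where
  "htop H = Metric_space.mtopology (carrier H) (hdist H)"

locale inner_product_space = Module.module complex_ring H for H :: "'a inner_module" (structure) +
  assumes ip_add: "\<lbrakk>x \<in> carrier H; y \<in> carrier H; z \<in> carrier H\<rbrakk>
      \<Longrightarrow> ip H (x \<oplus> y) z = ip H x z + ip H y z"
    and ip_smult: "\<lbrakk>x \<in> carrier H; y \<in> carrier H\<rbrakk> \<Longrightarrow> ip H (c \<odot> x) y = c * ip H x y"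
    and ip_cnj: "\<lbrakk>x \<in> carrier H; y \<in> carrier H\<rbrakk> \<Longrightarrow> ip H y x = cnj (ip H x y)"
    and ip_nonneg: "x \<in> carrier H \<Longrightarrow> 0 \<le> Re (ip H x x)"
    and ip_definite: "\<lbrakk>x \<in> carrier H; ip H x x = 0\<rbrakk> \<Longrightarrow> x = \<zero>"

context inner_product_space
begin

lemma ip_zero_left: "y \<in> carrier H \<Longrightarrow> ip H \<zero> y = 0"
  using ip_add[of "\<zero>" "\<zero>" y] by simp

lemma ip_add_right: "\<lbrakk>x \<in> carrier H; y \<in> carrier H; z \<in> carrier H\<rbrakk>
    \<Longrightarrow> ip H z (x \<oplus> y) = ip H z x + ip H z y"
  by (metis M.add.m_closed complex_cnj_add ip_add ip_cnj)

lemma ip_smult_right: "\<lbrakk>x \<in> carrier H; y \<in> carrier H\<rbrakk> \<Longrightarrow> ip H y (c \<odot> x) = cnj c * ip H y x"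
  using smult_closed[of c x] ip_smult[of x y c] ip_cnj
  by (metis UNIV_I complex_cnj_mult complex_ring_def partial_object.simps(1))

lemma ip_self: "x \<in> carrier H \<Longrightarrow> ip H x x = complex_of_real (Re (ip H x x))"
  using ip_cnj[of x x] by (auto simp: complex_eq_iff)

lemma hnorm_nonneg: "x \<in> carrier H \<Longrightarrow> 0 \<le> hnorm H x"
  by (simp add: hnorm_def ip_nonneg)

lemma hnorm_eq_0: "x \<in> carrier H \<Longrightarrow> hnorm H x = 0 \<longleftrightarrow> x = \<zero>"
  using ip_self[of x] ip_definite[of x] ip_zero_left[of "\<zero>"]
  by (auto simp: hnorm_def)

lemma Cauchy_Schwarz:
  assumes x: "x \<in> carrier H" and y: "y \<in> carrier H"
  shows "cmod (ip H x y) \<le> hnorm H x * hnorm H y"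
proof (cases "y = \<zero>")
  case True
  then have "ip H x y = 0"
    using ip_zero_left[OF x] ip_cnj[of "\<zero>" x] x by simp
  then show ?thesis using x y by (simp add: hnorm_nonneg)
next
  case False
  define b where "b = Re (ip H y y)"
  have b: "b > 0"
    using False ip_nonneg[OF y] ip_self[OF y] ip_definite[OF y] unfolding b_def
    by (metis less_eq_real_def of_real_0)
  define c where "c = - (ip H x y / of_real b)"
  have cy: "c \<odot> y \<in> carrier H" using y by (simp add: complex_ring_def)
  have yy: "ip H y y = of_real b" using ip_self[OF y] unfolding b_def .
  have "ip H (x \<oplus> c \<odot> y) (x \<oplus> c \<odot> y) =
      ip H x x + cnj c * ip H x y + (c * cnj (ip H x y) + c * cnj c * of_real b)"
    using x y cy by (simp add: ip_add ip_add_right ip_smult ip_smult_right yy ip_cnj[OF x y]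
        algebra_simps)
  also have "\<dots> = ip H x x - ip H x y * cnj (ip H x y) / of_real b"
    using b by (simp add: c_def field_simps)
  also have "\<dots> = of_real (Re (ip H x x) - (cmod (ip H x y))\<^sup>2 / b)"
    using ip_self[OF x] complex_norm_square[of "ip H x y"] by simp
  finally have "Re (ip H (x \<oplus> c \<odot> y) (x \<oplus> c \<odot> y)) = Re (ip H x x) - (cmod (ip H x y))\<^sup>2 / b"
    by simp
  then have "(cmod (ip H x y))\<^sup>2 / b \<le> Re (ip H x x)"
    using ip_nonneg[of "x \<oplus> c \<odot> y"] x cy by simp
  then have "(cmod (ip H x y))\<^sup>2 \<le> Re (ip H x x) * b"
    using b by (simp add: field_simps)
  then have "cmod (ip H x y) \<le> sqrt (Re (ip H x x) * b)"
    by (rule real_le_rsqrt)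
  then show ?thesis by (simp add: hnorm_def b_def real_sqrt_mult)
qed

lemma hnorm_triangle:
  assumes x: "x \<in> carrier H" and y: "y \<in> carrier H"
  shows "hnorm H (x \<oplus> y) \<le> hnorm H x + hnorm H y"
proof -
  have "Re (ip H (x \<oplus> y) (x \<oplus> y)) = Re (ip H x x) + 2 * Re (ip H x y) + Re (ip H y y)"
    using x y by (simp add: ip_add ip_add_right ip_cnj[OF x y])
  also have "\<dots> \<le> Re (ip H x x) + 2 * (hnorm H x * hnorm H y) + Re (ip H y y)"
    using Cauchy_Schwarz[OF x y] complex_Re_le_cmod[of "ip H x y"] by linarith
  also have "\<dots> = (hnorm H x + hnorm H y)\<^sup>2"
    using ip_nonneg[OF x] ip_nonneg[OF y] by (simp add: hnorm_def power2_sum)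
  finally have "hnorm H (x \<oplus> y) \<le> sqrt ((hnorm H x + hnorm H y)\<^sup>2)"
    unfolding hnorm_def[of H "x \<oplus> y"] by (rule real_sqrt_le_mono)
  then show ?thesis using x y by (simp add: hnorm_nonneg)
qed

lemma hnorm_minus: "x \<in> carrier H \<Longrightarrow> hnorm H (\<ominus> x) = hnorm H x"
proof -
  assume x: "x \<in> carrier H"
  have "ip H (\<ominus> x) z = - ip H x z" if "z \<in> carrier H" for z
    using ip_add[of x "\<ominus> x" z] x that by (simp add: M.r_neg ip_zero_left add_eq_0_iff)
  moreover have "ip H x (\<ominus> x) = - ip H x x"
    using ip_add_right[of x "\<ominus> x" x] ip_zero_left[OF x] ip_cnj[of "\<zero>" x] x
    by (simp add: M.r_neg add_eq_0_iff)
  ultimately show ?thesis using x by (simp add: hnorm_def)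
qed

lemma Metric_space_hdist: "Metric_space (carrier H) (hdist H)"
proof
  show "0 \<le> hdist H x y" for x y
    by (simp add: hdist_def hnorm_nonneg)
  show "hdist H x y = hdist H y x" for x y
  proof (cases "x \<in> carrier H \<and> y \<in> carrier H")
    case True
    then have "\<ominus> (x \<ominus> y) = y \<ominus> x"
      by (simp add: a_minus_def M.minus_add M.a_comm)
    then show ?thesis using True hnorm_minus[of "x \<ominus> y"] by (simp add: hdist_def)
  qed (auto simp: hdist_def)
  show "hdist H x y = 0 \<longleftrightarrow> x = y" if "x \<in> carrier H" "y \<in> carrier H" for x y
  proof -
    have "x \<ominus> y = \<zero> \<longleftrightarrow> x = y"
    proof
      assume "x \<ominus> y = \<zero>"
      then have "\<ominus> (\<ominus> y) = x"
        using that M.minus_equality[of x "\<ominus> y"] by (simp add: a_minus_def)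
      then show "x = y" using that by simp
    qed (use that in \<open>simp add: a_minus_def M.r_neg\<close>)
    then show ?thesis using that hnorm_eq_0[of "x \<ominus> y"] by (simp add: hdist_def)
  qed
  show "hdist H x z \<le> hdist H x y + hdist H y z"
    if "x \<in> carrier H" "y \<in> carrier H" "z \<in> carrier H" for x y z
  proof -
    have "x \<ominus> z = (x \<ominus> y) \<oplus> (y \<ominus> z)"
      using that by (simp add: a_minus_def M.a_ac M.l_neg M.r_neg2)
    then show ?thesis
      using hnorm_triangle[of "x \<ominus> y" "y \<ominus> z"] that by (simp add: hdist_def)
  qed
qed

end

locale hilbert_space = inner_product_space +
  assumes complete: "Metric_space.mcomplete (carrier H) (hdist H)"

section \<open>Unbounded operators\<close>

text \<open>Operators are identified with their graphs, so that \<open>\<subseteq>\<close> is operator extension.\<close>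

type_synonym 'a operator = "('a \<times> 'a) set"

definition lin_op :: "'a inner_module \<Rightarrow> 'a operator \<Rightarrow> bool" where
  "lin_op H T \<longleftrightarrow> T \<subseteq> carrier H \<times> carrier H \<and> single_valued T \<and> (\<zero>\<^bsub>H\<^esub>, \<zero>\<^bsub>H\<^esub>) \<in> T \<and>
     (\<forall>(f, g) \<in> T. \<forall>(f', g') \<in> T. (f \<oplus>\<^bsub>H\<^esub> f', g \<oplus>\<^bsub>H\<^esub> g') \<in> T) \<and>
     (\<forall>(f, g) \<in> T. \<forall>c. (c \<odot>\<^bsub>H\<^esub> f, c \<odot>\<^bsub>H\<^esub> g) \<in> T)"

definition app :: "'a operator \<Rightarrow> 'a \<Rightarrow> 'a" where
  "app T f = (THE g. (f, g) \<in> T)"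

definition densely_defined :: "'a inner_module \<Rightarrow> 'a operator \<Rightarrow> bool" where
  "densely_defined H T \<longleftrightarrow> htop H closure_of Domain T = carrier H"

definition closed_op :: "'a inner_module \<Rightarrow> 'a operator \<Rightarrow> bool" where
  "closed_op H T \<longleftrightarrow> closedin (prod_topology (htop H) (htop H)) T"

definition adjoint_op :: "'a inner_module \<Rightarrow> 'a operator \<Rightarrow> 'a operator" where
  "adjoint_op H T = {(f, g). f \<in> carrier H \<and> g \<in> carrier H \<and>
     (\<forall>(u, v) \<in> T. ip H v f = ip H u g)}"

definition symmetric_op :: "'a inner_module \<Rightarrow> 'a operator \<Rightarrow> bool" where
  "symmetric_op H T \<longleftrightarrow> (\<forall>(f, f') \<in> T. \<forall>(g, g') \<in> T. ip H f' g = ip H f g')"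

definition self_adjoint :: "'a inner_module \<Rightarrow> 'a operator \<Rightarrow> bool" where
  "self_adjoint H A \<longleftrightarrow> lin_op H A \<and> densely_defined H A \<and> adjoint_op H A = A"

definition resolvent_set :: "'a inner_module \<Rightarrow> 'a operator \<Rightarrow> complex set" where
  "resolvent_set H T = {z.
     bij_betw (\<lambda>f. app T f \<ominus>\<^bsub>H\<^esub> z \<odot>\<^bsub>H\<^esub> f) (Domain T) (carrier H) \<and>
     (\<exists>C. \<forall>f \<in> Domain T. hnorm H f \<le> C * hnorm H (app T f \<ominus>\<^bsub>H\<^esub> z \<odot>\<^bsub>H\<^esub> f))}"

definition resolvent :: "'a inner_module \<Rightarrow> 'a operator \<Rightarrow> complex \<Rightarrow> 'a \<Rightarrow> 'a" where
  "resolvent H T z = inv_into (Domain T) (\<lambda>f. app T f \<ominus>\<^bsub>H\<^esub> z \<odot>\<^bsub>H\<^esub> f)"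

definition defect_space :: "'a inner_module \<Rightarrow> 'a operator \<Rightarrow> complex \<Rightarrow> 'a set" where
  "defect_space H Adot z =
     {f \<in> Domain (adjoint_op H Adot). app (adjoint_op H Adot) f \<ominus>\<^bsub>H\<^esub> z \<odot>\<^bsub>H\<^esub> f = \<zero>\<^bsub>H\<^esub>}"

definition one_dimensional :: "'a inner_module \<Rightarrow> 'a set \<Rightarrow> bool" where
  "one_dimensional H N \<longleftrightarrow>
     (\<exists>g \<in> carrier H. g \<noteq> \<zero>\<^bsub>H\<^esub> \<and> N = {c \<odot>\<^bsub>H\<^esub> g | c. c \<in> UNIV})"

definition symmetric_11 :: "'a inner_module \<Rightarrow> 'a operator \<Rightarrow> bool" where
  "symmetric_11 H Adot \<longleftrightarrow>
     lin_op H Adot \<and> closed_op H Adot \<and> densely_defined H Adot \<and> symmetric_op H Adot \<and>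
     one_dimensional H (defect_space H Adot \<i>) \<and> one_dimensional H (defect_space H Adot (- \<i>))"

definition dissipative :: "'a inner_module \<Rightarrow> 'a operator \<Rightarrow> bool" where
  "dissipative H T \<longleftrightarrow> lin_op H T \<and> (\<forall>(f, g) \<in> T. 0 \<le> Im (ip H g f))"

definition maximal_dissipative :: "'a inner_module \<Rightarrow> 'a operator \<Rightarrow> bool" where
  "maximal_dissipative H T \<longleftrightarrow>
     dissipative H T \<and> (\<forall>S. dissipative H S \<and> T \<subseteq> S \<longrightarrow> S = T)"

section \<open>The rigged space and its bounded operators\<close>

definition hplus :: "'a inner_module \<Rightarrow> 'a operator \<Rightarrow> 'a inner_module" where
  "hplus H Adot = H\<lparr>carrier := Domain (adjoint_op H Adot),
     ip := \<lambda>f g. ip H f g + ip H (app (adjoint_op H Adot) f) (app (adjoint_op H Adot) g)\<rparr>"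

text \<open>
  An element \<open>\<phi>\<close> of the negative space is represented by the bounded conjugate-linear functional
  \<open>u \<mapsto> (\<phi>, u)\<close> on the positive space, so that the value of \<open>\<phi>\<close> at \<open>u\<close> is \<open>(u, \<phi>) = cnj (\<phi> u)\<close>.
  With this choice the embedding of \<open>H\<close> is linear. Functionals are extended by zero.
\<close>

definition hminus_carrier :: "'a inner_module \<Rightarrow> 'a operator \<Rightarrow> ('a \<Rightarrow> complex) set" where
  "hminus_carrier H Adot = (let P = hplus H Adot in
     {\<phi>. (\<forall>u. u \<notin> carrier P \<longrightarrow> \<phi> u = 0) \<and>
         (\<forall>u \<in> carrier P. \<forall>v \<in> carrier P. \<phi> (u \<oplus>\<^bsub>P\<^esub> v) = \<phi> u + \<phi> v) \<and>
         (\<forall>c. \<forall>u \<in> carrier P. \<phi> (c \<odot>\<^bsub>P\<^esub> u) = cnj c * \<phi> u) \<and>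
         (\<exists>C. \<forall>u \<in> carrier P. cmod (\<phi> u) \<le> C * hnorm P u)})"

definition hminus :: "'a inner_module \<Rightarrow> 'a operator \<Rightarrow> (complex, 'a \<Rightarrow> complex) module" where
  "hminus H Adot = \<lparr>carrier = hminus_carrier H Adot, mult = undefined, one = undefined,
     zero = (\<lambda>u. 0), add = (\<lambda>\<phi> \<psi> u. \<phi> u + \<psi> u), smult = (\<lambda>c \<phi> u. c * \<phi> u)\<rparr>"

definition hminus_norm :: "'a inner_module \<Rightarrow> 'a operator \<Rightarrow> ('a \<Rightarrow> complex) \<Rightarrow> real" where
  "hminus_norm H Adot \<phi> =
     (SUP u \<in> {u \<in> carrier (hplus H Adot). hnorm (hplus H Adot) u \<le> 1}. cmod (\<phi> u))"

definition complex_line :: "(complex, complex) module" where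
  "complex_line = \<lparr>carrier = UNIV, mult = (*), one = 1, zero = 0, add = (+), smult = (*)\<rparr>"

text \<open>Bounded linear operators from \<open>X\<close> to \<open>Y\<close>, normed by \<open>nX\<close> and \<open>nY\<close>. Values off the carrier
  of \<open>X\<close> are unconstrained, so such operators are compared on that carrier only.\<close>

definition bounded_ops :: "(complex, 'a, 'm) module_scheme \<Rightarrow> ('a \<Rightarrow> real) \<Rightarrow>
    (complex, 'b, 'n) module_scheme \<Rightarrow> ('b \<Rightarrow> real) \<Rightarrow> ('a \<Rightarrow> 'b) set" where
  "bounded_ops X nX Y nY = {F.
     (\<forall>x \<in> carrier X. F x \<in> carrier Y) \<and>
     (\<forall>x \<in> carrier X. \<forall>y \<in> carrier X. F (x \<oplus>\<^bsub>X\<^esub> y) = F x \<oplus>\<^bsub>Y\<^esub> F y) \<and>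
     (\<forall>c. \<forall>x \<in> carrier X. F (c \<odot>\<^bsub>X\<^esub> x) = c \<odot>\<^bsub>Y\<^esub> F x) \<and>
     (\<exists>C. \<forall>x \<in> carrier X. nY (F x) \<le> C * nX x)}"

definition bounded_plus_minus ::
    "'a inner_module \<Rightarrow> 'a operator \<Rightarrow> ('a \<Rightarrow> 'a \<Rightarrow> complex) set" where
  "bounded_plus_minus H Adot = bounded_ops (hplus H Adot) (hnorm (hplus H Adot))
     (hminus H Adot) (hminus_norm H Adot)"

definition embed :: "'a inner_module \<Rightarrow> 'a operator \<Rightarrow> 'a \<Rightarrow> ('a \<Rightarrow> complex)" where
  "embed H Adot h = (\<lambda>u. if u \<in> carrier (hplus H Adot) then ip H h u else 0)"

text \<open>The adjoint is determined by \<open>(\<bbbA> f, g) = (f, \<bbbA>\<^sup>* g)\<close> for \<open>f, g\<close> in the positive space, where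
  \<open>(\<bbbA> f, g)\<close> is \<open>\<bbbA> f g\<close> and \<open>(f, \<bbbA>\<^sup>* g)\<close> is \<open>cnj (\<bbbA>\<^sup>* g f)\<close>.\<close>

definition adj_pm :: "'a inner_module \<Rightarrow> 'a operator \<Rightarrow>
    ('a \<Rightarrow> 'a \<Rightarrow> complex) \<Rightarrow> ('a \<Rightarrow> 'a \<Rightarrow> complex)" where
  "adj_pm H Adot B = (\<lambda>g f. if f \<in> carrier (hplus H Adot) then cnj (B f g) else 0)"

definition re_pm :: "'a inner_module \<Rightarrow> 'a operator \<Rightarrow>
    ('a \<Rightarrow> 'a \<Rightarrow> complex) \<Rightarrow> ('a \<Rightarrow> 'a \<Rightarrow> complex)" where
  "re_pm H Adot B = (\<lambda>f u. (B f u + adj_pm H Adot B f u) / 2)"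

definition im_pm :: "'a inner_module \<Rightarrow> 'a operator \<Rightarrow>
    ('a \<Rightarrow> 'a \<Rightarrow> complex) \<Rightarrow> ('a \<Rightarrow> 'a \<Rightarrow> complex)" where
  "im_pm H Adot B = (\<lambda>f u. (B f u - adj_pm H Adot B f u) / (2 * \<i>))"

text \<open>The restriction of \<open>B\<close> to \<open>{f. B f \<in> H}\<close>, as an operator in \<open>H\<close>. It is the quasi-kernel of a
  self-adjoint bi-extension \<open>B\<close>, and the main operator of an L-system with state-space operator
  \<open>B\<close>. An operator \<open>T\<close> in \<open>H\<close> with domain in the positive space satisfies \<open>T \<subset> B\<close> iff its graph is
  contained in this one.\<close>

definition H_restriction ::
    "'a inner_module \<Rightarrow> 'a operator \<Rightarrow> ('a \<Rightarrow> 'a \<Rightarrow> complex) \<Rightarrow> 'a operator" where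
  "H_restriction H Adot B =
     {(f, g). f \<in> carrier (hplus H Adot) \<and> g \<in> carrier H \<and> B f = embed H Adot g}"

definition quasi_kernel ::
    "'a inner_module \<Rightarrow> 'a operator \<Rightarrow> ('a \<Rightarrow> 'a \<Rightarrow> complex) \<Rightarrow> 'a operator" where
  "quasi_kernel = H_restriction"

definition main_operator ::
    "'a inner_module \<Rightarrow> 'a operator \<Rightarrow> ('a \<Rightarrow> 'a \<Rightarrow> complex) \<Rightarrow> 'a operator" where
  "main_operator = H_restriction"

section \<open>L-systems\<close>

definition t_self_adjoint_biextension ::
    "'a inner_module \<Rightarrow> 'a operator \<Rightarrow> ('a \<Rightarrow> 'a \<Rightarrow> complex) \<Rightarrow> bool" where
  "t_self_adjoint_biextension H Adot B \<longleftrightarrow>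
     B \<in> bounded_plus_minus H Adot \<and>
     (\<forall>f \<in> carrier (hplus H Adot). adj_pm H Adot B f = B f) \<and>
     Adot \<subseteq> H_restriction H Adot B \<and>
     self_adjoint H (quasi_kernel H Adot B)"

definition Lambda_class :: "'a inner_module \<Rightarrow> 'a operator \<Rightarrow> 'a operator set" where
  "Lambda_class H Adot = {T. lin_op H T \<and> Adot \<subseteq> T \<and> T \<subseteq> adjoint_op H Adot \<and>
     resolvent_set H T \<noteq> {} \<and> Domain Adot = Domain T \<inter> Domain (adjoint_op H T)}"

definition star_extension ::
    "'a inner_module \<Rightarrow> 'a operator \<Rightarrow> 'a operator \<Rightarrow> ('a \<Rightarrow> 'a \<Rightarrow> complex) \<Rightarrow> bool" where
  "star_extension H Adot T AA \<longleftrightarrow>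
     AA \<in> bounded_plus_minus H Adot \<and>
     Adot \<subseteq> T \<and> T \<subseteq> H_restriction H Adot AA \<and>
     Adot \<subseteq> adjoint_op H T \<and> adjoint_op H T \<subseteq> H_restriction H Adot (adj_pm H Adot AA) \<and>
     t_self_adjoint_biextension H Adot (re_pm H Adot AA)"

text \<open>The adjoint of \<open>K\<close> from the complex numbers to the negative space is determined by
  \<open>(K c, u) = c * cnj (K\<^sup>* u)\<close>.\<close>

definition K_adj :: "(complex \<Rightarrow> 'a \<Rightarrow> complex) \<Rightarrow> 'a \<Rightarrow> complex" where
  "K_adj K = (\<lambda>u. cnj (K 1 u))"

definition L_system :: "'a inner_module \<Rightarrow> 'a operator \<Rightarrow> ('a \<Rightarrow> 'a \<Rightarrow> complex) \<Rightarrow>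
    (complex \<Rightarrow> 'a \<Rightarrow> complex) \<Rightarrow> bool" where
  "L_system H Adot AA K \<longleftrightarrow>
     hilbert_space H \<and> symmetric_11 H Adot \<and>
     (\<exists>T \<in> Lambda_class H Adot. star_extension H Adot T AA) \<and>
     K \<in> bounded_ops complex_line cmod (hminus H Adot) (hminus_norm H Adot) \<and>
     K_adj K \<in> bounded_ops (hplus H Adot) (hnorm (hplus H Adot)) complex_line cmod \<and>
     (\<forall>f \<in> carrier (hplus H Adot). im_pm H Adot AA f = K (K_adj K f)) \<and>
     range K = im_pm H Adot AA ` carrier (hplus H Adot)"

text \<open>\<open>K\<^sup>* (Re \<bbbA> - z I)\<^sup>-\<^sup>1 K\<close> is a linear map on the complex numbers and is identified with its
  value at \<open>1\<close>. For \<open>z\<close> in the resolvent set of the quasi-kernel of \<open>Re \<bbbA>\<close> the map \<open>Re \<bbbA> - z I\<close> is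
  injective and its range contains that of \<open>K\<close>.\<close>

definition impedance :: "'a inner_module \<Rightarrow> 'a operator \<Rightarrow> ('a \<Rightarrow> 'a \<Rightarrow> complex) \<Rightarrow>
    (complex \<Rightarrow> 'a \<Rightarrow> complex) \<Rightarrow> complex \<Rightarrow> complex" where
  "impedance H Adot AA K z =
     K_adj K (inv_into (carrier (hplus H Adot))
       (\<lambda>f u. re_pm H Adot AA f u - z * embed H Adot f u) (K 1))"

section \<open>Hypothesis (H), Weyl-Titchmarsh function, generalized Donoghue class\<close>

definition hypothesis_H :: "'a inner_module \<Rightarrow> 'a operator \<Rightarrow> 'a operator \<Rightarrow> 'a operator \<Rightarrow>
    complex \<Rightarrow> bool" where
  "hypothesis_H H Adot T A \<kappa> \<longleftrightarrow>
     symmetric_11 H Adot \<and>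
     Adot \<subseteq> T \<and> maximal_dissipative H T \<and> T \<noteq> adjoint_op H T \<and>
     Adot \<subseteq> A \<and> self_adjoint H A \<and>
     (\<exists>gp \<in> defect_space H Adot \<i>. \<exists>gm \<in> defect_space H Adot (- \<i>).
        hnorm H gp = 1 \<and> hnorm H gm = 1 \<and>
        gp \<ominus>\<^bsub>H\<^esub> gm \<in> Domain A \<and> gp \<ominus>\<^bsub>H\<^esub> \<kappa> \<odot>\<^bsub>H\<^esub> gm \<in> Domain T)"

text \<open>The value of \<open>M(Adot, A)\<close> at \<open>z\<close> computed from a unit vector \<open>g\<close> of \<open>Ker (Adot\<^sup>* - i I)\<close>, on the
  choice of which it does not depend. The symmetric operator enters through \<open>g\<close> only.\<close>

definition weyl_titchmarsh ::
    "'a inner_module \<Rightarrow> 'a operator \<Rightarrow> 'a \<Rightarrow> complex \<Rightarrow> complex" where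
  "weyl_titchmarsh H A g z =
     (let f = resolvent H A z g in ip H (z \<odot>\<^bsub>H\<^esub> app A f \<oplus>\<^bsub>H\<^esub> f) g)"

definition generalized_Donoghue :: "real \<Rightarrow> (complex \<Rightarrow> complex) set" where
  "generalized_Donoghue \<kappa> = {V.
     V analytic_on {z. 0 < Im z} \<and> V ` {z. 0 < Im z} \<subseteq> {z. 0 < Im z} \<and>
     (\<exists>\<mu> :: real measure. sets \<mu> = sets borel \<and> emeasure \<mu> UNIV = \<infinity> \<and>
        (\<integral>\<^sup>+ t. ennreal (1 / (1 + t\<^sup>2)) \<partial>\<mu>) = ennreal ((1 - \<kappa>) / (1 + \<kappa>)) \<and>
        (\<forall>z. 0 < Im z \<longrightarrow>
           V z = (\<integral>t. 1 / (of_real t - z) - of_real (t / (1 + t\<^sup>2)) \<partial>\<mu>)))}"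

end

theory Submission
  imports Defs
begin

text \<open>
  In \<open>L\<^sup>2(\<mu>)\<close> let \<open>S\<close> be the operator that sends \<open>f\<close> to \<open>t f - c(f)\<close>, defined whenever some
  constant \<open>c(f)\<close> makes this square integrable; \<open>c(f)\<close> is unique because \<open>\<mu>\<close> is infinite. With
  \<open>l(f) = \<integral> (f - c(f) t / (1 + t\<^sup>2)) d\<mu>\<close> one has Green's identity
  \<open>(S f, g) - (f, S g) = l(f) \<cdot> cnj (c(g)) - c(f) \<cdot> cnj (l(g))\<close>, so \<open>(c, l)\<close> is a boundary triple for
  the symmetric operator \<open>Adot = S\<close> on \<open>ker c \<inter> ker l\<close>, whose adjoint is \<open>S\<close>. The defect vector
  \<open>1 / (t - z)\<close> has \<open>c = 1\<close> and \<open>l = V(z)\<close>. The operator \<open>S + (c + \<i> l) l\<^sup>*\<close> from the positive to the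
  negative space has imaginary part \<open>l l\<^sup>*\<close>, the quasi-kernel of its real part is \<open>S\<close> on \<open>ker c\<close>
  (multiplication by \<open>t\<close>), and its main operator is \<open>S\<close> on \<open>ker (c + \<i> l)\<close>; since
  \<open>V(\<i>) = \<i> (1 - \<kappa>) / (1 + \<kappa>)\<close>, the latter has von Neumann parameter \<open>\<kappa>\<close>.
\<close>

text \<open>The shape of \<bbbA> is dictated by Green's identity. Rearranged, it says that
  \<open>(S f, u) + c(f) * cnj (l u)\<close> is a Hermitian form, so a further term
  \<open>\<i> * l(f) * cnj (l u)\<close> contributes exactly a rank-one imaginary part. The
  functional \<open>l\<close> is bounded on the positive space but vanishes on the dense domain of
  the symmetric operator, so it does not come from a vector of the Hilbert space. A value of the
  operator therefore lies in the Hilbert space only if the coefficient of \<open>l\<close> vanishes,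
  and this coefficient is the boundary condition of the restriction. Density is the delicate point:
  it needs the infinite mass of \<mu>, since only cutoffs of large mass repair an integral at small
  cost in norm. With \<open>q = (1 - \<kappa>) / (1 + \<kappa>)\<close> the vectors
  \<open>\<gamma> \<i>\<close> and \<open>\<gamma> (-\<i>)\<close> have boundary values
  \<open>(1, \<i> q)\<close> and \<open>(1, - \<i> q)\<close>. Their difference satisfies
  \<open>c = 0\<close>, while \<open>\<gamma> \<i> - \<kappa> \<gamma> (-\<i>)\<close> has the
  values \<open>(1 - \<kappa>, \<i> q (1 + \<kappa>))\<close>, on which \<open>c + \<i> l\<close>
  vanishes. Both vectors have squared norm \<open>q\<close>; passing to unit vectors produces the
  factor \<open>q\<close> in front of the Weyl-Titchmarsh function.\<close>

section \<open>Inner product spaces and operators\<close>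

context inner_product_space
begin

lemma carrier_complex_ring [simp]: "a \<in> carrier complex_ring"
  by (simp add: complex_ring_def)

lemma ip_minus: "\<lbrakk>x \<in> carrier H; y \<in> carrier H; z \<in> carrier H\<rbrakk>
    \<Longrightarrow> ip H (x \<ominus> y) z = ip H x z - ip H y z"
  using ip_add[of "x \<ominus> y" y z] by (simp add: a_minus_def M.a_assoc M.l_neg)

lemma ip_minus_right: "\<lbrakk>x \<in> carrier H; y \<in> carrier H; z \<in> carrier H\<rbrakk>
    \<Longrightarrow> ip H z (x \<ominus> y) = ip H z x - ip H z y"
  using ip_minus[of x y z] ip_cnj by (metis M.minus_closed complex_cnj_diff)

lemma ip_zero_right: "y \<in> carrier H \<Longrightarrow> ip H y \<zero> = 0"
  using ip_cnj[of "\<zero>" y] by (simp add: ip_zero_left)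

lemmas ip_simps = ip_add ip_add_right ip_smult ip_smult_right ip_minus ip_minus_right
  ip_zero_left ip_zero_right

lemma eq_iff_minus_zero: "\<lbrakk>x \<in> carrier H; y \<in> carrier H\<rbrakk> \<Longrightarrow> x \<ominus> y = \<zero> \<longleftrightarrow> x = y"
  by (metis M.minus_closed M.minus_minus M.minus_equality M.r_neg a_minus_def M.a_inv_closed)

text \<open>Testing against all vectors turns module identities, with their carrier conditions, into
  identities of complex numbers; later vector identities are proved this way.\<close>

lemma eqI_ip:
  assumes "x \<in> carrier H" "y \<in> carrier H" "\<And>u. u \<in> carrier H \<Longrightarrow> ip H x u = ip H y u"
  shows "x = y"
proof -
  have "ip H (x \<ominus> y) (x \<ominus> y) = 0"
    using assms by (simp add: ip_minus)
  then show ?thesis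
    using assms ip_definite[of "x \<ominus> y"] eq_iff_minus_zero by simp
qed

lemma minus_eq_smult: "x \<in> carrier H \<Longrightarrow> y \<in> carrier H \<Longrightarrow> x \<ominus> y = x \<oplus> (-1) \<odot> y"
  by (rule eqI_ip) (auto simp: ip_simps)

text \<open>Shared by the injectivity proofs: two preimages of the same vector under an operator
  minus \<open>z\<close> differ by an eigenvector.\<close>

lemma minus_eq_smult_minus:
  assumes "f \<in> carrier H" "h \<in> carrier H" "f' \<in> carrier H" "h' \<in> carrier H"
    and eq: "h \<ominus> z \<odot> f = h' \<ominus> z \<odot> f'"
  shows "h \<ominus> h' = z \<odot> (f \<ominus> f')"
proof -
  have "ip H h u - z * ip H f u = ip H h' u - z * ip H f' u" if "u \<in> carrier H" for u
    using arg_cong[OF eq, of "\<lambda>x. ip H x u"] assms(1-4) that by (simp add: ip_simps)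
  then show ?thesis
    by (intro eqI_ip) (use assms in \<open>auto simp: ip_simps algebra_simps\<close>)
qed

lemma hnorm_sq: "x \<in> carrier H \<Longrightarrow> ip H x x = complex_of_real ((hnorm H x)\<^sup>2)"
  using ip_self[of x] by (simp add: hnorm_def ip_nonneg)

text \<open>If \<open>x\<close> were nonzero, some \<open>u\<close> in \<open>D\<close> would be
  closer to \<open>x\<close> than \<open>hnorm H x\<close>. Orthogonality makes the squared norm of
  \<open>x\<close> equal to the inner product of \<open>x\<close> with \<open>x - u\<close>, against
  Cauchy-Schwarz.\<close>

lemma ip_dense_zero:
  assumes "htop H closure_of D = carrier H" "x \<in> carrier H" "\<And>u. u \<in> D \<Longrightarrow> ip H x u = 0"
  shows "x = \<zero>"
proof (rule ccontr)
  assume "x \<noteq> \<zero>"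
  interpret Metric_space "carrier H" "hdist H" by (rule Metric_space_hdist)
  have n: "hnorm H x > 0"
    using \<open>x \<noteq> \<zero>\<close> assms hnorm_nonneg[of x] hnorm_eq_0[of x] by simp
  have "x \<in> mtopology closure_of D" using assms by (simp add: htop_def)
  then obtain u where u: "u \<in> D" "u \<in> carrier H" "hdist H x u < hnorm H x"
    using n unfolding metric_closure_of by (auto simp: in_mball)
  have "ip H x (x \<ominus> u) = ip H x x" using u assms by (simp add: ip_minus_right)
  then have "(hnorm H x)\<^sup>2 \<le> hnorm H x * hnorm H (x \<ominus> u)"
    using Cauchy_Schwarz[of x "x \<ominus> u"] assms(2) u(2) hnorm_sq[of x] by (simp add: norm_power)
  also have "\<dots> < hnorm H x * hnorm H x"
    using u assms(2) n by (simp add: hdist_def)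
  finally show False by (simp add: power2_eq_square)
qed

lemma continuous_map_ip:
  assumes "y \<in> carrier H"
  shows "continuous_map (htop H) euclidean (\<lambda>x. ip H x y)"
proof -
  interpret Metric_space "carrier H" "hdist H" by (rule Metric_space_hdist)
  have "\<exists>\<delta>>0. \<forall>x. x \<in> carrier H \<and> hdist H a x < \<delta> \<longrightarrow> dist (ip H a y) (ip H x y) < e"
    if a: "a \<in> carrier H" and e: "e > 0" for a e
  proof (intro exI conjI allI impI)
    \<comment> \<open>The summand 1 keeps the denominator positive when \<open>y\<close> is
      zero.\<close>
    have pos: "hnorm H y + 1 > 0" using hnorm_nonneg[OF assms] by simp
    show "e / (hnorm H y + 1) > 0" using e pos by simp
    fix x assume x: "x \<in> carrier H \<and> hdist H a x < e / (hnorm H y + 1)"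
    have "dist (ip H a y) (ip H x y) = cmod (ip H (a \<ominus> x) y)"
      using a x assms by (simp add: ip_minus dist_norm)
    also have "\<dots> \<le> hnorm H (a \<ominus> x) * hnorm H y"
      using Cauchy_Schwarz a x assms by simp
    also have "\<dots> \<le> hnorm H (a \<ominus> x) * (hnorm H y + 1)"
      using hnorm_nonneg[of "a \<ominus> x"] a x by (intro mult_left_mono) auto
    also have "\<dots> < e"
      using x a pos by (auto simp: hdist_def pos_less_divide_eq)
    finally show "dist (ip H a y) (ip H x y) < e" .
  qed
  then have "continuous_map mtopology Met_TC.mtopology (\<lambda>x. ip H x y)"
    unfolding metric_continuous_map[OF Met_TC.Metric_space_axioms] by simp
  then show ?thesis by (simp add: htop_def)
qed

lemma topspace_htop [simp]: "topspace (htop H) = carrier H"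
  using Metric_space.topspace_mtopology[OF Metric_space_hdist] by (simp add: htop_def)

text \<open>An adjoint is an intersection of zero sets of continuous functions, one for each pair in
  \<open>T\<close>. Conjugation moves the varying vectors into the first argument, where
  \<open>continuous_map_ip\<close> applies.\<close>

lemma closed_op_adjoint:
  assumes "T \<subseteq> carrier H \<times> carrier H"
  shows "closed_op H (adjoint_op H T)"
proof -
  let ?X = "prod_topology (htop H) (htop H)"
  let ?C = "\<lambda>p. {x \<in> topspace ?X. ip H (fst x) (snd p) - ip H (snd x) (fst p) \<in> {0}}"
  have "adjoint_op H T = topspace ?X \<inter> \<Inter> (?C ` T)"
  proof -
    have "ip H v f = ip H u g \<longleftrightarrow> ip H f v - ip H g u = 0"
      if "u \<in> carrier H" "v \<in> carrier H" "f \<in> carrier H" "g \<in> carrier H" for u v f g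
      using ip_cnj[of f v] ip_cnj[of g u] that by auto
    then show ?thesis
      using assms by (fastforce simp: adjoint_op_def)
  qed
  moreover have "closedin ?X (?C p)" if "p \<in> T" for p
  proof (rule closedin_continuous_map_preimage)
    have p: "fst p \<in> carrier H" "snd p \<in> carrier H" using that assms by auto
    show "continuous_map ?X euclidean (\<lambda>x. ip H (fst x) (snd p) - ip H (snd x) (fst p))"
      using continuous_map_compose[OF continuous_map_fst continuous_map_ip[OF p(2)], of "htop H"]
        continuous_map_compose[OF continuous_map_snd continuous_map_ip[OF p(1)], of "htop H"]
      by (intro continuous_map_diff) (simp_all add: o_def)
  qed simp
  \<comment> \<open>The whole space joins the family so that it is nonempty even when
    \<open>T\<close> is empty.\<close>
  moreover have "topspace ?X \<inter> \<Inter> (?C ` T) = \<Inter> (insert (topspace ?X) (?C ` T))" by simp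
  ultimately show ?thesis
    unfolding closed_op_def by (metis (no_types, lifting) closedin_Inter closedin_topspace
        empty_not_insert imageE insertE)
qed

lemma adjoint_op_antimono: "T \<subseteq> T' \<Longrightarrow> adjoint_op H T' \<subseteq> adjoint_op H T"
  by (auto simp: adjoint_op_def)

lemma adjoint_opD: "\<lbrakk>(f, g) \<in> adjoint_op H T; (u, v) \<in> T\<rbrakk> \<Longrightarrow> ip H v f = ip H u g"
  by (auto simp: adjoint_op_def)

end

lemma lin_opD:
  assumes "lin_op H T"
  shows "(f, g) \<in> T \<Longrightarrow> f \<in> carrier H" "(f, g) \<in> T \<Longrightarrow> g \<in> carrier H"
    "(f, g) \<in> T \<Longrightarrow> (f, g') \<in> T \<Longrightarrow> g = g'"
    "(f, g) \<in> T \<Longrightarrow> (f', g') \<in> T \<Longrightarrow> (f \<oplus>\<^bsub>H\<^esub> f', g \<oplus>\<^bsub>H\<^esub> g') \<in> T"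
    "(f, g) \<in> T \<Longrightarrow> (a \<odot>\<^bsub>H\<^esub> f, a \<odot>\<^bsub>H\<^esub> g) \<in> T"
  using assms unfolding lin_op_def single_valued_def by blast+

lemma lin_op_app:
  assumes "lin_op H T" "(f, g) \<in> T"
  shows "app T f = g"
  unfolding app_def using assms lin_opD(3)[OF assms(1)] by (intro the_equality) auto

lemma (in inner_product_space) lin_op_minus:
  assumes "lin_op H T" "(f, g) \<in> T" "(f', g') \<in> T"
  shows "(f \<ominus> f', g \<ominus> g') \<in> T"
proof -
  note L = lin_opD[OF assms(1)]
  have "(f \<oplus> (-1) \<odot> f', g \<oplus> (-1) \<odot> g') \<in> T"
    by (rule L(4)[OF assms(2) L(5)[OF assms(3)]])
  then show ?thesis
    using minus_eq_smult L(1)[OF assms(2)] L(1)[OF assms(3)] L(2)[OF assms(2)] L(2)[OF assms(3)]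
    by simp
qed

section \<open>Boundary triples and their L-systems\<close>

text \<open>
  \<open>S\<close> is the maximal operator, \<open>c\<close> and \<open>l\<close> are the boundary functionals, \<open>\<gamma> z\<close> is the defect
  vector at \<open>z\<close> normalized by \<open>c\<close>, and \<open>l \<circ> \<gamma>\<close> is the Weyl function.
\<close>

locale boundary_triple = hilbert_space H for H :: "'a inner_module" (structure) +
  fixes S :: "'a operator" and c l :: "'a \<Rightarrow> complex" and \<gamma> :: "complex \<Rightarrow> 'a" and q :: real
  assumes lin_S: "lin_op H S"
    and c_add: "\<lbrakk>f \<in> Domain S; g \<in> Domain S\<rbrakk> \<Longrightarrow> c (f \<oplus> g) = c f + c g"
    and l_add: "\<lbrakk>f \<in> Domain S; g \<in> Domain S\<rbrakk> \<Longrightarrow> l (f \<oplus> g) = l f + l g"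
    and c_smult: "f \<in> Domain S \<Longrightarrow> c (a \<odot> f) = a * c f"
    and l_smult: "f \<in> Domain S \<Longrightarrow> l (a \<odot> f) = a * l f"
    and green: "\<lbrakk>(f, f') \<in> S; (g, g') \<in> S\<rbrakk>
      \<Longrightarrow> ip H f' g - ip H f g' = l f * cnj (c g) - c f * cnj (l g)"
    and adjoint_min: "adjoint_op H {(f, g) \<in> S. c f = 0 \<and> l f = 0} = S"
    and dense_min: "htop H closure_of Domain {(f, g) \<in> S. c f = 0 \<and> l f = 0} = carrier H"
    and \<gamma>_S: "Im z \<noteq> 0 \<Longrightarrow> (\<gamma> z, z \<odot> \<gamma> z) \<in> S"
    and c_\<gamma>: "Im z \<noteq> 0 \<Longrightarrow> c (\<gamma> z) = 1"
    and l_\<gamma>_ii: "l (\<gamma> \<i>) = \<i> * of_real q" and l_\<gamma>_mii: "l (\<gamma> (-\<i>)) = - \<i> * of_real q"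
    and q_pos: "q > 0"
    and surj: "\<lbrakk>Im z \<noteq> 0; h \<in> carrier H\<rbrakk>
      \<Longrightarrow> \<exists>f g. (f, g) \<in> S \<and> c f = 0 \<and> g \<ominus> z \<odot> f = h"
begin

text \<open>
  The reference operator is \<open>restr 1 0\<close>, the main operator is \<open>restr 1 \<i>\<close>.
\<close>

definition restr :: "complex \<Rightarrow> complex \<Rightarrow> 'a operator" where
  "restr a b = {(f, g) \<in> S. a * c f + b * l f = 0}"

definition Smin :: "'a operator" where
  "Smin = {(f, g) \<in> S. c f = 0 \<and> l f = 0}"

lemmas S_carrier = lin_opD(1,2)[OF lin_S]
lemmas S_unique = lin_opD(3)[OF lin_S]
lemmas S_add = lin_opD(4)[OF lin_S]
lemmas S_smult = lin_opD(5)[OF lin_S]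
lemmas S_minus = lin_op_minus[OF lin_S]
lemmas S_app = lin_op_app[OF lin_S]

lemma Domain_S_app: "f \<in> Domain S \<Longrightarrow> (f, app S f) \<in> S"
  using S_app by auto

lemma Domain_S_carrier: "f \<in> Domain S \<Longrightarrow> f \<in> carrier H"
  using S_carrier by auto

lemma Domain_S_app_carrier: "f \<in> Domain S \<Longrightarrow> app S f \<in> carrier H"
  using Domain_S_app S_carrier by blast

lemma Domain_S_add: "f \<in> Domain S \<Longrightarrow> g \<in> Domain S \<Longrightarrow> f \<oplus> g \<in> Domain S"
  using S_add by blast

lemma Domain_S_smult: "f \<in> Domain S \<Longrightarrow> a \<odot> f \<in> Domain S"
  using S_smult by blast

lemma app_S_add: "f \<in> Domain S \<Longrightarrow> g \<in> Domain S \<Longrightarrow> app S (f \<oplus> g) = app S f \<oplus> app S g"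
  using S_add Domain_S_app S_app by blast

lemma app_S_smult: "f \<in> Domain S \<Longrightarrow> app S (a \<odot> f) = a \<odot> app S f"
  using S_smult Domain_S_app S_app by blast

lemma zero_S: "(\<zero>, \<zero>) \<in> S"
  using lin_S by (simp add: lin_op_def)

lemma c_minus: "f \<in> Domain S \<Longrightarrow> g \<in> Domain S \<Longrightarrow> c (f \<ominus> g) = c f - c g"
  using c_add[of f "(-1) \<odot> g"] c_smult[of g "-1"] Domain_S_smult[of g "-1"]
  by (simp add: minus_eq_smult Domain_S_carrier)

lemma l_minus: "f \<in> Domain S \<Longrightarrow> g \<in> Domain S \<Longrightarrow> l (f \<ominus> g) = l f - l g"
  using l_add[of f "(-1) \<odot> g"] l_smult[of g "-1"] Domain_S_smult[of g "-1"]
  by (simp add: minus_eq_smult Domain_S_carrier)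

lemma c_zero: "c \<zero> = 0" and l_zero: "l \<zero> = 0"
  using c_smult[of \<zero> 0] l_smult[of \<zero> 0] zero_S smult_r_null[of 0] by auto

lemma adjoint_Smin: "adjoint_op H Smin = S"
  using adjoint_min by (simp add: Smin_def)

section \<open>Extensions cut out by a linear boundary condition, and their adjoints\<close>

lemma Smin_subset_restr: "Smin \<subseteq> restr a b"
  by (auto simp: Smin_def restr_def)

lemma restr_subset_S: "restr a b \<subseteq> S"
  by (auto simp: restr_def)

lemma lin_op_restr: "lin_op H (restr a b)"
  unfolding lin_op_def
proof (intro conjI ballI)
  show "restr a b \<subseteq> carrier H \<times> carrier H"
    using S_carrier by (auto simp: restr_def)
  show "single_valued (restr a b)"
    using S_unique by (auto simp: restr_def single_valued_def)
  show "(\<zero>, \<zero>) \<in> restr a b"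
    by (simp add: restr_def zero_S c_zero l_zero)
  show "case p of (f, g) \<Rightarrow> \<forall>(f', g') \<in> restr a b. (f \<oplus> f', g \<oplus> g') \<in> restr a b"
    if "p \<in> restr a b" for p
  proof (clarsimp split: prod.splits)
    fix f g f' g' assume "p = (f, g)" "(f', g') \<in> restr a b"
    then have *: "(f, g) \<in> S" "(f', g') \<in> S" "a * c f + b * l f = 0" "a * c f' + b * l f' = 0"
      using that by (auto simp: restr_def)
    have "a * c (f \<oplus> f') + b * l (f \<oplus> f') = (a * c f + b * l f) + (a * c f' + b * l f')"
      using * c_add[of f f'] l_add[of f f'] by (auto simp: algebra_simps Domain.DomainI)
    then show "(f \<oplus> f', g \<oplus> g') \<in> restr a b"
      using * S_add by (simp add: restr_def)
  qed
  show "case p of (f, g) \<Rightarrow> \<forall>s. (s \<odot> f, s \<odot> g) \<in> restr a b"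
    if "p \<in> restr a b" for p
  proof (clarsimp split: prod.splits)
    fix f g s assume "p = (f, g)"
    then have *: "(f, g) \<in> S" "a * c f + b * l f = 0"
      using that by (auto simp: restr_def)
    have "a * c (s \<odot> f) + b * l (s \<odot> f) = s * (a * c f + b * l f)"
      using c_smult[OF Domain.DomainI[OF *(1)]] l_smult[OF Domain.DomainI[OF *(1)]]
      by (simp only: distrib_left mult.left_commute)
    then show "(s \<odot> f, s \<odot> g) \<in> restr a b"
      using * S_smult by (simp add: restr_def)
  qed
qed

text \<open>The boundary values \<open>(1, \<i> q)\<close> and \<open>(1, - \<i> q)\<close> of the
  two defect vectors are linearly independent because \<open>q\<close> is not 0, so a combination of
  these vectors attains any pair.\<close>

lemma ex_boundary_values: "\<exists>f \<in> Domain S. c f = x \<and> l f = y"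
proof -
  define s where "s = (x + y / (\<i> * of_real q)) / 2"
  define t where "t = (x - y / (\<i> * of_real q)) / 2"
  have D: "\<gamma> \<i> \<in> Domain S" "\<gamma> (-\<i>) \<in> Domain S"
    using \<gamma>_S[of \<i>] \<gamma>_S[of "-\<i>"] by (auto intro: Domain.DomainI)
  have "c (s \<odot> \<gamma> \<i> \<oplus> t \<odot> \<gamma> (-\<i>)) = x"
    using D c_\<gamma>[of \<i>] c_\<gamma>[of "-\<i>"]
    by (simp add: c_add c_smult Domain_S_smult s_def t_def field_simps)
  moreover have "l (s \<odot> \<gamma> \<i> \<oplus> t \<odot> \<gamma> (-\<i>)) = y"
    using D l_\<gamma>_ii l_\<gamma>_mii q_pos
    by (simp add: l_add l_smult Domain_S_smult s_def t_def field_simps)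
  ultimately show ?thesis using Domain_S_add[OF Domain_S_smult[OF D(1)] Domain_S_smult[OF D(2)]] by blast
qed

text \<open>In terms of boundary values, Green's form is a nondegenerate determinant on a plane, and
  a line is its own complement up to conjugation.\<close>

lemma adjoint_restr:
  assumes "(a, b) \<noteq> (0, 0)"
  shows "adjoint_op H (restr a b) = restr (cnj a) (cnj b)"
proof (intro equalityI subrelI)
  fix f g assume fg: "(f, g) \<in> adjoint_op H (restr a b)"
  then have "(f, g) \<in> S"
    using adjoint_op_antimono[OF Smin_subset_restr] adjoint_Smin by blast
  \<comment> \<open>The pair \<open>(b, - a)\<close> spans the solutions of the boundary condition,
    so this single test vector extracts the conjugate condition on \<open>f\<close>.\<close>
  obtain u where u: "u \<in> Domain S" "c u = b" "l u = - a"
    using ex_boundary_values by blast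
  then have "(u, app S u) \<in> restr a b" using Domain_S_app by (simp add: restr_def)
  then have "ip H (app S u) f = ip H u g" using fg by (rule adjoint_opD[rotated])
  then have "cnj (cnj a * c f + cnj b * l f) = 0"
    using green[OF Domain_S_app[OF u(1)] \<open>(f, g) \<in> S\<close>] u
    by (simp add: algebra_simps add_eq_0_iff)
  then show "(f, g) \<in> restr (cnj a) (cnj b)"
    using \<open>(f, g) \<in> S\<close> unfolding restr_def complex_cnj_zero_iff by simp
next
  fix f g assume fg: "(f, g) \<in> restr (cnj a) (cnj b)"
  then have S: "(f, g) \<in> S" and "cnj (cnj a * c f + cnj b * l f) = 0"
    by (auto simp: restr_def)
  then have eq1: "a * cnj (c f) + b * cnj (l f) = 0" by simp
  have "ip H v f = ip H u g" if "(u, v) \<in> restr a b" for u v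
  proof -
    have uv: "(u, v) \<in> S" "a * c u + b * l u = 0" using that by (auto simp: restr_def)
    \<comment> \<open>Cramer's rule: both multiples of the determinant vanish, and one of
      \<open>a\<close> and \<open>b\<close> is nonzero.\<close>
    have "a * (l u * cnj (c f) - c u * cnj (l f)) =
        l u * (a * cnj (c f) + b * cnj (l f)) - (a * c u + b * l u) * cnj (l f)"
      "b * (l u * cnj (c f) - c u * cnj (l f)) =
        (a * c u + b * l u) * cnj (c f) - c u * (a * cnj (c f) + b * cnj (l f))"
      by (simp_all add: algebra_simps)
    then have "a * (l u * cnj (c f) - c u * cnj (l f)) = 0"
      "b * (l u * cnj (c f) - c u * cnj (l f)) = 0"
      using eq1 uv(2) by simp_all
    then have "l u * cnj (c f) - c u * cnj (l f) = 0" using assms by auto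
    then show ?thesis using green[OF uv(1) S] by simp
  qed
  then show "(f, g) \<in> adjoint_op H (restr a b)"
    using S S_carrier by (auto simp: adjoint_op_def)
qed

text \<open>Green's form vanishes against arbitrary boundary values only if both values of
  \<open>f\<close> are 0. Being an adjoint, \<open>Smin\<close> is then closed.\<close>

lemma adjoint_S: "adjoint_op H S = Smin"
proof (intro equalityI subrelI)
  fix f g assume fg: "(f, g) \<in> adjoint_op H S"
  then have S: "(f, g) \<in> S"
    using adjoint_op_antimono[of Smin S] adjoint_Smin by (auto simp: Smin_def)
  have *: "l u * cnj (c f) - c u * cnj (l f) = 0" if "u \<in> Domain S" for u
    using green[OF Domain_S_app[OF that] S] adjoint_opD[OF fg Domain_S_app[OF that]] by simp
  obtain u where "u \<in> Domain S" "c u = 0" "l u = 1" using ex_boundary_values by blast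
  with * have "c f = 0" by fastforce
  obtain u where "u \<in> Domain S" "c u = 1" "l u = 0" using ex_boundary_values by blast
  with * have "l f = 0" by fastforce
  show "(f, g) \<in> Smin" using S \<open>c f = 0\<close> \<open>l f = 0\<close> by (simp add: Smin_def)
next
  fix f g assume "(f, g) \<in> Smin"
  then have *: "(f, g) \<in> S" "c f = 0" "l f = 0" by (auto simp: Smin_def)
  then show "(f, g) \<in> adjoint_op H S"
    using green[of _ _ f g] S_carrier by (auto simp: adjoint_op_def)
qed

lemma lin_op_Smin: "lin_op H Smin"
proof -
  have "Smin = restr 1 0 \<inter> restr 0 1" by (auto simp: Smin_def restr_def)
  moreover have "lin_op H (A \<inter> B)" if "lin_op H A" "lin_op H B" for A B
    using that unfolding lin_op_def single_valued_def by blast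
  ultimately show ?thesis using lin_op_restr by simp
qed

lemma dense_Smin: "htop H closure_of Domain Smin = carrier H"
  using dense_min by (simp add: Smin_def)

lemma dense_restr: "densely_defined H (restr a b)"
proof -
  have "htop H closure_of Domain (restr a b) \<subseteq> carrier H"
    using closure_of_subset_topspace[of "htop H"] by simp
  moreover have "Domain Smin \<subseteq> Domain (restr a b)"
    using Smin_subset_restr by (rule Domain_mono)
  ultimately show ?thesis
    using closure_of_mono dense_Smin unfolding densely_defined_def by fast
qed

lemma self_adjoint_restr: "self_adjoint H (restr 1 0)"
  using adjoint_restr[of 1 0] by (simp add: self_adjoint_def lin_op_restr dense_restr)

section \<open>Defect vectors and deficiency indices\<close>

lemma eigenvector_c_eq_0:
  assumes "(f, z \<odot> f) \<in> S" "c f = 0" "Im z \<noteq> 0"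
  shows "f = \<zero>"
proof -
  have f: "f \<in> carrier H" using S_carrier assms(1) by blast
  \<comment> \<open>Green's form vanishes on the kernel of \<open>c\<close>, so the operator is
    symmetric there and admits no nonreal eigenvalue.\<close>
  have "(z - cnj z) * ip H f f = 0"
    using green[OF assms(1,1)] assms(2) f by (simp add: ip_simps algebra_simps)
  moreover have "z - cnj z \<noteq> 0" using assms(3) by (simp add: complex_eq_iff)
  ultimately show ?thesis using ip_definite f by simp
qed

text \<open>Subtracting \<open>c f\<close> times \<open>\<gamma> z\<close> from a defect vector
  \<open>f\<close> leaves an eigenvector in the kernel of \<open>c\<close>, which must be
  zero.\<close>

lemma defect_space_eq:
  assumes "Im z \<noteq> 0"
  shows "defect_space H Smin z = {a \<odot> \<gamma> z | a. a \<in> UNIV}"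
proof -
  have mem: "f \<in> defect_space H Smin z \<longleftrightarrow> (f, z \<odot> f) \<in> S" for f
  proof -
    have "app S f \<ominus> z \<odot> f = \<zero> \<longleftrightarrow> (f, z \<odot> f) \<in> S" if "f \<in> Domain S"
      using that Domain_S_app[OF that] S_app[of f "z \<odot> f"]
      by (auto simp: eq_iff_minus_zero[OF Domain_S_app_carrier smult_closed] Domain_S_carrier)
    then show ?thesis
      unfolding defect_space_def adjoint_Smin by blast
  qed
  have g: "(\<gamma> z, z \<odot> \<gamma> z) \<in> S" "\<gamma> z \<in> carrier H" using \<gamma>_S[OF assms] S_carrier by auto
  show ?thesis
  proof (intro equalityI subsetI)
    fix f assume "f \<in> defect_space H Smin z"
    then have f: "(f, z \<odot> f) \<in> S" "f \<in> carrier H" using mem S_carrier by auto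
    have cg: "(c f \<odot> \<gamma> z, c f \<odot> (z \<odot> \<gamma> z)) \<in> S" using g S_smult by blast
    then have "(f \<ominus> c f \<odot> \<gamma> z, z \<odot> f \<ominus> c f \<odot> (z \<odot> \<gamma> z)) \<in> S" using f S_minus by blast
    moreover have "z \<odot> f \<ominus> c f \<odot> (z \<odot> \<gamma> z) = z \<odot> (f \<ominus> c f \<odot> \<gamma> z)"
      by (rule eqI_ip) (use f g in \<open>auto simp: ip_simps algebra_simps\<close>)
    moreover have "c (f \<ominus> c f \<odot> \<gamma> z) = 0"
      using f g cg c_\<gamma>[OF assms] by (auto simp: c_minus c_smult Domain.DomainI)
    ultimately have "f \<ominus> c f \<odot> \<gamma> z = \<zero>" using eigenvector_c_eq_0 assms by metis
    then show "f \<in> {a \<odot> \<gamma> z | a. a \<in> UNIV}" using f g by (auto simp: eq_iff_minus_zero)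
  next
    fix f assume "f \<in> {a \<odot> \<gamma> z | a. a \<in> UNIV}"
    then obtain a where a: "f = a \<odot> \<gamma> z" by blast
    have "a \<odot> (z \<odot> \<gamma> z) = z \<odot> (a \<odot> \<gamma> z)"
      by (rule eqI_ip) (use g in \<open>auto simp: ip_simps algebra_simps\<close>)
    then show "f \<in> defect_space H Smin z"
      unfolding mem a using S_smult[OF g(1), of a] by simp
  qed
qed

lemma symmetric_11_Smin: "symmetric_11 H Smin"
proof -
  have "one_dimensional H (defect_space H Smin z)" if "Im z \<noteq> 0" for z
    unfolding one_dimensional_def
  proof (intro bexI conjI)
    show "\<gamma> z \<in> carrier H" using \<gamma>_S[OF that] S_carrier by blast
    show "\<gamma> z \<noteq> \<zero>" using c_\<gamma>[OF that] c_zero by auto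
  qed (rule defect_space_eq[OF that])
  moreover have "symmetric_op H Smin"
    unfolding symmetric_op_def Smin_def
  proof (intro ballI, clarify)
    fix f f' g g' assume "(f, f') \<in> S" "(g, g') \<in> S" "c f = 0" "l f = 0"
    then show "ip H f' g = ip H f g'" using green[of f f' g g'] by simp
  qed
  moreover have "closed_op H Smin"
    using closed_op_adjoint[of S] lin_S adjoint_S by (simp add: lin_op_def)
  ultimately show ?thesis
    by (simp add: symmetric_11_def lin_op_Smin densely_defined_def dense_Smin)
qed

section \<open>The positive space and the boundedness of the boundary functionals\<close>

abbreviation P :: "'a inner_module" where
  "P \<equiv> hplus H Smin"

lemma carrier_P [simp]: "carrier P = Domain S"
  by (simp add: hplus_def adjoint_Smin)

lemma add_P [simp]: "f \<oplus>\<^bsub>P\<^esub> g = f \<oplus> g"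
  by (simp add: hplus_def)

lemma smult_P [simp]: "a \<odot>\<^bsub>P\<^esub> f = a \<odot> f"
  by (simp add: hplus_def)

lemma hnorm_P: "hnorm P f = sqrt (Re (ip H f f) + Re (ip H (app S f) (app S f)))"
  by (simp add: hplus_def adjoint_Smin hnorm_def)

lemma hnorm_le_P:
  assumes "f \<in> Domain S"
  shows "hnorm H f \<le> hnorm P f" "hnorm H (app S f) \<le> hnorm P f"
  using ip_nonneg[OF Domain_S_carrier[OF assms]] ip_nonneg[OF Domain_S_app_carrier[OF assms]]
  by (simp_all add: hnorm_P hnorm_def[of H])

lemma hnorm_P_nonneg: "f \<in> Domain S \<Longrightarrow> 0 \<le> hnorm P f"
  using hnorm_le_P(1) hnorm_nonneg Domain_S_carrier order_trans by blast

text \<open>Pairing with a fixed element through Green's identity bounds a boundary functional.\<close>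

lemma green_bound:
  assumes "f \<in> Domain S" "u \<in> Domain S"
  shows "cmod (l f * cnj (c u) - c f * cnj (l u)) \<le> (hnorm H u + hnorm H (app S u)) * hnorm P f"
proof -
  note C = Domain_S_carrier[OF assms(1)] Domain_S_app_carrier[OF assms(1)]
    Domain_S_carrier[OF assms(2)] Domain_S_app_carrier[OF assms(2)]
  have "cmod (ip H (app S f) u - ip H f (app S u)) \<le> cmod (ip H (app S f) u) + cmod (ip H f (app S u))"
    by (rule norm_triangle_ineq4)
  also have "\<dots> \<le> hnorm H (app S f) * hnorm H u + hnorm H f * hnorm H (app S u)"
    using C by (intro add_mono Cauchy_Schwarz)
  also have "\<dots> \<le> hnorm P f * hnorm H u + hnorm P f * hnorm H (app S u)"
    using C hnorm_le_P[OF assms(1)] hnorm_nonneg by (intro add_mono mult_right_mono) auto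
  finally show ?thesis
    using green[OF Domain_S_app[OF assms(1)] Domain_S_app[OF assms(2)]] by (simp add: algebra_simps)
qed

lemma boundary_bound:
  "\<exists>C \<ge> 0. \<forall>f \<in> Domain S. cmod (c f) \<le> C * hnorm P f \<and> cmod (l f) \<le> C * hnorm P f"
proof -
  \<comment> \<open>Green's form against boundary values \<open>(0, 1)\<close> is
    \<open>- c f\<close>; against \<open>(1, 0)\<close>, taken for \<open>v\<close>, it is
    \<open>l f\<close>.\<close>
  obtain u where u: "u \<in> Domain S" "c u = 0" "l u = 1" using ex_boundary_values by blast
  obtain v where v: "v \<in> Domain S" "c v = 1" "l v = 0" using ex_boundary_values by blast
  define D where "D w = hnorm H w + hnorm H (app S w)" for w
  have D: "D w \<ge> 0" if "w \<in> Domain S" for w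
    using that hnorm_nonneg Domain_S_carrier Domain_S_app_carrier by (simp add: D_def)
  have *: "D w * hnorm P f \<le> (D u + D v) * hnorm P f" if "w = u \<or> w = v" "f \<in> Domain S" for w f
    using that D[OF u(1)] D[OF v(1)] hnorm_P_nonneg by (intro mult_right_mono) auto
  show ?thesis
  proof (intro exI conjI ballI)
    show "D u + D v \<ge> 0" using D u v by simp
    show "cmod (c f) \<le> (D u + D v) * hnorm P f" if "f \<in> Domain S" for f
      using green_bound[OF that u(1)] u *[of u f] that by (auto simp: D_def)
    show "cmod (l f) \<le> (D u + D v) * hnorm P f" if "f \<in> Domain S" for f
      using green_bound[OF that v(1)] v *[of v f] that by (auto simp: D_def)
  qed
qed

section \<open>The bi-extensions and the channel operator\<close>

text \<open>
  \<open>biext b\<close> is \<open>S + (c + b l) l\<^sup>*\<close>; for \<open>b = \<i>, 0, - \<i>\<close> this is \<open>\<bbbA>\<close>, its real part and its adjoint.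
\<close>

definition biext :: "complex \<Rightarrow> 'a \<Rightarrow> 'a \<Rightarrow> complex" where
  "biext b f u = (if f \<in> Domain S \<and> u \<in> Domain S
     then ip H (app S f) u + (c f + b * l f) * cnj (l u) else 0)"

text \<open>This is the operator K of the L-system: \<open>s\<close> times the functional given by
  \<open>l\<close>. On the positive space its adjoint is \<open>l\<close> itself.\<close>

definition channel :: "complex \<Rightarrow> 'a \<Rightarrow> complex" where
  "channel s u = (if u \<in> Domain S then s * cnj (l u) else 0)"

lemma hminus_carrierI:
  assumes "\<And>u. u \<notin> Domain S \<Longrightarrow> \<phi> u = 0"
    and "\<And>u v. u \<in> Domain S \<Longrightarrow> v \<in> Domain S \<Longrightarrow> \<phi> (u \<oplus> v) = \<phi> u + \<phi> v"
    and "\<And>a u. u \<in> Domain S \<Longrightarrow> \<phi> (a \<odot> u) = cnj a * \<phi> u"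
    and "\<And>u. u \<in> Domain S \<Longrightarrow> cmod (\<phi> u) \<le> C * hnorm P u"
  shows "\<phi> \<in> carrier (hminus H Smin)"
proof -
  have "\<exists>C. \<forall>u \<in> Domain S. cmod (\<phi> u) \<le> C * hnorm P u" using assms(4) by blast
  then show ?thesis using assms(1-3) by (auto simp: hminus_def hminus_carrier_def Let_def)
qed

lemma hminus_norm_le:
  assumes "C \<ge> 0" "\<And>u. u \<in> Domain S \<Longrightarrow> cmod (\<phi> u) \<le> C * hnorm P u"
  shows "hminus_norm H Smin \<phi> \<le> C"
  unfolding hminus_norm_def
proof (rule cSUP_least)
  have "hnorm P \<zero> = 0" using S_app[OF zero_S] by (simp add: hnorm_P ip_zero_left)
  then show "{u \<in> carrier P. hnorm P u \<le> 1} \<noteq> {}" using zero_S by force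
  fix u assume "u \<in> {u \<in> carrier P. hnorm P u \<le> 1}"
  then have "u \<in> Domain S" "hnorm P u \<le> 1" by auto
  then show "cmod (\<phi> u) \<le> C"
    using assms(2)[of u] mult_left_mono[OF _ assms(1), of "hnorm P u" 1] by simp
qed

lemma biext_bounded: "biext b \<in> bounded_plus_minus H Smin"
proof -
  obtain C where C: "C \<ge> 0" "\<And>f. f \<in> Domain S \<Longrightarrow> cmod (c f) \<le> C * hnorm P f"
    "\<And>f. f \<in> Domain S \<Longrightarrow> cmod (l f) \<le> C * hnorm P f"
    using boundary_bound by blast
  \<comment> \<open>The 1 bounds the term with \<open>S\<close>; the product bounds
    \<open>c + b l\<close> by \<open>C + cmod b * C\<close> and \<open>l\<close> by
    \<open>C\<close>.\<close>
  define D where "D = 1 + (C + cmod b * C) * C"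
  have D: "D \<ge> 0" using C(1) by (simp add: D_def)
  have bound: "cmod (biext b f u) \<le> D * hnorm P f * hnorm P u"
    if "f \<in> Domain S" "u \<in> Domain S" for f u
  proof -
    have "cmod (c f + b * l f) \<le> cmod (c f) + cmod b * cmod (l f)"
      by (metis norm_mult norm_triangle_ineq)
    also have "\<dots> \<le> C * hnorm P f + cmod b * (C * hnorm P f)"
      using C that by (intro add_mono mult_left_mono) auto
    finally have 1: "cmod (c f + b * l f) \<le> (C + cmod b * C) * hnorm P f"
      by (simp add: algebra_simps)
    have "cmod (biext b f u) \<le> cmod (ip H (app S f) u) + cmod (c f + b * l f) * cmod (l u)"
      using that by (simp add: biext_def) (metis complex_mod_cnj norm_mult norm_triangle_ineq)
    also have "\<dots> \<le> hnorm P f * hnorm P u + ((C + cmod b * C) * hnorm P f) * (C * hnorm P u)"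
    proof (intro add_mono)
      have "cmod (ip H (app S f) u) \<le> hnorm H (app S f) * hnorm H u"
        using that by (intro Cauchy_Schwarz Domain_S_app_carrier Domain_S_carrier)
      also have "\<dots> \<le> hnorm P f * hnorm P u"
        using hnorm_le_P that hnorm_P_nonneg hnorm_nonneg Domain_S_carrier by (intro mult_mono) auto
      finally show "cmod (ip H (app S f) u) \<le> hnorm P f * hnorm P u" .
      show "cmod (c f + b * l f) * cmod (l u) \<le> ((C + cmod b * C) * hnorm P f) * (C * hnorm P u)"
        using 1 C that hnorm_P_nonneg by (intro mult_mono) auto
    qed
    also have "\<dots> = D * hnorm P f * hnorm P u" by (simp add: D_def algebra_simps)
    finally show ?thesis .
  qed
  have "biext b f \<in> carrier (hminus H Smin)" if f: "f \<in> Domain S" for f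
  proof (rule hminus_carrierI[where C = "D * hnorm P f"])
    note fc = Domain_S_app_carrier[OF f]
    show "biext b f (u \<oplus> v) = biext b f u + biext b f v" if "u \<in> Domain S" "v \<in> Domain S" for u v
      using f fc that Domain_S_carrier Domain_S_add l_add
      by (simp add: biext_def ip_add_right algebra_simps)
    show "biext b f (a \<odot> u) = cnj a * biext b f u" if "u \<in> Domain S" for u a
      using f fc that Domain_S_carrier Domain_S_smult l_smult
      by (simp add: biext_def ip_smult_right algebra_simps)
  qed (use f bound in \<open>auto simp: biext_def\<close>)
  moreover have "biext b (f \<oplus> g) = biext b f \<oplus>\<^bsub>hminus H Smin\<^esub> biext b g"
    if "f \<in> Domain S" "g \<in> Domain S" for f g
    using that Domain_S_app_carrier Domain_S_carrier
    by (auto simp: fun_eq_iff hminus_def biext_def Domain_S_add app_S_add c_add l_add ip_add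
        algebra_simps simp del: Domain_iff)
  moreover have "biext b (a \<odot> f) = a \<odot>\<^bsub>hminus H Smin\<^esub> biext b f"
    if "f \<in> Domain S" for a f
    using that Domain_S_app_carrier Domain_S_carrier
    by (auto simp: fun_eq_iff hminus_def biext_def Domain_S_smult app_S_smult c_smult l_smult
        ip_smult algebra_simps simp del: Domain_iff)
  moreover have "\<exists>C. \<forall>f \<in> Domain S. hminus_norm H Smin (biext b f) \<le> C * hnorm P f"
    using bound D hnorm_P_nonneg by (intro exI[of _ D] ballI hminus_norm_le) auto
  ultimately show ?thesis
    unfolding bounded_plus_minus_def bounded_ops_def by (auto simp del: Domain_iff)
qed

text \<open>By Green's identity the form \<open>(S f, u) + c(f) * cnj (l u)\<close> equals
  \<open>(f, S u) + l(f) * cnj (c u)\<close>, so it is Hermitian. Taking the adjoint therefore only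
  conjugates the coefficient \<open>b\<close> of the remaining term.\<close>

lemma adj_pm_biext: "adj_pm H Smin (biext b) = biext (cnj b)"
proof (intro ext)
  fix f u
  have "cnj (biext b u f) = biext (cnj b) f u" if "f \<in> Domain S" "u \<in> Domain S"
  proof -
    have "cnj (ip H (app S u) f) = ip H f (app S u)"
      using that by (simp add: ip_cnj[symmetric] Domain_S_app_carrier Domain_S_carrier)
    then show ?thesis
      using green[OF Domain_S_app[OF that(1)] Domain_S_app[OF that(2)]] that
      by (simp add: biext_def algebra_simps)
  qed
  then show "adj_pm H Smin (biext b) f u = biext (cnj b) f u"
    by (auto simp: adj_pm_def biext_def simp del: Domain_iff)
qed

lemma re_pm_biext: "re_pm H Smin (biext \<i>) = biext 0"
  by (auto simp: fun_eq_iff re_pm_def adj_pm_biext biext_def field_simps simp del: Domain_iff)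

lemma im_pm_biext: "f \<in> Domain S \<Longrightarrow> im_pm H Smin (biext \<i>) f = channel (l f)"
  by (auto simp: fun_eq_iff im_pm_def adj_pm_biext biext_def channel_def field_simps
      simp del: Domain_iff)

section \<open>Regular and singular parts of functionals\<close>

lemma embed_Smin: "embed H Smin h = (\<lambda>u. if u \<in> Domain S then ip H h u else 0)"
  by (simp add: embed_def)

lemma H_eqI_Smin:
  assumes "x \<in> carrier H" "y \<in> carrier H" "\<And>u. u \<in> Domain Smin \<Longrightarrow> ip H x u = ip H y u"
  shows "x = y"
proof -
  have "x \<ominus> y = \<zero>"
  proof (rule ip_dense_zero[OF dense_Smin])
    fix u assume u: "u \<in> Domain Smin"
    then have "u \<in> carrier H" using S_carrier by (auto simp: Smin_def)
    then show "ip H (x \<ominus> y) u = 0" using assms u by (simp add: ip_minus)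
  qed (use assms in simp)
  then show ?thesis using assms eq_iff_minus_zero by simp
qed

text \<open>Density makes the functional \<open>l\<close> singular: it vanishes on the dense domain of \<open>Smin\<close>.\<close>

lemma functional_eqD:
  assumes "x \<in> carrier H" "y \<in> carrier H"
    and eq: "\<And>u. u \<in> Domain S \<Longrightarrow> ip H x u + s * cnj (l u) = ip H y u + t * cnj (l u)"
  shows "x = y" "s = t"
proof -
  show "x = y"
  proof (rule H_eqI_Smin[OF assms(1,2)])
    fix u assume "u \<in> Domain Smin"
    then have "u \<in> Domain S" "l u = 0" by (auto simp: Smin_def)
    then show "ip H x u = ip H y u" using eq[of u] by simp
  qed
  obtain u where "u \<in> Domain S" "l u = 1" using ex_boundary_values by blast
  then show "s = t" using eq[of u] \<open>x = y\<close> by simp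
qed

text \<open>The value is a vector of the Hilbert space exactly when the coefficient
  \<open>c f + b * l f\<close> of the singular part is 0. The choices \<open>\<i>\<close>,
  \<open>0\<close> and \<open>- \<i>\<close> of \<open>b\<close> give the main operator, the
  quasi-kernel of the real part, and the adjoint of the main operator.\<close>

lemma H_restriction_biext: "H_restriction H Smin (biext b) = restr 1 b"
proof (intro equalityI subrelI)
  fix f g assume "(f, g) \<in> H_restriction H Smin (biext b)"
  then have f: "f \<in> Domain S" and g: "g \<in> carrier H" and eq: "biext b f = embed H Smin g"
    by (auto simp: H_restriction_def)
  have "ip H (app S f) u + (c f + b * l f) * cnj (l u) = ip H g u + 0 * cnj (l u)"
    if "u \<in> Domain S" for u
    using fun_cong[OF eq, of u] f that by (simp add: biext_def embed_Smin del: Domain_iff)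
  from functional_eqD[OF Domain_S_app_carrier[OF f] g this]
  show "(f, g) \<in> restr 1 b" using Domain_S_app[OF f] by (simp add: restr_def)
next
  fix f g assume "(f, g) \<in> restr 1 b"
  then have *: "(f, g) \<in> S" "c f + b * l f = 0" by (auto simp: restr_def)
  then have "f \<in> Domain S" "g \<in> carrier H" using S_carrier by auto
  then show "(f, g) \<in> H_restriction H Smin (biext b)"
    using * S_app[OF *(1)] by (auto simp: H_restriction_def fun_eq_iff biext_def embed_Smin
        simp del: Domain_iff)
qed

section \<open>The main operator is maximal dissipative\<close>

lemma restr_1_0: "(f, g) \<in> restr 1 0 \<longleftrightarrow> (f, g) \<in> S \<and> c f = 0"
  by (simp add: restr_def)

text \<open>The boundary condition \<open>c f = - \<i> * l f\<close> turns Green's identity into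
  \<open>Im (ip H g f) = (cmod (l f))\<^sup>2\<close>. Adding \<open>\<i>\<close> to the operator
  raises this imaginary part by the squared norm of \<open>f\<close>, and Cauchy-Schwarz gives the
  bound.\<close>

lemma dissipative_T: "dissipative H (restr 1 \<i>)"
  and T_bound: "(f, g) \<in> restr 1 \<i> \<Longrightarrow> hnorm H f \<le> hnorm H (g \<ominus> (-\<i>) \<odot> f)"
proof -
  have Im: "Im (ip H g f) \<ge> 0" if "(f, g) \<in> restr 1 \<i>" for f g
  proof -
    have *: "(f, g) \<in> S" "c f = - \<i> * l f"
      using that by (auto simp: restr_def add_eq_0_iff2)
    have "ip H f g = cnj (ip H g f)" using ip_cnj S_carrier[OF *(1)] by blast
    then have "ip H g f - cnj (ip H g f) = 2 * \<i> * (l f * cnj (l f))"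
      using green[OF *(1,1)] by (simp add: *(2) algebra_simps)
    then have "Im (ip H g f - cnj (ip H g f)) = Im (2 * \<i> * of_real ((cmod (l f))\<^sup>2))"
      by (simp only: complex_norm_square[symmetric])
    then show ?thesis by simp
  qed
  then show "dissipative H (restr 1 \<i>)" by (auto simp: dissipative_def lin_op_restr)
  assume fg: "(f, g) \<in> restr 1 \<i>"
  then have C: "f \<in> carrier H" "g \<in> carrier H" using S_carrier by (auto simp: restr_def)
  have "ip H (g \<ominus> (-\<i>) \<odot> f) f = ip H g f + \<i> * of_real ((hnorm H f)\<^sup>2)"
    using C hnorm_sq[of f] by (simp add: ip_simps)
  then have "(hnorm H f)\<^sup>2 \<le> Im (ip H (g \<ominus> (-\<i>) \<odot> f) f)" using Im[OF fg] by simp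
  also have "\<dots> \<le> cmod (ip H (g \<ominus> (-\<i>) \<odot> f) f)" by (rule order_trans[OF abs_ge_self abs_Im_le_cmod])
  also have "\<dots> \<le> hnorm H (g \<ominus> (-\<i>) \<odot> f) * hnorm H f"
    using C by (intro Cauchy_Schwarz) auto
  finally have "hnorm H f * hnorm H f \<le> hnorm H (g \<ominus> (-\<i>) \<odot> f) * hnorm H f"
    by (simp add: power2_eq_square)
  then show "hnorm H f \<le> hnorm H (g \<ominus> (-\<i>) \<odot> f)"
    using C hnorm_nonneg[of f] hnorm_nonneg[of "g \<ominus> (-\<i>) \<odot> f"]
    by (cases "hnorm H f = 0") (auto simp: mult_le_cancel_right)
qed

text \<open>The equation is first solved with the reference condition \<open>c = 0\<close>. Adding a
  multiple of the defect vector at \<open>- \<i>\<close> keeps the right-hand side and adjusts the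
  boundary condition.\<close>

lemma T_surj:
  assumes "h \<in> carrier H"
  shows "\<exists>f g. (f, g) \<in> restr 1 \<i> \<and> g \<ominus> (-\<i>) \<odot> f = h"
proof -
  obtain f0 g0 where f0: "(f0, g0) \<in> S" "c f0 = 0" "h = g0 \<ominus> (-\<i>) \<odot> f0"
    using surj[OF _ assms, of "-\<i>"] by auto
  \<comment> \<open>Since \<open>c + \<i> l\<close> takes the value \<open>1 + q\<close> at
    \<open>\<gamma> (-\<i>)\<close> and \<open>\<i> * l f0\<close> at \<open>f0\<close>, this
    \<open>a\<close> makes the sum vanish; positivity of \<open>q\<close> permits the
    division.\<close>
  define a where "a = - \<i> * l f0 / (1 + of_real q)"
  have q: "1 + of_real q \<noteq> (0 :: complex)"
    using q_pos by (metis add_pos_pos of_real_1 of_real_add of_real_eq_0_iff less_irrefl zero_less_one)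
  have g: "(\<gamma> (-\<i>), (-\<i>) \<odot> \<gamma> (-\<i>)) \<in> S" by (rule \<gamma>_S) simp
  have cg: "c (\<gamma> (-\<i>)) = 1" by (rule c_\<gamma>) simp
  let ?f = "f0 \<oplus> a \<odot> \<gamma> (-\<i>)" and ?g = "g0 \<oplus> a \<odot> ((-\<i>) \<odot> \<gamma> (-\<i>))"
  have fg: "(?f, ?g) \<in> S" using S_add[OF f0(1) S_smult[OF g]] .
  have D: "f0 \<in> Domain S" "\<gamma> (-\<i>) \<in> Domain S" using f0 g by auto
  have "c ?f + \<i> * l ?f = a * (1 + of_real q) + \<i> * l f0"
    using D Domain_S_smult f0 cg l_\<gamma>_mii by (simp add: c_add l_add c_smult l_smult algebra_simps)
  also have "\<dots> = 0" using q by (simp add: a_def)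
  finally have "(?f, ?g) \<in> restr 1 \<i>" using fg by (simp add: restr_def)
  moreover have "?g \<ominus> (-\<i>) \<odot> ?f = h"
    by (rule eqI_ip) (use f0 g S_carrier assms in \<open>auto simp: ip_simps algebra_simps\<close>)
  ultimately show ?thesis by blast
qed

text \<open>Dissipativity makes \<open>- \<i>\<close> a natural point: \<open>T_bound\<close> yields
  injectivity and a bounded inverse, with constant 1, and \<open>T_surj\<close> yields
  surjectivity.\<close>

lemma resolvent_set_T: "- \<i> \<in> resolvent_set H (restr 1 \<i>)"
proof -
  note A = lin_op_app[OF lin_op_restr[of 1 \<i>]]
  have "inj_on (\<lambda>f. app (restr 1 \<i>) f \<ominus> (-\<i>) \<odot> f) (Domain (restr 1 \<i>))"
  proof (rule inj_onI)
    fix f f' assume "f \<in> Domain (restr 1 \<i>)" "f' \<in> Domain (restr 1 \<i>)"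
      and eq: "app (restr 1 \<i>) f \<ominus> (-\<i>) \<odot> f = app (restr 1 \<i>) f' \<ominus> (-\<i>) \<odot> f'"
    then obtain g g' where fg: "(f, g) \<in> restr 1 \<i>" "(f', g') \<in> restr 1 \<i>" by auto
    then have C: "f \<in> carrier H" "g \<in> carrier H" "f' \<in> carrier H" "g' \<in> carrier H"
      using S_carrier by (auto simp: restr_def)
    have eq': "g \<ominus> (-\<i>) \<odot> f = g' \<ominus> (-\<i>) \<odot> f'" using eq A fg by simp
    have "(g \<ominus> g') \<ominus> (-\<i>) \<odot> (f \<ominus> f') = \<zero>"
      using C minus_eq_smult_minus[OF C eq'] by (simp add: eq_iff_minus_zero)
    then have "hnorm H (f \<ominus> f') \<le> hnorm H \<zero>"
      using T_bound[OF lin_op_minus[OF lin_op_restr fg]] by simp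
    then have "hnorm H (f \<ominus> f') = 0"
      using C hnorm_nonneg[of "f \<ominus> f'"] hnorm_eq_0[of \<zero>] by simp
    then show "f = f'" using C hnorm_eq_0[of "f \<ominus> f'"] eq_iff_minus_zero by simp
  qed
  moreover have "(\<lambda>f. app (restr 1 \<i>) f \<ominus> (-\<i>) \<odot> f) ` Domain (restr 1 \<i>) = carrier H"
  proof (intro equalityI subsetI)
    fix h assume "h \<in> carrier H"
    then obtain f g where "(f, g) \<in> restr 1 \<i>" "g \<ominus> (-\<i>) \<odot> f = h" using T_surj by blast
    then show "h \<in> (\<lambda>f. app (restr 1 \<i>) f \<ominus> (-\<i>) \<odot> f) ` Domain (restr 1 \<i>)"
      using A by (intro image_eqI[of _ _ f]) auto
  next
    fix h assume "h \<in> (\<lambda>f. app (restr 1 \<i>) f \<ominus> (-\<i>) \<odot> f) ` Domain (restr 1 \<i>)"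
    then obtain f g where "(f, g) \<in> restr 1 \<i>" "h = g \<ominus> (-\<i>) \<odot> f" using A by auto
    then show "h \<in> carrier H" using S_carrier by (auto simp: restr_def)
  qed
  ultimately show ?thesis
    unfolding resolvent_set_def bij_betw_def using T_bound A
    by (auto intro!: exI[of _ 1])
qed

text \<open>By \<open>T_surj\<close>, a pair of a dissipative extension differs from one of the main
  operator by an eigenvector for \<open>- \<i>\<close>. Dissipativity makes minus its squared norm
  nonnegative, so it is zero.\<close>

lemma maximal_dissipative_T: "maximal_dissipative H (restr 1 \<i>)"
  unfolding maximal_dissipative_def
proof (intro conjI allI impI dissipative_T)
  fix R assume R: "dissipative H R \<and> restr 1 \<i> \<subseteq> R"
  then have lin: "lin_op H R" by (simp add: dissipative_def)
  have "p \<in> restr 1 \<i>" if "p \<in> R" for p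
  proof -
    obtain f g where p: "p = (f, g)" by force
    have C: "f \<in> carrier H" "g \<in> carrier H" using that p lin_opD[OF lin] by auto
    then obtain f' g' where f': "(f', g') \<in> restr 1 \<i>" "g' \<ominus> (-\<i>) \<odot> f' = g \<ominus> (-\<i>) \<odot> f"
      using T_surj[of "g \<ominus> (-\<i>) \<odot> f"] by auto
    have C': "f' \<in> carrier H" "g' \<in> carrier H" using f' S_carrier by (auto simp: restr_def)
    have *: "(f \<ominus> f', g \<ominus> g') \<in> R" using lin_op_minus[OF lin] that p f' R by blast
    have "g \<ominus> g' = (-\<i>) \<odot> (f \<ominus> f')"
      by (rule minus_eq_smult_minus[OF C C' f'(2)[symmetric]])
    moreover have "0 \<le> Im (ip H (g \<ominus> g') (f \<ominus> f'))" using R * by (auto simp: dissipative_def)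
    ultimately have "(hnorm H (f \<ominus> f'))\<^sup>2 \<le> 0"
      using C C' hnorm_sq[of "f \<ominus> f'"] by (simp add: ip_smult)
    then have "f \<ominus> f' = \<zero>" using C C' hnorm_eq_0[of "f \<ominus> f'"] by simp
    then have "f = f'" using C C' eq_iff_minus_zero by simp
    moreover have "(f', g') \<in> R" using f' R by blast
    ultimately have "g = g'" using that p lin_opD(3)[OF lin] by blast
    then show ?thesis using p f' \<open>f = f'\<close> by simp
  qed
  then show "R = restr 1 \<i>" using R by blast
qed

section \<open>The L-system\<close>

lemma Lambda_class_T: "restr 1 \<i> \<in> Lambda_class H Smin"
proof -
  \<comment> \<open>The adjoint of the main operator is \<open>restr 1 (-\<i>)\<close>, and
    \<open>c + \<i> l\<close> and \<open>c - \<i> l\<close> vanish together only where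
    \<open>c\<close> and \<open>l\<close> both do.\<close>
  have "Domain Smin = Domain (restr 1 \<i>) \<inter> Domain (restr 1 (-\<i>))"
    by (force simp: Smin_def restr_def complex_eq_iff)
  then show ?thesis
    using resolvent_set_T
    by (auto simp: Lambda_class_def lin_op_restr adjoint_Smin adjoint_restr
        intro: subsetD[OF Smin_subset_restr] subsetD[OF restr_subset_S])
qed

lemma star_extension_T: "star_extension H Smin (restr 1 \<i>) (biext \<i>)"
  by (simp add: star_extension_def t_self_adjoint_biextension_def biext_bounded Smin_subset_restr
      adjoint_restr H_restriction_biext adj_pm_biext re_pm_biext quasi_kernel_def
      self_adjoint_restr)

lemma L_system: "L_system H Smin (biext \<i>) channel"
proof -
  obtain C where C: "C \<ge> 0" "\<And>f. f \<in> Domain S \<Longrightarrow> cmod (c f) \<le> C * hnorm P f"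
    "\<And>f. f \<in> Domain S \<Longrightarrow> cmod (l f) \<le> C * hnorm P f"
    using boundary_bound by blast
  have b: "cmod (channel s u) \<le> (C * cmod s) * hnorm P u" if "u \<in> Domain S" for s u
    using mult_left_mono[OF C(3)[OF that], of "cmod s"] that
    by (simp add: channel_def norm_mult mult_ac del: Domain_iff)
  have "channel s \<in> carrier (hminus H Smin)" for s
    by (rule hminus_carrierI[OF _ _ _ b])
      (auto simp: channel_def Domain_S_add Domain_S_smult l_add l_smult algebra_simps
        simp del: Domain_iff)
  moreover have "hminus_norm H Smin (channel s) \<le> C * cmod s" for s
    by (rule hminus_norm_le[OF _ b]) (use C in auto)
  ultimately have "channel \<in> bounded_ops complex_line cmod (hminus H Smin) (hminus_norm H Smin)"
    by (auto simp: bounded_ops_def complex_line_def hminus_def channel_def fun_eq_iff algebra_simps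
        simp del: Domain_iff)
  moreover have adj: "K_adj channel u = l u" if "u \<in> Domain S" for u
    using that by (simp add: K_adj_def channel_def del: Domain_iff)
  moreover have "\<exists>C. \<forall>f \<in> Domain S. cmod (l f) \<le> C * hnorm P f" using C by blast
  with adj have "K_adj channel \<in> bounded_ops P (hnorm P) complex_line cmod"
    by (auto simp: bounded_ops_def complex_line_def Domain_S_add Domain_S_smult l_add l_smult
        simp del: Domain_iff)
  \<comment> \<open>The functional \<open>l\<close> attains every complex value, so the imaginary
    part reaches the whole range of the channel.\<close>
  moreover have "im_pm H Smin (biext \<i>) ` Domain S = range channel"
    using ex_boundary_values im_pm_biext by (auto simp: image_iff simp del: Domain_iff) metis
  ultimately show ?thesis
    unfolding L_system_def
    using symmetric_11_Smin hilbert_space_axioms Lambda_class_T star_extension_T im_pm_biext adj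
    by (auto simp del: Domain_iff)
qed

section \<open>Hypothesis (H), impedance and Weyl-Titchmarsh function\<close>

lemma ip_\<gamma>:
  assumes "z = \<i> \<or> z = - \<i>"
  shows "ip H (\<gamma> z) (\<gamma> z) = of_real q"
proof -
  have z: "Im z \<noteq> 0" using assms by auto
  have g: "\<gamma> z \<in> carrier H" using \<gamma>_S[OF z] S_carrier by blast
  show ?thesis
    \<comment> \<open>Green's identity for \<open>\<gamma> z\<close> with itself:
      \<open>z - cnj z\<close> times the squared norm equals
      \<open>l (\<gamma> z) - cnj (l (\<gamma> z))\<close>.\<close>
    using green[OF \<gamma>_S[OF z] \<gamma>_S[OF z]] assms g l_\<gamma>_ii l_\<gamma>_mii c_\<gamma>[OF z]
    by (auto simp: ip_simps algebra_simps)
qed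

text \<open>Everything is read off from boundary values: those of \<open>gp - \<kappa> gm\<close>
  are proportional to \<open>(1 - \<kappa>, \<i> q (1 + \<kappa>))\<close>, and the value of
  \<open>q\<close> makes them satisfy \<open>l = \<i> * c\<close>, that is
  \<open>c + \<i> l = 0\<close>.\<close>

lemma hypothesis_H:
  assumes "\<kappa> < 1" "0 \<le> \<kappa>" "q = (1 - \<kappa>) / (1 + \<kappa>)"
  shows "hypothesis_H H Smin (restr 1 \<i>) (restr 1 0) (of_real \<kappa>)"
proof -
  \<comment> \<open>The squared norm of both defect vectors is \<open>q\<close>, so this factor
    normalizes them.\<close>
  define n where "n = complex_of_real (1 / sqrt q)"
  have g: "\<gamma> \<i> \<in> carrier H" "\<gamma> (-\<i>) \<in> carrier H" and D: "\<gamma> \<i> \<in> Domain S" "\<gamma> (-\<i>) \<in> Domain S"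
    using \<gamma>_S[of \<i>] \<gamma>_S[of "-\<i>"] S_carrier by auto
  have cl: "c (\<gamma> \<i>) = 1" "c (\<gamma> (-\<i>)) = 1" using c_\<gamma> by auto
  define gp where "gp = n \<odot> \<gamma> \<i>"
  define gm where "gm = n \<odot> \<gamma> (-\<i>)"
  have norm: "hnorm H (n \<odot> \<gamma> z) = 1" if "z = \<i> \<or> z = - \<i>" for z
  proof -
    have gz: "\<gamma> z \<in> carrier H" using that g by auto
    have "ip H (n \<odot> \<gamma> z) (n \<odot> \<gamma> z) = of_real (1 / sqrt q * (1 / sqrt q) * q)"
      using gz ip_\<gamma>[OF that]
      by (simp only: ip_simps smult_closed carrier_complex_ring n_def complex_cnj_complex_of_real
          of_real_mult mult.assoc)
    also have "1 / sqrt q * (1 / sqrt q) * q = 1" using q_pos by (simp add: field_simps)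
    finally show ?thesis by (simp add: hnorm_def)
  qed
  have gpm: "gp \<in> Domain S" "gm \<in> Domain S" using D Domain_S_smult by (auto simp: gp_def gm_def)
  have bv: "c gp = n" "c gm = n" "l gp = n * (\<i> * of_real q)" "l gm = - n * (\<i> * of_real q)"
    using D cl l_\<gamma>_ii l_\<gamma>_mii by (auto simp: gp_def gm_def c_smult l_smult)
  have "c (gp \<ominus> gm) = 0" using gpm bv by (simp add: c_minus)
  moreover have "gp \<ominus> gm \<in> Domain S"
    using S_minus[OF Domain_S_app Domain_S_app] gpm by blast
  ultimately have 1: "gp \<ominus> gm \<in> Domain (restr 1 0)"
    using Domain_S_app by (intro DomainI[of _ "app S (gp \<ominus> gm)"]) (simp add: restr_1_0)
  define w where "w = gp \<ominus> of_real \<kappa> \<odot> gm"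
  have w: "w \<in> Domain S"
    using S_minus[OF Domain_S_app Domain_S_app] gpm Domain_S_smult unfolding w_def by blast
  have cw: "c w = n * of_real (1 - \<kappa>)" and lw: "l w = n * \<i> * of_real (q * (1 + \<kappa>))"
    using gpm bv by (auto simp: w_def c_minus l_minus c_smult l_smult Domain_S_smult algebra_simps)
  have "q * (1 + \<kappa>) = 1 - \<kappa>" using assms by simp
  then have lw: "l w = \<i> * c w" using cw lw by simp
  then have wT: "(w, app S w) \<in> restr 1 \<i>" using Domain_S_app[OF w] by (simp add: restr_def)
  \<comment> \<open>At \<open>w\<close> the adjoint condition reads
    \<open>c - \<i> l = 2 * c w\<close>, nonzero because \<kappa> is less than 1; so
    \<open>w\<close> separates the main operator from its adjoint.\<close>
  have "(w, app S w) \<notin> restr 1 (-\<i>)"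
    using lw cw q_pos assms by (simp add: restr_def n_def)
  then have "restr 1 \<i> \<noteq> adjoint_op H (restr 1 \<i>)" using wT by (auto simp: adjoint_restr)
  moreover have "gp \<in> defect_space H Smin \<i>" "gm \<in> defect_space H Smin (-\<i>)"
    by (auto simp: defect_space_eq gp_def gm_def)
  moreover have "hnorm H gp = 1" "hnorm H gm = 1" using norm by (auto simp: gp_def gm_def)
  moreover have "gp \<ominus> of_real \<kappa> \<odot> gm \<in> Domain (restr 1 \<i>)"
    using wT unfolding w_def by (rule DomainI)
  ultimately show ?thesis
    unfolding hypothesis_H_def
    using symmetric_11_Smin Smin_subset_restr maximal_dissipative_T self_adjoint_restr 1 by blast
qed

text \<open>The preimage of \<open>channel 1\<close> is explicit: at \<open>\<gamma> z\<close> the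
  regular part \<open>S - z\<close> vanishes and the singular part has coefficient
  \<open>c = 1\<close>. The adjoint channel then evaluates \<open>l\<close> there.\<close>

lemma impedance:
  assumes z: "Im z \<noteq> 0"
  shows "impedance H Smin (biext \<i>) channel z = l (\<gamma> z)"
proof -
  have D: "\<gamma> z \<in> Domain S" using \<gamma>_S[OF z] by blast
  let ?F = "\<lambda>f u. biext 0 f u - z * embed H Smin f u"
  have "inj_on ?F (Domain S)"
  proof (rule inj_onI)
    fix f g assume f: "f \<in> Domain S" and g: "g \<in> Domain S" and eq: "?F f = ?F g"
    note C = Domain_S_carrier[OF f] Domain_S_app_carrier[OF f] Domain_S_carrier[OF g]
      Domain_S_app_carrier[OF g]
    have "ip H (app S f \<ominus> z \<odot> f) u + c f * cnj (l u) = ip H (app S g \<ominus> z \<odot> g) u + c g * cnj (l u)"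
      if "u \<in> Domain S" for u
      using fun_cong[OF eq, of u] that f g C Domain_S_carrier[OF that]
      by (simp add: biext_def embed_Smin ip_simps algebra_simps del: Domain_iff)
    \<comment> \<open>Regular and singular parts agree separately, so \<open>f - g\<close> is an
      eigenvector in the kernel of \<open>c\<close>.\<close>
    then have eq': "app S f \<ominus> z \<odot> f = app S g \<ominus> z \<odot> g" "c f = c g"
      using functional_eqD[of "app S f \<ominus> z \<odot> f" "app S g \<ominus> z \<odot> g" "c f" "c g"] C by auto
    have "app S f \<ominus> app S g = z \<odot> (f \<ominus> g)"
      by (rule minus_eq_smult_minus[OF C eq'(1)])
    then have "(f \<ominus> g, z \<odot> (f \<ominus> g)) \<in> S"
      using S_minus[OF Domain_S_app[OF f] Domain_S_app[OF g]] by simp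
    moreover have "c (f \<ominus> g) = 0" using f g eq' by (simp add: c_minus)
    ultimately show "f = g" using eigenvector_c_eq_0 z C eq_iff_minus_zero by metis
  qed
  moreover have "?F (\<gamma> z) = channel 1"
    using D S_app[OF \<gamma>_S[OF z]] c_\<gamma>[OF z] Domain_S_carrier[OF D] Domain_S_carrier
    by (auto simp: fun_eq_iff biext_def embed_Smin channel_def ip_smult simp del: Domain_iff)
  ultimately have "inv_into (Domain S) ?F (channel 1) = \<gamma> z"
    using D by (intro inv_into_f_eq)
  then show ?thesis
    using D by (simp add: impedance_def re_pm_biext K_adj_def channel_def del: Domain_iff)
qed

text \<open>The resolvent applied to \<open>g = a \<gamma>(\<i>)\<close> satisfies
  \<open>(z - \<i>) f = a (\<gamma> z - \<gamma> \<i>)\<close>, which determines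
  \<open>(z - \<i>) * l f\<close>. Green's identity for \<open>f\<close> and \<open>g\<close>
  converts \<open>l f\<close> into the inner product of \<open>f\<close> and \<open>g\<close>, and
  the normalization \<open>a * cnj a * q = 1\<close> cancels the remaining constants.\<close>

lemma weyl_titchmarsh:
  assumes z: "0 < Im z" and g: "g \<in> defect_space H Smin \<i>" "hnorm H g = 1"
  shows "l (\<gamma> z) = of_real q * weyl_titchmarsh H (restr 1 0) g z"
proof -
  obtain a where a: "g = a \<odot> \<gamma> \<i>" using g by (auto simp: defect_space_eq)
  have zi: "Im z \<noteq> 0" "Im \<i> \<noteq> 0" using z by auto
  note G = \<gamma>_S[OF zi(1)] \<gamma>_S[OF zi(2)]
  have C: "\<gamma> z \<in> carrier H" "\<gamma> \<i> \<in> carrier H" "g \<in> carrier H" using G S_carrier a by auto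
  have D: "\<gamma> z \<in> Domain S" "\<gamma> \<i> \<in> Domain S" using G by auto
  note A = lin_op_app[OF lin_op_restr[of 1 0]]
  have inj: "inj_on (\<lambda>f. app (restr 1 0) f \<ominus> z \<odot> f) (Domain (restr 1 0))"
  proof (rule inj_onI)
    fix f f' assume "f \<in> Domain (restr 1 0)" "f' \<in> Domain (restr 1 0)"
      and eq: "app (restr 1 0) f \<ominus> z \<odot> f = app (restr 1 0) f' \<ominus> z \<odot> f'"
    then obtain h h' where fh: "(f, h) \<in> restr 1 0" "(f', h') \<in> restr 1 0" by auto
    then have S: "(f, h) \<in> S" "(f', h') \<in> S" "c f = 0" "c f' = 0" by (auto simp: restr_1_0)
    note C = S_carrier[OF S(1)] S_carrier[OF S(2)]
    have eq': "h \<ominus> z \<odot> f = h' \<ominus> z \<odot> f'" using eq A fh by simp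
    have "h \<ominus> h' = z \<odot> (f \<ominus> f')"
      by (rule minus_eq_smult_minus[OF C eq'])
    then have "(f \<ominus> f', z \<odot> (f \<ominus> f')) \<in> S" using S_minus[OF S(1,2)] by simp
    moreover have "c (f \<ominus> f') = 0" using S by (auto simp: c_minus Domain.DomainI)
    ultimately show "f = f'" using eigenvector_c_eq_0 zi C eq_iff_minus_zero by metis
  qed
  obtain f h where f: "(f, h) \<in> S" "c f = 0" "h \<ominus> z \<odot> f = g"
    using surj[OF zi(1) C(3)] by blast
  have fA: "(f, h) \<in> restr 1 0" using f by (simp add: restr_1_0)
  have res: "resolvent H (restr 1 0) z g = f"
    unfolding resolvent_def using fA A[OF fA] f(3) by (intro inv_into_f_eq[OF inj]) auto
  have Cf: "f \<in> carrier H" "h \<in> carrier H" using f S_carrier by auto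
  have ip_h: "ip H h u = z * ip H f u + ip H g u" if "u \<in> carrier H" for u
    using arg_cong[OF f(3), of "\<lambda>x. ip H x u"] Cf that by (simp add: ip_simps algebra_simps)
  \<comment> \<open>The resolvent formula is kept multiplied by \<open>z - \<i>\<close> and never
    divided, so the case \<open>z = \<i>\<close> is included.\<close>
  define w where "w = (z - \<i>) \<odot> f \<ominus> (a \<odot> \<gamma> z \<ominus> a \<odot> \<gamma> \<i>)"
  have "(w, (z - \<i>) \<odot> h \<ominus> (a \<odot> (z \<odot> \<gamma> z) \<ominus> a \<odot> (\<i> \<odot> \<gamma> \<i>))) \<in> S"
    unfolding w_def by (intro S_minus S_smult f G)
  moreover have "(z - \<i>) \<odot> h \<ominus> (a \<odot> (z \<odot> \<gamma> z) \<ominus> a \<odot> (\<i> \<odot> \<gamma> \<i>)) = z \<odot> w"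
    by (rule eqI_ip) (use C Cf a in \<open>auto simp: ip_simps ip_h w_def algebra_simps\<close>)
  moreover have Df: "f \<in> Domain S" "a \<odot> \<gamma> z \<in> Domain S" "a \<odot> \<gamma> \<i> \<in> Domain S" "(z - \<i>) \<odot> f \<in> Domain S"
    "a \<odot> \<gamma> z \<ominus> a \<odot> \<gamma> \<i> \<in> Domain S"
    using f(1) S_smult[OF f(1)] S_smult[OF G(1)] S_smult[OF G(2)]
      S_minus[OF S_smult[OF G(1)] S_smult[OF G(2)]] by blast+
  moreover have "c w = 0"
    using Df D f c_\<gamma>[OF zi(1)] c_\<gamma>[OF zi(2)] by (simp add: w_def c_minus c_smult del: Domain_iff)
  ultimately have "w = \<zero>" using eigenvector_c_eq_0 zi by metis
  then have "l w = 0" using l_zero by simp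
  then have lf: "(z - \<i>) * l f = a * (l (\<gamma> z) - \<i> * of_real q)"
    using Df D l_\<gamma>_ii by (simp add: w_def l_minus l_smult algebra_simps del: Domain_iff)
  have gg: "ip H g g = 1" using hnorm_sq[OF C(3)] g(2) by simp
  have aq: "a * cnj a * of_real q = 1"
    using gg C ip_\<gamma>[of \<i>] by (simp add: a ip_simps mult_ac)
  have "(g, \<i> \<odot> g) \<in> S"
  proof -
    have "a \<odot> (\<i> \<odot> \<gamma> \<i>) = \<i> \<odot> g"
      by (rule eqI_ip) (use C in \<open>auto simp: ip_simps a algebra_simps\<close>)
    then show ?thesis using S_smult[OF G(2), of a] by (simp add: a)
  qed
  moreover have "c g = a" using D c_\<gamma>[OF zi(2)] by (simp add: a c_smult)
  ultimately have "ip H h g - ip H f (\<i> \<odot> g) = l f * cnj a"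
    using green[OF f(1), of g "\<i> \<odot> g"] f(2) by simp
  then have X: "(z + \<i>) * ip H f g + 1 = l f * cnj a"
    using ip_h[OF C(3)] gg C Cf by (simp add: ip_simps algebra_simps)
  \<comment> \<open>Substituting \<open>h = z f + g\<close> produces \<open>z\<^sup>2 + 1\<close>,
    factored here so that \<open>X\<close> and \<open>lf\<close> can be applied one after the
    other.\<close>
  have "of_real q * ip H (z \<odot> h \<oplus> f) g = of_real q * (z + (z - \<i>) * ((z + \<i>) * ip H f g))"
    using ip_h[OF C(3)] gg C Cf by (simp add: ip_simps algebra_simps)
  also have "(z + \<i>) * ip H f g = l f * cnj a - 1" using X by (simp add: algebra_simps)
  also have "of_real q * (z + (z - \<i>) * (l f * cnj a - 1)) =
      of_real q * (\<i> + ((z - \<i>) * l f) * cnj a)"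
    by (simp add: algebra_simps)
  also have "\<dots> = of_real q * \<i> + (a * cnj a * of_real q) * (l (\<gamma> z) - \<i> * of_real q)"
    unfolding lf by (simp add: algebra_simps)
  also have "\<dots> = l (\<gamma> z)" unfolding aq by (simp add: algebra_simps)
  finally show ?thesis
    by (simp add: weyl_titchmarsh_def res A[OF fA])
qed

text \<open>This isolates what the measure has to provide: a boundary triple with Weyl function
  \<open>V\<close> on the upper half-plane and with the right \<open>q\<close>.\<close>

theorem realization:
  assumes "0 \<le> \<kappa>" "\<kappa> < 1" "q = (1 - \<kappa>) / (1 + \<kappa>)" "\<And>z. 0 < Im z \<Longrightarrow> l (\<gamma> z) = V z"
  shows "\<exists>Adot AA K.
     L_system H Adot AA K \<and>
     hypothesis_H H Adot (main_operator H Adot AA) (quasi_kernel H Adot (re_pm H Adot AA))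
       (complex_of_real \<kappa>) \<and>
     (\<forall>z. 0 < Im z \<longrightarrow>
        V z = impedance H Adot AA K z \<and>
        (\<forall>g \<in> defect_space H Adot \<i>. hnorm H g = 1 \<longrightarrow>
           impedance H Adot AA K z =
             complex_of_real ((1 - \<kappa>) / (1 + \<kappa>)) *
             weyl_titchmarsh H (quasi_kernel H Adot (re_pm H Adot AA)) g z))"
proof (rule exI[of _ Smin], rule exI[of _ "biext \<i>"], rule exI[of _ channel], intro conjI allI impI ballI)
  show "L_system H Smin (biext \<i>) channel" by (rule L_system)
  show "hypothesis_H H Smin (main_operator H Smin (biext \<i>))
      (quasi_kernel H Smin (re_pm H Smin (biext \<i>))) (complex_of_real \<kappa>)"
    using hypothesis_H assms
    by (simp add: main_operator_def quasi_kernel_def re_pm_biext H_restriction_biext)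
  fix z assume z: "0 < Im z"
  show "V z = impedance H Smin (biext \<i>) channel z" using impedance z assms(4) by simp
  show "impedance H Smin (biext \<i>) channel z =
      complex_of_real ((1 - \<kappa>) / (1 + \<kappa>)) *
      weyl_titchmarsh H (quasi_kernel H Smin (re_pm H Smin (biext \<i>))) g z"
    if "g \<in> defect_space H Smin \<i>" "hnorm H g = 1" for g
    using weyl_titchmarsh[OF z that] impedance z assms(3)
    by (simp add: quasi_kernel_def re_pm_biext H_restriction_biext)
qed

end

section \<open>The Hilbert space of square integrable functions\<close>

definition L2_fun :: "'a measure \<Rightarrow> ('a \<Rightarrow> complex) set" where
  "L2_fun M = {f \<in> borel_measurable M. integrable M (\<lambda>t. (cmod (f t))\<^sup>2)}"

definition AE_class :: "'a measure \<Rightarrow> ('a \<Rightarrow> complex) \<Rightarrow> ('a \<Rightarrow> complex) set" where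
  "AE_class M f = {g \<in> borel_measurable M. AE t in M. g t = f t}"

text \<open>The operations on classes go through a chosen member; by \<open>rep_AE_class\<close> the
  choice matters only on a null set.\<close>

definition rep :: "'a set \<Rightarrow> 'a" where
  "rep X = (SOME f. f \<in> X)"

definition L2 :: "'a measure \<Rightarrow> ('a \<Rightarrow> complex) set inner_module" where
  "L2 M = \<lparr>carrier = AE_class M ` L2_fun M, mult = undefined, one = undefined,
     zero = AE_class M (\<lambda>t. 0), add = (\<lambda>X Y. AE_class M (\<lambda>t. rep X t + rep Y t)),
     smult = (\<lambda>a X. AE_class M (\<lambda>t. a * rep X t)),
     ip = (\<lambda>X Y. \<integral>t. rep X t * cnj (rep Y t) \<partial>M)\<rparr>"

lemma L2_fun_bound:
  assumes "f \<in> borel_measurable M" "integrable M h" "AE t in M. (cmod (f t))\<^sup>2 \<le> h t"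
  shows "f \<in> L2_fun M"
proof -
  have "integrable M (\<lambda>t. (cmod (f t))\<^sup>2)"
    by (rule Bochner_Integration.integrable_bound[OF assms(2)]) (use assms in auto)
  then show ?thesis using assms by (simp add: L2_fun_def)
qed

lemma L2_fun_sq: "f \<in> L2_fun M \<Longrightarrow> integrable M (\<lambda>t. (cmod (f t))\<^sup>2)"
  by (simp add: L2_fun_def)

lemma cmod_add_sq: "(cmod (x + y))\<^sup>2 \<le> 2 * (cmod x)\<^sup>2 + 2 * (cmod y)\<^sup>2"
proof -
  have "(cmod (x + y))\<^sup>2 \<le> (cmod x + cmod y)\<^sup>2" by (intro power_mono norm_triangle_ineq) auto
  then show ?thesis using sum_squares_bound[of "cmod x" "cmod y"] by (simp add: power2_sum)
qed

lemma L2_fun_add: "f \<in> L2_fun M \<Longrightarrow> g \<in> L2_fun M \<Longrightarrow> (\<lambda>t. f t + g t) \<in> L2_fun M"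
  by (rule L2_fun_bound[where h = "\<lambda>t. 2 * (cmod (f t))\<^sup>2 + 2 * (cmod (g t))\<^sup>2"])
    (auto simp: cmod_add_sq L2_fun_def)

lemma L2_fun_mult_bounded:
  assumes "f \<in> L2_fun M" "k \<in> borel_measurable M" "\<And>t. cmod (k t) \<le> C"
  shows "(\<lambda>t. k t * f t) \<in> L2_fun M"
proof (rule L2_fun_bound[where h = "\<lambda>t. C\<^sup>2 * (cmod (f t))\<^sup>2"])
  show "AE t in M. (cmod (k t * f t))\<^sup>2 \<le> C\<^sup>2 * (cmod (f t))\<^sup>2"
    using assms(3) by (auto simp: norm_mult power_mult_distrib intro!: mult_right_mono power_mono)
qed (use assms in \<open>auto simp: L2_fun_def\<close>)

lemma L2_fun_cmult: "f \<in> L2_fun M \<Longrightarrow> (\<lambda>t. a * f t) \<in> L2_fun M"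
  by (rule L2_fun_mult_bounded[where C = "cmod a"]) auto

lemma L2_fun_diff: "f \<in> L2_fun M \<Longrightarrow> g \<in> L2_fun M \<Longrightarrow> (\<lambda>t. f t - g t) \<in> L2_fun M"
  using L2_fun_add[of f M "\<lambda>t. - 1 * g t"] L2_fun_cmult[of g M "-1"] by simp

lemma L2_fun_zero: "(\<lambda>t. 0) \<in> L2_fun M"
  by (simp add: L2_fun_def)

lemma L2_fun_cong_AE:
  assumes "f \<in> L2_fun M" "g \<in> borel_measurable M" "AE t in M. g t = f t"
  shows "g \<in> L2_fun M"
  by (rule L2_fun_bound[OF assms(2) L2_fun_sq[OF assms(1)]]) (use assms(3) in auto)

lemma borel_measurable_cnj [measurable]:
  "f \<in> borel_measurable M \<Longrightarrow> (\<lambda>t. cnj (f t)) \<in> borel_measurable M"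
  by (rule borel_measurable_continuous_on[where f = cnj]) (intro continuous_intros)

lemma L2_fun_prod_integrable:
  assumes "f \<in> L2_fun M" "g \<in> L2_fun M"
  shows "integrable M (\<lambda>t. f t * cnj (g t))"
proof (rule Bochner_Integration.integrable_bound)
  show "integrable M (\<lambda>t. (cmod (f t))\<^sup>2 + (cmod (g t))\<^sup>2)"
    using assms by (auto simp: L2_fun_sq)
  have "cmod x * cmod y \<le> (cmod x)\<^sup>2 + (cmod y)\<^sup>2" for x y
  proof -
    have "0 \<le> cmod x * cmod y" by simp
    then show ?thesis using sum_squares_bound[of "cmod x" "cmod y"] unfolding mult.assoc by linarith
  qed
  then show "AE t in M. norm (f t * cnj (g t)) \<le> norm ((cmod (f t))\<^sup>2 + (cmod (g t))\<^sup>2)"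
    by (auto simp: norm_mult)
  have [measurable]: "f \<in> borel_measurable M" "g \<in> borel_measurable M"
    using assms by (auto simp: L2_fun_def)
  show "(\<lambda>t. f t * cnj (g t)) \<in> borel_measurable M"
    by simp
qed

lemma AE_class_eq_iff:
  assumes "f \<in> borel_measurable M" "g \<in> borel_measurable M"
  shows "AE_class M f = AE_class M g \<longleftrightarrow> (AE t in M. f t = g t)"
proof
  assume "AE_class M f = AE_class M g"
  then have "f \<in> AE_class M g" using assms by (auto simp: AE_class_def)
  then show "AE t in M. f t = g t" by (simp add: AE_class_def)
next
  assume *: "AE t in M. f t = g t"
  have "(AE t in M. h t = f t) \<longleftrightarrow> (AE t in M. h t = g t)" for h
    using * by (auto elim: AE_mp)
  then show "AE_class M f = AE_class M g" by (auto simp: AE_class_def)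
qed

lemma rep_AE_class:
  assumes "f \<in> borel_measurable M"
  shows "rep (AE_class M f) \<in> borel_measurable M" "AE t in M. rep (AE_class M f) t = f t"
proof -
  have "f \<in> AE_class M f" using assms by (simp add: AE_class_def)
  then have "rep (AE_class M f) \<in> AE_class M f" 
    unfolding rep_def by (rule someI[where P = "\<lambda>h. h \<in> AE_class M f"])
  then show "rep (AE_class M f) \<in> borel_measurable M" "AE t in M. rep (AE_class M f) t = f t"
    by (auto simp: AE_class_def)
qed

lemma carrier_L2: "carrier (L2 M) = AE_class M ` L2_fun M"
  and zero_L2: "\<zero>\<^bsub>L2 M\<^esub> = AE_class M (\<lambda>t. 0)"
  by (simp_all add: L2_def)

lemma AE_class_in_L2: "f \<in> L2_fun M \<Longrightarrow> AE_class M f \<in> carrier (L2 M)"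
  by (simp add: carrier_L2)

lemma add_L2:
  assumes "f \<in> L2_fun M" "g \<in> L2_fun M"
  shows "AE_class M f \<oplus>\<^bsub>L2 M\<^esub> AE_class M g = AE_class M (\<lambda>t. f t + g t)"
proof -
  have [measurable]: "f \<in> borel_measurable M" "g \<in> borel_measurable M"
    using assms by (auto simp: L2_fun_def)
  note [measurable] = rep_AE_class(1)
  have "AE t in M. rep (AE_class M f) t + rep (AE_class M g) t = f t + g t"
    using rep_AE_class(2)[of f M] rep_AE_class(2)[of g M] by (auto elim: AE_mp)
  then show ?thesis by (simp add: L2_def AE_class_eq_iff)
qed

lemma smult_L2:
  assumes "f \<in> L2_fun M"
  shows "a \<odot>\<^bsub>L2 M\<^esub> AE_class M f = AE_class M (\<lambda>t. a * f t)"
proof -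
  have [measurable]: "f \<in> borel_measurable M"
    using assms by (auto simp: L2_fun_def)
  note [measurable] = rep_AE_class(1)
  have "AE t in M. a * rep (AE_class M f) t = a * f t"
    using rep_AE_class(2)[of f M] by (auto elim: AE_mp)
  then show ?thesis by (simp add: L2_def AE_class_eq_iff)
qed

lemma ip_L2:
  assumes "f \<in> L2_fun M" "g \<in> L2_fun M"
  shows "ip (L2 M) (AE_class M f) (AE_class M g) = (\<integral>t. f t * cnj (g t) \<partial>M)"
proof -
  have [measurable]: "f \<in> borel_measurable M" "g \<in> borel_measurable M"
    using assms by (auto simp: L2_fun_def)
  note [measurable] = rep_AE_class(1)
  have "AE t in M. rep (AE_class M f) t * cnj (rep (AE_class M g) t) = f t * cnj (g t)"
    using rep_AE_class(2)[of f M] rep_AE_class(2)[of g M] by (auto elim: AE_mp)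
  then show ?thesis
    unfolding L2_def by (auto intro!: integral_cong_AE)
qed

lemma ip_L2_self:
  "f \<in> L2_fun M \<Longrightarrow>
    ip (L2 M) (AE_class M f) (AE_class M f) = of_real (\<integral>t. (cmod (f t))\<^sup>2 \<partial>M)"
  unfolding ip_L2 complex_norm_square[symmetric] integral_complex_of_real ..

section \<open>Inner product and completeness of the space of classes\<close>

lemma cring_complex_ring: "cring complex_ring"
proof (rule cringI)
  show "abelian_group complex_ring"
    by (rule abelian_groupI) (auto simp: complex_ring_def intro: exI[of _ "- _"] add.left_inverse)
  show "comm_monoid complex_ring"
    by (rule comm_monoidI) (auto simp: complex_ring_def)
qed (auto simp: complex_ring_def algebra_simps)

lemma inner_product_space_L2: "inner_product_space (L2 M)"
proof -
  note L = L2_fun_add L2_fun_cmult L2_fun_zero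
  have "abelian_group (L2 M)"
  proof (rule abelian_groupI)
    fix x assume "x \<in> carrier (L2 M)"
    then obtain f where f: "f \<in> L2_fun M" "x = AE_class M f" by (auto simp: carrier_L2)
    then show "\<exists>y \<in> carrier (L2 M). y \<oplus>\<^bsub>L2 M\<^esub> x = \<zero>\<^bsub>L2 M\<^esub>"
      using L2_fun_cmult[of f M "-1"]
      by (intro bexI[of _ "AE_class M (\<lambda>t. -1 * f t)"]) (auto simp: add_L2 zero_L2 carrier_L2)
  qed (auto simp: carrier_L2 zero_L2 add_L2 L algebra_simps)
  then have "Module.module complex_ring (L2 M)"
    by (intro moduleI cring_complex_ring)
      (auto simp: carrier_L2 smult_L2 add_L2 L complex_ring_def algebra_simps)
  then show ?thesis
  proof (intro inner_product_space.intro inner_product_space_axioms.intro)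
    fix x y z a assume x: "x \<in> carrier (L2 M)" and y: "y \<in> carrier (L2 M)"
    then obtain f g where f: "f \<in> L2_fun M" "x = AE_class M f"
      and g: "g \<in> L2_fun M" "y = AE_class M g" by (auto simp: carrier_L2)
    show "ip (L2 M) (a \<odot>\<^bsub>L2 M\<^esub> x) y = a * ip (L2 M) x y"
      using f g by (simp add: smult_L2 ip_L2 L mult.assoc)
    have "(\<integral>t. g t * cnj (f t) \<partial>M) = (\<integral>t. cnj (f t * cnj (g t)) \<partial>M)"
      by (intro Bochner_Integration.integral_cong) (simp_all add: mult.commute)
    then show "ip (L2 M) y x = cnj (ip (L2 M) x y)"
      using f g by (simp only: ip_L2 Bochner_Integration.integral_cnj)
    assume "z \<in> carrier (L2 M)"
    then obtain h where h: "h \<in> L2_fun M" "z = AE_class M h" by (auto simp: carrier_L2)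
    show "ip (L2 M) (x \<oplus>\<^bsub>L2 M\<^esub> y) z = ip (L2 M) x z + ip (L2 M) y z"
      using f g h by (simp add: add_L2 ip_L2 L distrib_right L2_fun_prod_integrable)
  next
    fix x assume "x \<in> carrier (L2 M)"
    then obtain f where f: "f \<in> L2_fun M" "x = AE_class M f" by (auto simp: carrier_L2)
    have eq: "ip (L2 M) x x = of_real (\<integral>t. (cmod (f t))\<^sup>2 \<partial>M)"
      using f by (simp add: ip_L2_self)
    show "0 \<le> Re (ip (L2 M) x x)" unfolding eq by simp
    assume "ip (L2 M) x x = 0"
    then have "(\<integral>t. (cmod (f t))\<^sup>2 \<partial>M) = 0" unfolding eq by simp
    then have "AE t in M. (cmod (f t))\<^sup>2 = 0"
      using integral_nonneg_eq_0_iff_AE[OF L2_fun_sq[OF f(1)]] by simp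
    then show "x = \<zero>\<^bsub>L2 M\<^esub>" using f by (simp add: zero_L2 AE_class_eq_iff L2_fun_def)
  qed
qed

lemma minus_L2:
  assumes "f \<in> L2_fun M" "g \<in> L2_fun M"
  shows "AE_class M f \<ominus>\<^bsub>L2 M\<^esub> AE_class M g = AE_class M (\<lambda>t. f t - g t)"
proof -
  interpret inner_product_space "L2 M" by (rule inner_product_space_L2)
  show ?thesis
    using assms L2_fun_cmult[OF assms(2), of "-1"]
    by (simp add: minus_eq_smult AE_class_in_L2 smult_L2 add_L2)
qed

lemma hdist_L2:
  assumes "f \<in> L2_fun M" "g \<in> L2_fun M"
  shows "hdist (L2 M) (AE_class M f) (AE_class M g) = sqrt (\<integral>t. (cmod (f t - g t))\<^sup>2 \<partial>M)"
proof -
  note ip_L2_self[OF L2_fun_diff[OF assms]]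
  then show ?thesis
    using assms by (simp add: hdist_def AE_class_in_L2 minus_L2 hnorm_def)
qed

text \<open>The weights \<open>4 ^ k\<close> turn a bound on the sum of squares into geometric decay of the increments.\<close>

lemma convergent_of_geometric_bound:
  fixes x :: "nat \<Rightarrow> complex"
  assumes "(\<Sum>k. ennreal (4 ^ k * (cmod (x (Suc k) - x k))\<^sup>2)) \<noteq> \<infinity>"
  shows "convergent x"
proof -
  define C where "C = enn2real (\<Sum>k. ennreal (4 ^ k * (cmod (x (Suc k) - x k))\<^sup>2))"
  have "(\<Sum>k. ennreal (4 ^ k * (cmod (x (Suc k) - x k))\<^sup>2)) = ennreal C"
    using assms by (simp add: C_def ennreal_enn2real_if)
  then have "(\<Sum>i\<in>{k}. ennreal (4 ^ i * (cmod (x (Suc i) - x i))\<^sup>2)) \<le> ennreal C" for k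
    using sum_le_suminf[of "\<lambda>k. ennreal (4 ^ k * (cmod (x (Suc k) - x k))\<^sup>2)" "{k}"] by simp
  then have "ennreal (4 ^ k * (cmod (x (Suc k) - x k))\<^sup>2) \<le> ennreal C" for k
    by simp
  moreover have "C \<ge> 0" by (simp add: C_def)
  ultimately have "4 ^ k * (cmod (x (Suc k) - x k))\<^sup>2 \<le> C" for k
    by (metis ennreal_le_iff)
  moreover have "(2 ^ k)\<^sup>2 = (4 :: real) ^ k" for k
    by (simp add: power2_eq_square flip: power_mult_distrib)
  ultimately have "(2 ^ k * cmod (x (Suc k) - x k))\<^sup>2 \<le> C" for k
    by (simp add: power_mult_distrib)
  then have "2 ^ k * cmod (x (Suc k) - x k) \<le> sqrt C" for k
    by (rule real_le_rsqrt)
  then have bound: "cmod (x (Suc k) - x k) \<le> sqrt C * (1 / 2) ^ k" for k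
    by (simp add: power_divide pos_le_divide_eq mult.commute)
  have geometric: "summable (\<lambda>k. sqrt C * (1 / 2) ^ k)"
    by (intro summable_mult summable_geometric) simp
  have "summable (\<lambda>k. x (Suc k) - x k)"
    by (rule summable_comparison_test'[OF geometric, where N = 0]) (rule bound)
  then have "convergent (\<lambda>n. \<Sum>k<n. x (Suc k) - x k)"
    by (simp add: summable_iff_convergent)
  then have "convergent (\<lambda>n. x n - x 0)"
    by (simp add: sum_lessThan_telescope)
  then show ?thesis
    using convergent_add[OF _ convergent_const[of "x 0"]] by fastforce
qed

text \<open>A subsequence with rapidly decaying increments converges almost everywhere by the
  preceding criterion. Fatou's lemma then shows that the whole sequence tends to this limit in mean
  square.\<close>

lemma Riesz_Fischer:
  fixes f :: "nat \<Rightarrow> 'a \<Rightarrow> complex"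
  assumes f: "\<And>n. f n \<in> L2_fun M"
    and cauchy: "\<And>e. e > 0 \<Longrightarrow> \<exists>N. \<forall>m \<ge> N. \<forall>n \<ge> N. (\<integral>t. (cmod (f m t - f n t))\<^sup>2 \<partial>M) < e"
  shows "\<exists>g \<in> L2_fun M. \<forall>e > 0. \<exists>N. \<forall>n \<ge> N. (\<integral>t. (cmod (f n t - g t))\<^sup>2 \<partial>M) < e"
proof -
  have [measurable]: "f n \<in> borel_measurable M" for n using f by (simp add: L2_fun_def)
  \<comment> \<open>The rate \<open>(1 / 8) ^ k\<close> leaves the summable
    \<open>(1 / 2) ^ k\<close> after multiplication by the weight \<open>4 ^ k\<close>.\<close>
  obtain N where N: "\<And>k m n. m \<ge> N k \<Longrightarrow> n \<ge> N k \<Longrightarrow> (\<integral>t. (cmod (f m t - f n t))\<^sup>2 \<partial>M) < (1 / 8) ^ k"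
  proof -
    have "\<forall>k. \<exists>N. \<forall>m \<ge> N. \<forall>n \<ge> N. (\<integral>t. (cmod (f m t - f n t))\<^sup>2 \<partial>M) < (1 / 8) ^ k"
      using cauchy by simp
    then show ?thesis using that by metis
  qed
  \<comment> \<open>Partial sums give indices that increase with \<open>k\<close> and still dominate
    each \<open>N k\<close>.\<close>
  define r where "r k = (\<Sum>i\<le>k. N i)" for k
  have rN: "N k \<le> r k" for k unfolding r_def by (rule member_le_sum) auto
  have r_mono: "r j \<le> r k" if "j \<le> k" for j k
    unfolding r_def by (rule sum_mono2) (use that in auto)
  have nn: "(\<integral>\<^sup>+t. ennreal ((cmod (f m t - f n t))\<^sup>2) \<partial>M) \<le> ennreal ((1 / 8) ^ k)"
    if "m \<ge> r k" "n \<ge> r k" for k m n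
  proof -
    have "m \<ge> N k" "n \<ge> N k" using rN[of k] that by auto
    then show ?thesis
      using N[of k m n] nn_integral_eq_integral[OF L2_fun_sq[OF L2_fun_diff[OF f[of m] f[of n]]]]
      by (simp add: ennreal_leI)
  qed
  have "(\<integral>\<^sup>+t. (\<Sum>k. ennreal (4 ^ k * (cmod (f (r (Suc k)) t - f (r k) t))\<^sup>2)) \<partial>M) =
      (\<Sum>k. \<integral>\<^sup>+t. ennreal (4 ^ k * (cmod (f (r (Suc k)) t - f (r k) t))\<^sup>2) \<partial>M)"
    by (rule nn_integral_suminf) simp
  also have "\<dots> \<le> (\<Sum>k. ennreal ((1 / 2) ^ k))"
  proof (rule suminf_le)
    fix k
    have "(\<integral>\<^sup>+t. ennreal (4 ^ k * (cmod (f (r (Suc k)) t - f (r k) t))\<^sup>2) \<partial>M) =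
        ennreal (4 ^ k) * (\<integral>\<^sup>+t. ennreal ((cmod (f (r (Suc k)) t - f (r k) t))\<^sup>2) \<partial>M)"
      by (simp add: ennreal_mult nn_integral_cmult)
    also have "\<dots> \<le> ennreal (4 ^ k) * ennreal ((1 / 8) ^ k)"
      by (intro mult_left_mono nn r_mono) auto
    also have "\<dots> = ennreal ((1 / 2) ^ k)"
      by (simp add: ennreal_mult[symmetric] power_mult_distrib[symmetric])
    finally show "(\<integral>\<^sup>+t. ennreal (4 ^ k * (cmod (f (r (Suc k)) t - f (r k) t))\<^sup>2) \<partial>M)
        \<le> ennreal ((1 / 2) ^ k)" .
  qed auto
  also have "\<dots> = ennreal (\<Sum>k. (1 / 2) ^ k)"
    by (rule suminf_ennreal2) (auto intro: summable_geometric)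
  also have "\<dots> < \<infinity>" by simp
  finally have "AE t in M. (\<Sum>k. ennreal (4 ^ k * (cmod (f (r (Suc k)) t - f (r k) t))\<^sup>2)) \<noteq> \<infinity>"
    by (intro nn_integral_noteq_infinite) auto
  then have conv: "AE t in M. convergent (\<lambda>k. f (r k) t)"
    using convergent_of_geometric_bound[of "\<lambda>k. f (r k) _"] by (auto elim!: AE_mp)
  define g where "g t = lim (\<lambda>k. f (r k) t)" for t
  have [measurable]: "g \<in> borel_measurable M"
    unfolding g_def by (rule borel_measurable_lim_metric) simp
  have bound: "(\<integral>\<^sup>+t. ennreal ((cmod (f n t - g t))\<^sup>2) \<partial>M) \<le> ennreal ((1 / 8) ^ k)"
    if "n \<ge> r k" for n k
  proof -
    have "(\<integral>\<^sup>+t. ennreal ((cmod (f n t - g t))\<^sup>2) \<partial>M) =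
        (\<integral>\<^sup>+t. liminf (\<lambda>j. ennreal ((cmod (f n t - f (r j) t))\<^sup>2)) \<partial>M)"
    proof (rule nn_integral_cong_AE)
      show "AE t in M. ennreal ((cmod (f n t - g t))\<^sup>2) =
          liminf (\<lambda>j. ennreal ((cmod (f n t - f (r j) t))\<^sup>2))"
        using conv
      proof eventually_elim
        case (elim t)
        then have "(\<lambda>j. f (r j) t) \<longlonglongrightarrow> g t" by (simp add: g_def convergent_LIMSEQ_iff)
        then have "(\<lambda>j. ennreal ((cmod (f n t - f (r j) t))\<^sup>2)) \<longlonglongrightarrow> ennreal ((cmod (f n t - g t))\<^sup>2)"
          by (intro tendsto_intros)
        then show ?case by (intro lim_imp_Liminf[symmetric]) auto
      qed
    qed
    \<comment> \<open>Fatou's lemma carries the uniform estimate between late members over to the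
      limit.\<close>
    also have "\<dots> \<le> liminf (\<lambda>j. \<integral>\<^sup>+t. ennreal ((cmod (f n t - f (r j) t))\<^sup>2) \<partial>M)"
      by (rule nn_integral_liminf) simp
    also have "\<dots> \<le> liminf (\<lambda>j. ennreal ((1 / 8) ^ k))"
    proof (rule Liminf_mono)
      show "\<forall>\<^sub>F j in sequentially. (\<integral>\<^sup>+t. ennreal ((cmod (f n t - f (r j) t))\<^sup>2) \<partial>M) \<le> ennreal ((1 / 8) ^ k)"
        using eventually_ge_at_top[of k] by eventually_elim (intro nn that r_mono)
    qed
    also have "\<dots> = ennreal ((1 / 8) ^ k)" by (simp add: Liminf_const)
    finally show ?thesis .
  qed
  have diff: "(\<lambda>t. f n t - g t) \<in> L2_fun M" if "n \<ge> r k" for n k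
  proof -
    have "(\<integral>\<^sup>+t. ennreal (norm ((cmod (f n t - g t))\<^sup>2)) \<partial>M) < \<infinity>"
      using order_le_less_trans[OF bound[OF that]] by simp
    then have "integrable M (\<lambda>t. (cmod (f n t - g t))\<^sup>2)" by (intro integrableI_bounded) simp_all
    then show ?thesis by (simp add: L2_fun_def)
  qed
  \<comment> \<open>Square integrability is so far known for the differences only; subtracting one
    of them from a member of the sequence recovers \<open>g\<close>.\<close>
  have "(\<lambda>t. f (r 0) t - (f (r 0) t - g t)) \<in> L2_fun M" by (rule L2_fun_diff[OF f diff[of 0]]) simp
  moreover have "(\<lambda>t. f (r 0) t - (f (r 0) t - g t)) = g" by auto
  ultimately have g: "g \<in> L2_fun M" by simp
  show ?thesis
  proof (intro bexI[OF _ g] allI impI)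
    fix e :: real assume "e > 0"
    then obtain k where k: "(1 / 8) ^ k < e" using real_arch_pow_inv[of e "1 / 8"] by auto
    have "(\<integral>t. (cmod (f n t - g t))\<^sup>2 \<partial>M) < e" if "n \<ge> r k" for n
    proof -
      have "ennreal (\<integral>t. (cmod (f n t - g t))\<^sup>2 \<partial>M) \<le> ennreal ((1 / 8) ^ k)"
        using bound[OF that] nn_integral_eq_integral[OF L2_fun_sq[OF diff[OF that]]] by simp
      then show ?thesis using k by (simp add: ennreal_le_iff)
    qed
    then show "\<exists>N. \<forall>n \<ge> N. (\<integral>t. (cmod (f n t - g t))\<^sup>2 \<partial>M) < e" by blast
  qed
qed

lemma hilbert_space_L2: "hilbert_space (L2 M)"
proof -
  interpret inner_product_space "L2 M" by (rule inner_product_space_L2)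
  interpret Metric_space "carrier (L2 M)" "hdist (L2 M)" by (rule Metric_space_hdist)
  have "mcomplete"
    unfolding mcomplete_def
  proof (intro allI impI)
    fix \<sigma> assume \<sigma>: "MCauchy \<sigma>"
    then have "range \<sigma> \<subseteq> carrier (L2 M)"
      unfolding MCauchy_def by blast
    then have "\<forall>n. \<exists>f. f \<in> L2_fun M \<and> \<sigma> n = AE_class M f"
      by (auto simp: carrier_L2)
    then obtain f where f: "\<And>n. f n \<in> L2_fun M" and \<sigma>f: "\<And>n. \<sigma> n = AE_class M (f n)" by metis
    have "\<exists>N. \<forall>m \<ge> N. \<forall>n \<ge> N. (\<integral>t. (cmod (f m t - f n t))\<^sup>2 \<partial>M) < e" if "e > 0" for e
    proof -
      obtain N where "\<And>m n. m \<ge> N \<Longrightarrow> n \<ge> N \<Longrightarrow> hdist (L2 M) (\<sigma> m) (\<sigma> n) < sqrt e"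
      proof -
        have "\<forall>\<epsilon>>0. \<exists>N. \<forall>n n'. N \<le> n \<longrightarrow> N \<le> n' \<longrightarrow> hdist (L2 M) (\<sigma> n) (\<sigma> n') < \<epsilon>"
          using \<sigma> unfolding MCauchy_def by (rule conjunct2)
        moreover have "sqrt e > 0" using \<open>e > 0\<close> by simp
        ultimately show ?thesis using that by blast
      qed
      then show ?thesis by (auto simp: \<sigma>f hdist_L2 f)
    qed
    then obtain g where g: "g \<in> L2_fun M"
      and lim: "\<And>e. e > 0 \<Longrightarrow> \<exists>N. \<forall>n \<ge> N. (\<integral>t. (cmod (f n t - g t))\<^sup>2 \<partial>M) < e"
      using Riesz_Fischer[of f M] f by blast
    have "limitin mtopology \<sigma> (AE_class M g) sequentially"
      unfolding limitin_metric eventually_sequentially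
    proof (intro conjI allI impI)
      fix e :: real assume "e > 0"
      then obtain N where "\<forall>n \<ge> N. (\<integral>t. (cmod (f n t - g t))\<^sup>2 \<partial>M) < e\<^sup>2"
        using lim[of "e\<^sup>2"] by auto
      then have "\<forall>n \<ge> N. hdist (L2 M) (\<sigma> n) (AE_class M g) < e"
        using \<open>e > 0\<close> real_sqrt_less_iff[of _ "e\<^sup>2"] by (simp add: \<sigma>f hdist_L2 f g)
      then show "\<exists>N. \<forall>n \<ge> N. \<sigma> n \<in> carrier (L2 M) \<and> hdist (L2 M) (\<sigma> n) (AE_class M g) < e"
        using AE_class_in_L2[OF f] unfolding \<sigma>f by blast
    qed (use g AE_class_in_L2 in auto)
    then show "\<exists>x. limitin mtopology \<sigma> x sequentially" ..
  qed
  then show ?thesis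
    by (intro hilbert_space.intro hilbert_space_axioms.intro inner_product_space_L2)
qed

section \<open>Multiplication by the independent variable\<close>

locale donoghue_measure =
  fixes \<mu> :: "real measure" and q :: real
  assumes sets_\<mu> [measurable_cong]: "sets \<mu> = sets borel"
    and infinite_\<mu>: "emeasure \<mu> UNIV = \<infinity>"
    and weight: "(\<integral>\<^sup>+t. ennreal (1 / (1 + t\<^sup>2)) \<partial>\<mu>) = ennreal q"
    and q_pos: "q > 0"
begin

text \<open>The functions \<open>r\<close> and \<open>w\<close> are the real and imaginary parts of
  the defect function \<open>G \<i>\<close>.\<close>

definition w :: "real \<Rightarrow> real" where "w t = 1 / (1 + t\<^sup>2)"

definition r :: "real \<Rightarrow> real" where "r t = t / (1 + t\<^sup>2)"

definition G :: "complex \<Rightarrow> real \<Rightarrow> complex" where "G z t = 1 / (of_real t - z)"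

lemma denom_pos: "1 + t\<^sup>2 > (0 :: real)"
  by (simp add: add_pos_nonneg)

lemma w_pos: "w t > 0" and w_le_1: "w t \<le> 1"
  using denom_pos by (auto simp: w_def)

lemma tw: "t * w t = r t"
  by (simp add: w_def r_def)

text \<open>Hence \<open>t * r t - 1\<close> is \<open>- w t\<close>, which is square integrable:
  the unbounded factor \<open>t\<close> applied to \<open>r\<close> leaves just the constant 1 and a
  harmless remainder.\<close>

lemma tr: "t * r t = 1 - w t"
  using denom_pos[of t] by (simp add: w_def r_def field_simps power2_eq_square)

lemma r_sq: "(r t)\<^sup>2 = w t - (w t)\<^sup>2"
proof -
  have "(r t)\<^sup>2 = (t * r t) * w t" by (simp add: power2_eq_square flip: tw)
  then show ?thesis by (simp add: tr algebra_simps power2_eq_square)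
qed

lemma r_sq_le: "(r t)\<^sup>2 \<le> w t" and w_sq_le: "(w t)\<^sup>2 \<le> w t"
  using w_le_1[of t] w_pos[of t] r_sq[of t] by (auto simp: power2_eq_square)

lemma measurable_wrG [measurable]:
  "w \<in> borel_measurable \<mu>" "r \<in> borel_measurable \<mu>" "G z \<in> borel_measurable \<mu>"
  "(\<lambda>t. complex_of_real t) \<in> borel_measurable \<mu>"
  unfolding w_def[abs_def] r_def[abs_def] G_def[abs_def] by measurable

lemma integrable_w: "integrable \<mu> w" and integral_w: "integral\<^sup>L \<mu> w = q"
proof -
  have eq: "(\<integral>\<^sup>+t. ennreal (w t) \<partial>\<mu>) = ennreal q"
    using weight by (simp add: w_def)
  have w0: "w t \<ge> 0" for t using w_pos[of t] by simp
  show "integrable \<mu> w"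
    by (rule integrableI_nn_integral_finite[where x = q]) (simp_all add: eq w0)
  show "integral\<^sup>L \<mu> w = q"
    using q_pos by (intro integral_eq_nn_integral[THEN trans]) (simp_all add: eq w0)
qed

lemma w_L2: "(\<lambda>t. of_real (w t)) \<in> L2_fun \<mu>" and r_L2: "(\<lambda>t. of_real (r t)) \<in> L2_fun \<mu>"
  by (rule L2_fun_bound[OF _ integrable_w]; simp add: w_sq_le r_sq_le)+

lemma denom_ne: "Im z \<noteq> 0 \<Longrightarrow> complex_of_real t - z \<noteq> 0"
  by (auto simp: complex_eq_iff)

lemma Im_le_denom: "\<bar>Im z\<bar> \<le> cmod (complex_of_real t - z)"
  using abs_Im_le_cmod[of "complex_of_real t - z"] by simp

lemma G_bounded: "Im z \<noteq> 0 \<Longrightarrow> cmod (G z t) \<le> 1 / \<bar>Im z\<bar>"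
  using Im_le_denom[of z t] by (auto simp: G_def norm_divide intro!: divide_left_mono mult_pos_pos)

lemma G_L2:
  assumes "Im z \<noteq> 0"
  shows "G z \<in> L2_fun \<mu>"
proof (rule L2_fun_bound)
  \<comment> \<open>The bound wanted is
    \<open>1 + t\<^sup>2 \<le> C * (cmod (t - z))\<^sup>2\<close>. The 2 comes from expanding
    \<open>t\<close> around \<open>Re z\<close>; the leftover constant
    \<open>2 * (Re z)\<^sup>2 + 1\<close> is absorbed by the lower bound
    \<open>(Im z)\<^sup>2\<close>.\<close>
  define C where "C = 2 + (2 * (Re z)\<^sup>2 + 1) / (Im z)\<^sup>2"
  show "integrable \<mu> (\<lambda>t. C * w t)" using integrable_w by simp
  have "(cmod (G z t))\<^sup>2 \<le> C * w t" for t
  proof -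
    have y: "(Im z)\<^sup>2 > 0" using assms by simp
    have n: "(cmod (of_real t - z))\<^sup>2 = (t - Re z)\<^sup>2 + (Im z)\<^sup>2" by (simp add: cmod_power2)
    have "0 \<le> (t - 2 * Re z)\<^sup>2" by simp
    then have "1 + t\<^sup>2 \<le> 2 * (t - Re z)\<^sup>2 + (2 * (Re z)\<^sup>2 + 1)"
      by (simp add: power2_eq_square algebra_simps)
    also have "\<dots> \<le> 2 * ((t - Re z)\<^sup>2 + (Im z)\<^sup>2) +
        (2 * (Re z)\<^sup>2 + 1) / (Im z)\<^sup>2 * ((t - Re z)\<^sup>2 + (Im z)\<^sup>2)"
      using y by (intro add_mono) (simp_all add: distrib_left)
    also have "\<dots> = C * ((t - Re z)\<^sup>2 + (Im z)\<^sup>2)" unfolding C_def by (rule distrib_right[symmetric])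
    finally have "1 + t\<^sup>2 \<le> C * ((t - Re z)\<^sup>2 + (Im z)\<^sup>2)" .
    moreover have "(t - Re z)\<^sup>2 + (Im z)\<^sup>2 > 0" using y by (simp add: add_nonneg_pos)
    ultimately have "1 / ((t - Re z)\<^sup>2 + (Im z)\<^sup>2) \<le> C * w t"
      using denom_pos[of t] by (simp add: w_def field_simps)
    then show ?thesis by (simp add: G_def norm_divide power_divide n)
  qed
  then show "AE t in \<mu>. (cmod (G z t))\<^sup>2 \<le> C * w t" by simp
qed simp

lemma const_L2:
  assumes "(\<lambda>_. a) \<in> L2_fun \<mu>"
  shows "a = 0"
proof (rule ccontr)
  assume "a \<noteq> 0"
  have "(\<integral>\<^sup>+_. ennreal ((cmod a)\<^sup>2) \<partial>\<mu>) < \<infinity>"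
    using assms by (simp add: L2_fun_def integrable_iff_bounded del: nn_integral_const)
  then show False
    using infinite_\<mu> sets_eq_imp_space_eq[OF sets_\<mu>] \<open>a \<noteq> 0\<close> by (simp add: ennreal_mult_top)
qed

section \<open>The maximal operator and its boundary values\<close>

text \<open>
  \<open>maxrel f g a\<close> says that \<open>f\<close> is in the domain of the maximal operator, with value \<open>g\<close> and first
  boundary value \<open>a\<close>. Since \<open>r\<close> is the real part of \<open>1 / (t - \<i>)\<close>, whose first boundary value is
  \<open>1\<close>, subtracting \<open>a r\<close> from \<open>f\<close> makes it integrable.
\<close>

definition maxrel :: "(real \<Rightarrow> complex) \<Rightarrow> (real \<Rightarrow> complex) \<Rightarrow> complex \<Rightarrow> bool" where
  "maxrel f g a \<longleftrightarrow> f \<in> L2_fun \<mu> \<and> g \<in> L2_fun \<mu> \<and> (AE t in \<mu>. g t = of_real t * f t - a)"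

definition S :: "(real \<Rightarrow> complex) set operator" where
  "S = {(AE_class \<mu> f, AE_class \<mu> g) | f g. \<exists>a. maxrel f g a}"

definition c :: "(real \<Rightarrow> complex) set \<Rightarrow> complex" where
  "c X = (THE a. \<exists>f g. X = AE_class \<mu> f \<and> maxrel f g a)"

text \<open>A regularized integral. For the defect function \<open>G z\<close>, whose constant is 1,
  the subtracted term is exactly the one in the integral representation of \<open>V\<close>.\<close>

definition l :: "(real \<Rightarrow> complex) set \<Rightarrow> complex" where
  "l X = (\<integral>t. rep X t - c X * of_real (r t) \<partial>\<mu>)"

definition \<gamma> :: "complex \<Rightarrow> (real \<Rightarrow> complex) set" where
  "\<gamma> z = AE_class \<mu> (G z)"

lemma maxrelD: "maxrel f g a \<Longrightarrow> f \<in> L2_fun \<mu>" "maxrel f g a \<Longrightarrow> g \<in> L2_fun \<mu>"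
  "maxrel f g a \<Longrightarrow> AE t in \<mu>. g t = of_real t * f t - a"
  by (auto simp: maxrel_def)

lemma S_memI: "maxrel f g a \<Longrightarrow> (AE_class \<mu> f, AE_class \<mu> g) \<in> S"
  by (auto simp: S_def)

lemma S_memE:
  assumes "(X, Y) \<in> S"
  obtains f g a where "X = AE_class \<mu> f" "Y = AE_class \<mu> g" "maxrel f g a"
  using assms by (auto simp: S_def)

text \<open>Since \<open>\<mu>\<close> is infinite, no nonzero constant is square integrable, which makes the constant in
  \<^const>\<open>maxrel\<close> unique.\<close>

lemma maxrel_unique:
  assumes "maxrel f g a" "maxrel f' g' a'" "AE_class \<mu> f = AE_class \<mu> f'"
  shows "a = a'" "AE_class \<mu> g = AE_class \<mu> g'"
proof -
  have [measurable]: "f \<in> borel_measurable \<mu>" "f' \<in> borel_measurable \<mu>"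
    "g \<in> borel_measurable \<mu>" "g' \<in> borel_measurable \<mu>"
    using assms(1,2) by (auto simp: maxrel_def L2_fun_def)
  have "AE t in \<mu>. f t = f' t" using assms(3) by (simp add: AE_class_eq_iff)
  with maxrelD(3)[OF assms(1)] maxrelD(3)[OF assms(2)]
  have AE: "AE t in \<mu>. a' - a = g t - g' t" by eventually_elim simp
  have "(\<lambda>_. a' - a) \<in> L2_fun \<mu>"
    by (rule L2_fun_cong_AE[OF L2_fun_diff[OF maxrelD(2)[OF assms(1)] maxrelD(2)[OF assms(2)]] _ AE]) simp
  then show "a = a'" using const_L2[of "a' - a"] by simp
  with AE have "AE t in \<mu>. g t = g' t" by simp
  then show "AE_class \<mu> g = AE_class \<mu> g'" by (simp add: AE_class_eq_iff)
qed

lemma c_eq: "maxrel f g a \<Longrightarrow> c (AE_class \<mu> f) = a"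
  unfolding c_def using maxrel_unique(1) by (intro the_equality) blast+

lemma l_eq:
  assumes "maxrel f g a"
  shows "l (AE_class \<mu> f) = (\<integral>t. f t - a * of_real (r t) \<partial>\<mu>)"
proof -
  have [measurable]: "f \<in> borel_measurable \<mu>" using assms by (auto simp: maxrel_def L2_fun_def)
  note [measurable] = rep_AE_class(1)
  have "AE t in \<mu>. rep (AE_class \<mu> f) t - a * of_real (r t) = f t - a * of_real (r t)"
    using rep_AE_class(2)[of f \<mu>] by (auto elim: AE_mp)
  then show ?thesis
    unfolding l_def c_eq[OF assms] by (intro integral_cong_AE) simp_all
qed

lemma maxrel_add:
  assumes "maxrel f g a" "maxrel f' g' a'"
  shows "maxrel (\<lambda>t. f t + f' t) (\<lambda>t. g t + g' t) (a + a')"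
proof -
  have "AE t in \<mu>. g t + g' t = of_real t * (f t + f' t) - (a + a')"
    using maxrelD(3)[OF assms(1)] maxrelD(3)[OF assms(2)]
    by eventually_elim (simp add: algebra_simps)
  then show ?thesis using assms by (simp add: maxrel_def L2_fun_add)
qed

lemma maxrel_cmult:
  assumes "maxrel f g a"
  shows "maxrel (\<lambda>t. b * f t) (\<lambda>t. b * g t) (b * a)"
proof -
  have "AE t in \<mu>. b * g t = of_real t * (b * f t) - b * a"
    using maxrelD(3)[OF assms] by eventually_elim (simp add: right_diff_distrib mult.left_commute)
  then show ?thesis using assms by (simp add: maxrel_def L2_fun_cmult)
qed

lemma L2_div_integrable:
  assumes "f \<in> borel_measurable \<mu>" "(\<lambda>t. (of_real t - \<i>) * f t) \<in> L2_fun \<mu>"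
  shows "integrable \<mu> f"
proof -
  \<comment> \<open>The factor \<open>cnj (G (-\<i>) t)\<close> is \<open>1 / (t - \<i>)\<close>, so
    \<open>f\<close> is a product of two square integrable functions.\<close>
  have "integrable \<mu> (\<lambda>t. (of_real t - \<i>) * f t * cnj (G (-\<i>) t))"
    by (intro L2_fun_prod_integrable assms G_L2) simp
  moreover have "(of_real t - \<i>) * f t * cnj (G (-\<i>) t) = f t" for t
    using denom_ne[of \<i> t] by (simp add: G_def)
  ultimately show ?thesis by simp
qed

text \<open>Multiplied by \<open>t - \<i>\<close>, the function stays square integrable:
  \<open>t * f\<close> and \<open>a * t * r\<close> contain the same constant \<open>a\<close>, and
  what remains is \<open>g + a w\<close> and a multiple of the function itself.\<close>

lemma maxrel_regularized_integrable:
  assumes "maxrel f g a"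
  shows "integrable \<mu> (\<lambda>t. f t - a * of_real (r t))"
proof (rule L2_div_integrable)
  have [measurable]: "f \<in> borel_measurable \<mu>" using assms by (auto simp: maxrel_def L2_fun_def)
  show "(\<lambda>t. f t - a * of_real (r t)) \<in> borel_measurable \<mu>" by simp
  have AE: "AE t in \<mu>. (of_real t - \<i>) * (f t - a * of_real (r t)) =
      g t + a * of_real (w t) - \<i> * (f t - a * of_real (r t))"
    using maxrelD(3)[OF assms]
  proof eventually_elim
    case (elim t)
    have tr': "complex_of_real t * of_real (r t) = 1 - of_real (w t)"
      using arg_cong[OF tr[of t], of complex_of_real] by simp
    have "(of_real t - \<i>) * (f t - a * of_real (r t)) =
        of_real t * f t - a * (of_real t * of_real (r t)) - \<i> * (f t - a * of_real (r t))"
      by (simp add: algebra_simps)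
    then show ?case unfolding tr' elim by (simp add: algebra_simps)
  qed
  show "(\<lambda>t. (of_real t - \<i>) * (f t - a * of_real (r t))) \<in> L2_fun \<mu>"
    by (rule L2_fun_cong_AE[OF _ _ AE], rule L2_fun_diff[OF
          L2_fun_add[OF maxrelD(2)[OF assms] L2_fun_cmult[OF w_L2]]
          L2_fun_cmult[OF L2_fun_diff[OF maxrelD(1)[OF assms] L2_fun_cmult[OF r_L2]]]]) measurable
qed

text \<open>Neither \<open>f\<close> nor \<open>g\<close> need be integrable, but the terms with \<open>r\<close> cancel since \<open>r\<close> is real.\<close>

lemma green_maxrel:
  assumes "maxrel f f' a" "maxrel g g' b"
  shows "(\<integral>t. f' t * cnj (g t) \<partial>\<mu>) - (\<integral>t. f t * cnj (g' t) \<partial>\<mu>) =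
    (\<integral>t. f t - a * of_real (r t) \<partial>\<mu>) * cnj b - a * cnj (\<integral>t. g t - b * of_real (r t) \<partial>\<mu>)"
proof -
  note F = maxrelD(1,2)[OF assms(1)] and G = maxrelD(1,2)[OF assms(2)]
  note I = maxrel_regularized_integrable[OF assms(1)] maxrel_regularized_integrable[OF assms(2)]
  have [measurable]: "f \<in> borel_measurable \<mu>" "f' \<in> borel_measurable \<mu>"
    "g \<in> borel_measurable \<mu>" "g' \<in> borel_measurable \<mu>"
    using F G by (auto simp: L2_fun_def)
  have "(\<integral>t. f' t * cnj (g t) \<partial>\<mu>) - (\<integral>t. f t * cnj (g' t) \<partial>\<mu>) =
      (\<integral>t. f' t * cnj (g t) - f t * cnj (g' t) \<partial>\<mu>)"
    by (intro Bochner_Integration.integral_diff[symmetric] L2_fun_prod_integrable F G)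
  also have "\<dots> = (\<integral>t. (f t - a * of_real (r t)) * cnj b - a * cnj (g t - b * of_real (r t)) \<partial>\<mu>)"
  proof (rule integral_cong_AE)
    show "AE t in \<mu>. f' t * cnj (g t) - f t * cnj (g' t) =
        (f t - a * of_real (r t)) * cnj b - a * cnj (g t - b * of_real (r t))"
      using maxrelD(3)[OF assms(1)] maxrelD(3)[OF assms(2)]
    proof eventually_elim
      case (elim t)
      show ?case unfolding elim by (simp add: algebra_simps)
    qed
  qed measurable
  also have "\<dots> = (\<integral>t. (f t - a * of_real (r t)) * cnj b \<partial>\<mu>) -
      (\<integral>t. a * cnj (g t - b * of_real (r t)) \<partial>\<mu>)"
    by (intro Bochner_Integration.integral_diff integrable_mult_left integrable_mult_right
        integrable_cnj I)
  also have "\<dots> = (\<integral>t. f t - a * of_real (r t) \<partial>\<mu>) * cnj b -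
      a * (\<integral>t. cnj (g t - b * of_real (r t)) \<partial>\<mu>)"
    by (simp only: integral_mult_left_zero integral_mult_right_zero)
  finally show ?thesis by (simp only: Bochner_Integration.integral_cnj)
qed

lemma maxrel_G:
  assumes "Im z \<noteq> 0"
  shows "maxrel (G z) (\<lambda>t. z * G z t) 1"
proof -
  have "(of_real t - z) * G z t = 1" for t
    using denom_ne[OF assms, of t] by (simp add: G_def)
  then show ?thesis
    using G_L2[OF assms] by (simp add: maxrel_def L2_fun_cmult left_diff_distrib diff_eq_eq)
qed

lemma l_\<gamma>_integral:
  assumes "Im z \<noteq> 0"
  shows "l (\<gamma> z) = (\<integral>t. 1 / (of_real t - z) - of_real (t / (1 + t\<^sup>2)) \<partial>\<mu>)"
  unfolding \<gamma>_def l_eq[OF maxrel_G[OF assms]] by (simp add: G_def r_def)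

text \<open>For these points \<open>z * z = - 1\<close>, so \<open>G z - r\<close> collapses to
  \<open>z * w\<close> and only the total weight \<open>q\<close> is left.\<close>

lemma l_\<gamma>_unit:
  assumes "z = \<i> \<or> z = - \<i>"
  shows "l (\<gamma> z) = z * of_real q"
proof -
  have z: "Im z \<noteq> 0" using assms by auto
  have "G z t - 1 * of_real (r t) = z * of_real (w t)" for t
  proof -
    have z2: "z * z = - 1" using assms by auto
    have "(of_real t - z) * (of_real t + z) = of_real (1 + t\<^sup>2)"
      using z2 by (simp add: algebra_simps power2_eq_square)
    then have "G z t = (of_real t + z) / of_real (1 + t\<^sup>2)"
      using denom_ne[OF z, of t] denom_pos[of t]
      by (simp add: G_def frac_eq_eq mult.commute del: of_real_add of_real_power)
    then show ?thesis by (simp add: r_def w_def add_divide_distrib)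
  qed
  then have "l (\<gamma> z) = (\<integral>t. z * of_real (w t) \<partial>\<mu>)"
    unfolding \<gamma>_def l_eq[OF maxrel_G[OF z]] by simp
  also have "\<dots> = z * of_real q" by (simp add: integral_w)
  finally show ?thesis .
qed

section \<open>The adjoint of the minimal operator\<close>

lemma Smin_memI:
  assumes "u \<in> L2_fun \<mu>" "(\<lambda>t. of_real t * u t) \<in> L2_fun \<mu>" "(\<integral>t. u t \<partial>\<mu>) = 0"
  shows "(AE_class \<mu> u, AE_class \<mu> (\<lambda>t. of_real t * u t)) \<in> {(f, g) \<in> S. c f = 0 \<and> l f = 0}"
proof -
  have "maxrel u (\<lambda>t. of_real t * u t) 0" using assms by (simp add: maxrel_def)
  from S_memI[OF this] c_eq[OF this] l_eq[OF this] show ?thesis using assms(3) by simp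
qed

text \<open>The hypothesis says that \<open>d = t f - h\<close> is orthogonal to all admissible
  \<open>u\<close> of integral zero, and \<open>d\<close> has to be constant. The test function
  \<open>u = (d - a) w\<close>, with \<open>a\<close> the weighted mean of \<open>d\<close>, turns
  the relation into a vanishing weighted variance.\<close>

lemma L2_orthogonal_imp_maxrel:
  assumes f: "f \<in> L2_fun \<mu>" and h: "h \<in> L2_fun \<mu>"
    and orth: "\<And>u. \<lbrakk>u \<in> L2_fun \<mu>; (\<lambda>t. of_real t * u t) \<in> L2_fun \<mu>; (\<integral>t. u t \<partial>\<mu>) = 0\<rbrakk>
      \<Longrightarrow> (\<integral>t. (of_real t * u t) * cnj (f t) \<partial>\<mu>) = (\<integral>t. u t * cnj (h t) \<partial>\<mu>)"
  shows "\<exists>a. maxrel f h a"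
proof -
  have [measurable]: "f \<in> borel_measurable \<mu>" "h \<in> borel_measurable \<mu>"
    using f h by (auto simp: L2_fun_def)
  define d where "d t = of_real t * f t - h t" for t
  \<comment> \<open>This is \<open>d * w\<close> written with bounded multipliers of
    \<open>f\<close> and \<open>h\<close>, since \<open>d\<close> itself need not be square
    integrable.\<close>
  define p where "p t = of_real (r t) * f t - of_real (w t) * h t" for t
  \<comment> \<open>The mean of \<open>d\<close> for the weight \<open>w\<close> of total mass
    \<open>q\<close>; it gives \<open>u\<close> integral zero.\<close>
  define a where "a = (\<integral>t. p t \<partial>\<mu>) / of_real q"
  define u where "u t = p t - a * of_real (w t)" for t
  have r_le: "cmod (of_real (r t)) \<le> 1" for t
    using r_sq_le[of t] w_le_1[of t] by (simp add: abs_square_le_1[symmetric])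
  have w_le: "cmod (of_real (w t)) \<le> 1" "cmod (1 - of_real (w t)) \<le> 1" for t
  proof -
    have "cmod (of_real (1 - w t)) \<le> 1"
      unfolding norm_of_real using w_le_1[of t] w_pos[of t] by simp
    then show "cmod (1 - of_real (w t)) \<le> 1" by simp
  qed (use w_le_1[of t] w_pos[of t] in simp)
  have tw': "complex_of_real t * of_real (w t) = of_real (r t)" for t
    using arg_cong[OF tw[of t], of complex_of_real] by simp
  have tr': "complex_of_real t * of_real (r t) = 1 - of_real (w t)" for t
    using arg_cong[OF tr[of t], of complex_of_real] by simp
  have pd: "p t = d t * of_real (w t)" for t
    unfolding p_def d_def tw'[symmetric] by (simp add: algebra_simps)
  have p: "p \<in> L2_fun \<mu>"
    unfolding p_def[abs_def]
    by (rule L2_fun_diff[OF L2_fun_mult_bounded[OF f _ r_le] L2_fun_mult_bounded[OF h _ w_le(1)]])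
      measurable
  have "(\<lambda>t. (1 - of_real (w t)) * f t - of_real (r t) * h t) \<in> L2_fun \<mu>"
    by (rule L2_fun_diff[OF L2_fun_mult_bounded[OF f _ w_le(2)] L2_fun_mult_bounded[OF h _ r_le]])
      measurable
  moreover have "of_real t * p t = (1 - of_real (w t)) * f t - of_real (r t) * h t" for t
    unfolding p_def tw'[symmetric] by (simp add: right_diff_distrib tr' tw' flip: mult.assoc)
  ultimately have tp: "(\<lambda>t. of_real t * p t) \<in> L2_fun \<mu>" by simp
  have u: "u \<in> L2_fun \<mu>"
    unfolding u_def[abs_def] by (rule L2_fun_diff[OF p L2_fun_cmult[OF w_L2]])
  have "of_real t * u t = of_real t * p t - a * of_real (r t)" for t
    unfolding u_def tw'[symmetric] by (simp add: algebra_simps)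
  then have tu: "(\<lambda>t. of_real t * u t) \<in> L2_fun \<mu>"
    using L2_fun_diff[OF tp L2_fun_cmult[OF r_L2, of a]] by simp
  have "integrable \<mu> (\<lambda>t. f t * cnj (of_real (r t)) - h t * cnj (of_real (w t)))"
    by (intro Bochner_Integration.integrable_diff L2_fun_prod_integrable f h r_L2 w_L2)
  then have ip: "integrable \<mu> p" by (simp add: p_def[abs_def] mult.commute)
  have iw: "integrable \<mu> (\<lambda>t. a * of_real (w t))" using integrable_w by simp
  have iu: "integrable \<mu> u" unfolding u_def[abs_def] using ip iw by simp
  have int_u: "(\<integral>t. u t \<partial>\<mu>) = 0"
    using Bochner_Integration.integral_diff[OF ip iw] q_pos
    by (simp add: u_def integral_w a_def)
  have I: "integrable \<mu> (\<lambda>t. (of_real t * u t) * cnj (f t))" "integrable \<mu> (\<lambda>t. u t * cnj (h t))"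
    "integrable \<mu> (\<lambda>t. u t * cnj a)"
    using L2_fun_prod_integrable[OF tu f] L2_fun_prod_integrable[OF u h] iu by auto
  \<comment> \<open>On the right, the first two terms have equal integrals by orthogonality and the
    last has integral zero.\<close>
  have "of_real ((cmod (d t - a))\<^sup>2 * w t) =
      (of_real t * u t) * cnj (f t) - u t * cnj (h t) - u t * cnj a" for t
  proof -
    have "u t = (d t - a) * of_real (w t)" by (simp add: u_def pd algebra_simps)
    moreover have "(of_real t * u t) * cnj (f t) - u t * cnj (h t) - u t * cnj a = u t * cnj (d t - a)"
      by (simp add: d_def algebra_simps)
    ultimately show ?thesis
      unfolding of_real_mult complex_norm_square by (simp only: mult_ac)
  qed
  then have "(\<integral>t. complex_of_real ((cmod (d t - a))\<^sup>2 * w t) \<partial>\<mu>) = 0"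
    and "integrable \<mu> (\<lambda>t. complex_of_real ((cmod (d t - a))\<^sup>2 * w t))"
    using I orth[OF u tu int_u] int_u by simp_all
  then have "(\<integral>t. (cmod (d t - a))\<^sup>2 * w t \<partial>\<mu>) = 0"
    and int: "integrable \<mu> (\<lambda>t. (cmod (d t - a))\<^sup>2 * w t)"
    unfolding integral_complex_of_real complex_of_real_integrable_eq by simp_all
  moreover have "(cmod (d t - a))\<^sup>2 * w t \<ge> 0" for t using w_pos[of t] by simp
  ultimately have "AE t in \<mu>. (cmod (d t - a))\<^sup>2 * w t = 0"
    using integral_nonneg_eq_0_iff_AE[OF int] by simp
  then have "AE t in \<mu>. h t = of_real t * f t - a"
  proof eventually_elim
    case (elim t)
    then have "d t = a" using w_pos[of t] by simp
    then show ?case by (simp add: d_def algebra_simps)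
  qed
  then show ?thesis using f h by (auto simp: maxrel_def)
qed

section \<open>Density of the minimal domain\<close>

definition cutoff :: "nat \<Rightarrow> real \<Rightarrow> complex" where
  "cutoff n t = of_real (indicator {- real n..real n} t)"

lemma cutoff_measurable [measurable]: "cutoff n \<in> borel_measurable \<mu>"
  unfolding cutoff_def[abs_def] by measurable

lemma cutoff_idem: "cutoff n t * cutoff n t = cutoff n t"
  by (simp add: cutoff_def indicator_def)

lemma cutoff_le: "cmod (cutoff n t) \<le> 1" "cmod (of_real t * cutoff n t) \<le> real n"
  "cmod (1 - cutoff n t) \<le> 1"
  by (auto simp: cutoff_def indicator_def)

lemma cutoff_sq: "(cmod (cutoff n t))\<^sup>2 = indicator {- real n..real n} t"
  by (simp add: cutoff_def indicator_def)

text \<open>On the interval the weight \<open>w\<close> is at least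
  \<open>1 / (1 + n\<^sup>2)\<close>, so finiteness of the total weight makes \<mu> finite on
  bounded intervals.\<close>

lemma integrable_indicator_interval: "integrable \<mu> (indicator {- real n..real n} :: real \<Rightarrow> real)"
proof (rule Bochner_Integration.integrable_bound)
  show "integrable \<mu> (\<lambda>t. (1 + (real n)\<^sup>2) * w t)" using integrable_w by simp
  have "indicator {- real n..real n} t \<le> (1 + (real n)\<^sup>2) * w t" for t :: real
  proof (cases "t \<in> {- real n..real n}")
    case True
    then have "t\<^sup>2 \<le> (real n)\<^sup>2" by (intro abs_le_square_iff[THEN iffD1]) auto
    then show ?thesis using True denom_pos[of t] by (simp add: w_def)
  qed (use w_pos[of t] in simp)
  then show "AE t in \<mu>. norm (indicator {- real n..real n} t :: real) \<le> norm ((1 + (real n)\<^sup>2) * w t)"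
    using w_pos by (auto intro!: AE_I2 simp: abs_mult less_imp_le abs_of_pos)
qed simp

lemma cutoff_L2: "cutoff n \<in> L2_fun \<mu>"
  by (rule L2_fun_bound[OF _ integrable_indicator_interval]) (auto simp: cutoff_sq)

lemma t_cutoff_L2: "(\<lambda>t. of_real t * cutoff n t) \<in> L2_fun \<mu>"
  using L2_fun_mult_bounded[OF cutoff_L2, of "\<lambda>t. of_real t * cutoff n t" n n] cutoff_le(2)
  by (simp add: mult.assoc cutoff_idem)

lemma space_\<mu>: "space \<mu> = UNIV"
  using sets_eq_imp_space_eq[OF sets_\<mu>] by simp

lemma integral_cutoff: "(\<integral>t. cutoff n t \<partial>\<mu>) = of_real (measure \<mu> {- real n..real n})"
  unfolding cutoff_def integral_complex_of_real by (simp add: space_\<mu>)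

lemma measure_interval_unbounded: "\<exists>n. C < measure \<mu> {- real n..real n}"
proof -
  have S: "range (\<lambda>n. {- real n..real n}) \<subseteq> sets \<mu>" by (auto simp: sets_\<mu>)
  have "(\<Union>n. {- real n..real n}) = UNIV"
  proof -
    have "t \<in> {- real (nat \<lceil>\<bar>t\<bar>\<rceil>)..real (nat \<lceil>\<bar>t\<bar>\<rceil>)}" for t
      by (simp add: abs_le_iff[symmetric] real_nat_ceiling_ge minus_le_iff abs_le_D1 abs_le_D2)
    then show ?thesis by blast
  qed
  then have "(SUP n. emeasure \<mu> {- real n..real n}) = \<infinity>"
    using SUP_emeasure_incseq[OF S] infinite_\<mu> by (simp add: incseq_def)
  then have "ennreal C < (SUP n. emeasure \<mu> {- real n..real n})"
    by (simp only: ennreal_less_top infinity_ennreal_def)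
  then obtain n where n: "ennreal C < emeasure \<mu> {- real n..real n}"
    unfolding less_SUP_iff by blast
  \<comment> \<open>Finiteness matters because \<open>measure\<close> is 0 on sets of infinite
    \<open>emeasure\<close>.\<close>
  have "emeasure \<mu> {- real n..real n} \<noteq> \<infinity>"
    using integrable_indicator_interval[of n]
    by (simp add: integrable_indicator_iff space_\<mu> less_top)
  then have "emeasure \<mu> {- real n..real n} = ennreal (measure \<mu> {- real n..real n})"
    by (simp add: emeasure_eq_ennreal_measure)
  then have "C < measure \<mu> {- real n..real n}" using n by (metis ennreal_leI not_le)
  then show ?thesis ..
qed

lemma cutoff_converges:
  assumes f: "f \<in> L2_fun \<mu>"
  shows "(\<lambda>n. \<integral>t. (cmod (f t - cutoff n t * f t))\<^sup>2 \<partial>\<mu>) \<longlonglongrightarrow> 0"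
proof -
  have [measurable]: "f \<in> borel_measurable \<mu>" using f by (auto simp: L2_fun_def)
  have "(\<lambda>n. \<integral>t. (cmod (f t - cutoff n t * f t))\<^sup>2 \<partial>\<mu>) \<longlonglongrightarrow> (\<integral>t. 0 \<partial>\<mu>)"
  proof (rule integral_dominated_convergence[where w = "\<lambda>t. (cmod (f t))\<^sup>2"])
    show "AE t in \<mu>. (\<lambda>n. (cmod (f t - cutoff n t * f t))\<^sup>2) \<longlonglongrightarrow> 0"
    proof (rule AE_I2)
      fix t
      have "\<forall>\<^sub>F n in sequentially. (cmod (f t - cutoff n t * f t))\<^sup>2 = 0"
        using eventually_ge_at_top[of "nat \<lceil>\<bar>t\<bar>\<rceil>"]
      proof eventually_elim
        case (elim n)
        then have "\<bar>t\<bar> \<le> real n" by (simp add: nat_le_iff ceiling_le_iff)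
        then show ?case by (simp add: cutoff_def abs_le_iff minus_le_iff)
      qed
      then show "(\<lambda>n. (cmod (f t - cutoff n t * f t))\<^sup>2) \<longlonglongrightarrow> 0" by (rule tendsto_eventually)
    qed
    fix n
    have "cmod (f t - cutoff n t * f t) \<le> cmod (f t)" for t
      by (auto simp: cutoff_def indicator_def)
    then show "AE t in \<mu>. norm ((cmod (f t - cutoff n t * f t))\<^sup>2) \<le> (cmod (f t))\<^sup>2"
      by (auto intro!: power_mono)
  qed (use f in \<open>auto simp: L2_fun_sq\<close>)
  then show ?thesis by simp
qed

text \<open>A truncation of a square integrable function is corrected to have integral zero by a multiple
  of a wide cutoff; as \<open>\<mu>\<close> is infinite, the correction can be made small in norm.\<close>

lemma dense_minimal: "htop (L2 \<mu>) closure_of Domain {(f, g) \<in> S. c f = 0 \<and> l f = 0} = carrier (L2 \<mu>)"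
proof -
  interpret inner_product_space "L2 \<mu>" by (rule inner_product_space_L2)
  interpret Metric_space "carrier (L2 \<mu>)" "hdist (L2 \<mu>)" by (rule Metric_space_hdist)
  have "\<exists>Y \<in> Domain {(f, g) \<in> S. c f = 0 \<and> l f = 0}. Y \<in> mball X e"
    if X: "X \<in> carrier (L2 \<mu>)" and e: "e > 0" for X e
  proof -
    obtain f where f: "f \<in> L2_fun \<mu>" "X = AE_class \<mu> f" using X by (auto simp: carrier_L2)
    \<comment> \<open>\<open>cmod_add_sq\<close> doubles the two squared errors, so each may use a
      quarter of \<open>e\<^sup>2\<close>.\<close>
    obtain n where n: "(\<integral>t. (cmod (f t - cutoff n t * f t))\<^sup>2 \<partial>\<mu>) < e\<^sup>2 / 4"
      using order_tendstoD(2)[OF cutoff_converges[OF f(1)], of "e\<^sup>2 / 4"] e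
      by (auto dest: eventually_happens)
    define J where "J = (\<integral>t. cutoff n t * f t \<partial>\<mu>)"
    \<comment> \<open>The correction has squared norm \<open>(cmod J)\<^sup>2 / m\<close>, where
      \<open>m\<close> is the mass of the wide interval; a large mass makes it small.\<close>
    obtain k where k: "4 * (cmod J)\<^sup>2 / e\<^sup>2 < measure \<mu> {- real k..real k}"
      using measure_interval_unbounded by blast
    define m where "m = measure \<mu> {- real k..real k}"
    have m: "m > 0" "4 * (cmod J)\<^sup>2 < e\<^sup>2 * m"
    proof -
      have "0 \<le> 4 * (cmod J)\<^sup>2 / e\<^sup>2" by simp
      then show "m > 0" using k unfolding m_def by linarith
      show "4 * (cmod J)\<^sup>2 < e\<^sup>2 * m" using k e by (simp add: m_def divide_less_eq mult.commute)
    qed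
    define s where "s = J / of_real m"
    define h where "h t = cutoff n t * f t - s * cutoff k t" for t
    have cf: "(\<lambda>t. cutoff n t * f t) \<in> L2_fun \<mu>"
      by (rule L2_fun_mult_bounded[OF f(1) cutoff_measurable cutoff_le(1)])
    have h: "h \<in> L2_fun \<mu>"
      unfolding h_def[abs_def] by (rule L2_fun_diff[OF cf L2_fun_cmult[OF cutoff_L2]])
    have "(\<lambda>t. (of_real t * cutoff n t) * f t - s * (of_real t * cutoff k t)) \<in> L2_fun \<mu>"
      by (rule L2_fun_diff[OF L2_fun_mult_bounded[OF f(1) _ cutoff_le(2)] L2_fun_cmult[OF t_cutoff_L2]])
        measurable
    then have th: "(\<lambda>t. of_real t * h t) \<in> L2_fun \<mu>"
      by (simp add: h_def algebra_simps)
    have "integrable \<mu> (\<lambda>t. f t * cnj (cutoff n t))"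
      by (intro L2_fun_prod_integrable f cutoff_L2)
    moreover have "cnj (cutoff n t) = cutoff n t" for t by (simp add: cutoff_def)
    ultimately have icf: "integrable \<mu> (\<lambda>t. cutoff n t * f t)" by (simp add: mult.commute)
    have "integrable \<mu> (cutoff k)"
      unfolding cutoff_def[abs_def] complex_of_real_integrable_eq
      using integrable_indicator_interval by simp
    then have ick: "integrable \<mu> (\<lambda>t. s * cutoff k t)" by simp
    have "(\<integral>t. h t \<partial>\<mu>) = 0"
      unfolding h_def Bochner_Integration.integral_diff[OF icf ick] using m
      by (simp add: integral_cutoff J_def[symmetric] s_def m_def[symmetric])
    then have mem: "AE_class \<mu> h \<in> Domain {(f, g) \<in> S. c f = 0 \<and> l f = 0}"
      using Smin_memI[OF h th] by blast
    have sm: "(cmod s)\<^sup>2 * m < e\<^sup>2 / 4"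
      using m by (simp add: s_def norm_divide power_divide power2_eq_square field_simps)
    have "(\<integral>t. (cmod (f t - h t))\<^sup>2 \<partial>\<mu>) \<le>
        (\<integral>t. 2 * (cmod (f t - cutoff n t * f t))\<^sup>2 + 2 * ((cmod s)\<^sup>2 * indicator {- real k..real k} t) \<partial>\<mu>)"
    proof (rule integral_mono)
      show "integrable \<mu> (\<lambda>t. (cmod (f t - h t))\<^sup>2)"
        by (rule L2_fun_sq[OF L2_fun_diff[OF f(1) h]])
      show "integrable \<mu> (\<lambda>t. 2 * (cmod (f t - cutoff n t * f t))\<^sup>2 +
          2 * ((cmod s)\<^sup>2 * indicator {- real k..real k} t))"
        by (intro Bochner_Integration.integrable_add integrable_mult_right
            L2_fun_sq[OF L2_fun_diff[OF f(1) cf]] integrable_indicator_interval)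
      show "(cmod (f t - h t))\<^sup>2 \<le> 2 * (cmod (f t - cutoff n t * f t))\<^sup>2 +
          2 * ((cmod s)\<^sup>2 * indicator {- real k..real k} t)" for t
      proof -
        have "f t - h t = (f t - cutoff n t * f t) + s * cutoff k t" by (simp add: h_def)
        then show ?thesis
          using cmod_add_sq[of "f t - cutoff n t * f t" "s * cutoff k t"]
          by (simp only: norm_mult power_mult_distrib cutoff_sq)
      qed
    qed
    also have "\<dots> = 2 * (\<integral>t. (cmod (f t - cutoff n t * f t))\<^sup>2 \<partial>\<mu>) + 2 * ((cmod s)\<^sup>2 * m)"
      using L2_fun_sq[OF L2_fun_diff[OF f(1) cf]] integrable_indicator_interval[of k]
      by (simp add: space_\<mu> m_def)
    also have "\<dots> < e\<^sup>2" using n sm by simp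
    finally have "hdist (L2 \<mu>) X (AE_class \<mu> h) < e"
      using e real_sqrt_less_iff[of _ "e\<^sup>2"] by (simp add: f hdist_L2 h)
    then show ?thesis using mem X AE_class_in_L2[OF h] by (auto simp: in_mball)
  qed
  then show ?thesis unfolding htop_def metric_closure_of by blast
qed

section \<open>The boundary triple of the measure\<close>

lemma green_S:
  assumes "(X, X') \<in> S" "(Y, Y') \<in> S"
  shows "ip (L2 \<mu>) X' Y - ip (L2 \<mu>) X Y' = l X * cnj (c Y) - c X * cnj (l Y)"
proof -
  obtain f f' a where X: "X = AE_class \<mu> f" "X' = AE_class \<mu> f'" and f: "maxrel f f' a"
    using assms(1) by (rule S_memE)
  obtain g g' b where Y: "Y = AE_class \<mu> g" "Y' = AE_class \<mu> g'" and g: "maxrel g g' b"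
    using assms(2) by (rule S_memE)
  show ?thesis
    unfolding X Y c_eq[OF f] c_eq[OF g] l_eq[OF f] l_eq[OF g]
      ip_L2[OF maxrelD(2)[OF f] maxrelD(1)[OF g]] ip_L2[OF maxrelD(1)[OF f] maxrelD(2)[OF g]]
    by (rule green_maxrel[OF f g])
qed

text \<open>One inclusion is the variance argument above; the other is Green's identity with
  vanishing boundary values on one side.\<close>

lemma adjoint_minimal: "adjoint_op (L2 \<mu>) {(f, g) \<in> S. c f = 0 \<and> l f = 0} = S"
proof (intro equalityI subrelI)
  fix X Y assume XY: "(X, Y) \<in> adjoint_op (L2 \<mu>) {(f, g) \<in> S. c f = 0 \<and> l f = 0}"
  then obtain f h where f: "f \<in> L2_fun \<mu>" "X = AE_class \<mu> f" and h: "h \<in> L2_fun \<mu>" "Y = AE_class \<mu> h"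
    by (auto simp: adjoint_op_def carrier_L2)
  have "\<exists>a. maxrel f h a"
  proof (rule L2_orthogonal_imp_maxrel[OF f(1) h(1)])
    fix u assume u: "u \<in> L2_fun \<mu>" "(\<lambda>t. of_real t * u t) \<in> L2_fun \<mu>" "(\<integral>t. u t \<partial>\<mu>) = 0"
    have "ip (L2 \<mu>) (AE_class \<mu> (\<lambda>t. of_real t * u t)) X = ip (L2 \<mu>) (AE_class \<mu> u) Y"
      using XY Smin_memI[OF u] by (auto simp: adjoint_op_def)
    then show "(\<integral>t. (of_real t * u t) * cnj (f t) \<partial>\<mu>) = (\<integral>t. u t * cnj (h t) \<partial>\<mu>)"
      using u f h by (simp add: ip_L2)
  qed
  then show "(X, Y) \<in> S" using f h S_memI by blast
next
  fix X Y assume XY: "(X, Y) \<in> S"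
  then have "X \<in> carrier (L2 \<mu>)" "Y \<in> carrier (L2 \<mu>)"
    by (auto elim!: S_memE simp: maxrel_def AE_class_in_L2)
  moreover have "ip (L2 \<mu>) V X = ip (L2 \<mu>) U Y" if "(U, V) \<in> S" "c U = 0" "l U = 0" for U V
    using green_S[OF that(1) XY] that by simp
  ultimately show "(X, Y) \<in> adjoint_op (L2 \<mu>) {(f, g) \<in> S. c f = 0 \<and> l f = 0}"
    by (auto simp: adjoint_op_def)
qed

lemma S_add:
  assumes "(X, X') \<in> S" "(Y, Y') \<in> S"
  shows "(X \<oplus>\<^bsub>L2 \<mu>\<^esub> Y, X' \<oplus>\<^bsub>L2 \<mu>\<^esub> Y') \<in> S"
    "c (X \<oplus>\<^bsub>L2 \<mu>\<^esub> Y) = c X + c Y" "l (X \<oplus>\<^bsub>L2 \<mu>\<^esub> Y) = l X + l Y"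
proof -
  obtain f f' a where X: "X = AE_class \<mu> f" "X' = AE_class \<mu> f'" and f: "maxrel f f' a"
    using assms(1) by (rule S_memE)
  obtain g g' b where Y: "Y = AE_class \<mu> g" "Y' = AE_class \<mu> g'" and g: "maxrel g g' b"
    using assms(2) by (rule S_memE)
  note fg = maxrel_add[OF f g]
  have eq: "X \<oplus>\<^bsub>L2 \<mu>\<^esub> Y = AE_class \<mu> (\<lambda>t. f t + g t)" "X' \<oplus>\<^bsub>L2 \<mu>\<^esub> Y' = AE_class \<mu> (\<lambda>t. f' t + g' t)"
    using X Y maxrelD(1,2)[OF f] maxrelD(1,2)[OF g] by (simp_all add: add_L2)
  show "(X \<oplus>\<^bsub>L2 \<mu>\<^esub> Y, X' \<oplus>\<^bsub>L2 \<mu>\<^esub> Y') \<in> S" unfolding eq by (rule S_memI[OF fg])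
  have cXY: "c X = a" "c Y = b" unfolding X Y by (rule c_eq[OF f], rule c_eq[OF g])
  then show "c (X \<oplus>\<^bsub>L2 \<mu>\<^esub> Y) = c X + c Y" unfolding eq c_eq[OF fg] by simp
  have lXY: "l X = (\<integral>t. f t - a * of_real (r t) \<partial>\<mu>)" "l Y = (\<integral>t. g t - b * of_real (r t) \<partial>\<mu>)"
    unfolding X Y by (rule l_eq[OF f], rule l_eq[OF g])
  have split: "f t + g t - (a + b) * of_real (r t) =
      (f t - a * of_real (r t)) + (g t - b * of_real (r t))" for t
    by (simp add: algebra_simps)
  show "l (X \<oplus>\<^bsub>L2 \<mu>\<^esub> Y) = l X + l Y"
    unfolding eq l_eq[OF fg] lXY split
    by (rule Bochner_Integration.integral_add[OF maxrel_regularized_integrable[OF f]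
          maxrel_regularized_integrable[OF g]])
qed

lemma S_smult:
  assumes "(X, X') \<in> S"
  shows "(b \<odot>\<^bsub>L2 \<mu>\<^esub> X, b \<odot>\<^bsub>L2 \<mu>\<^esub> X') \<in> S"
    "c (b \<odot>\<^bsub>L2 \<mu>\<^esub> X) = b * c X" "l (b \<odot>\<^bsub>L2 \<mu>\<^esub> X) = b * l X"
proof -
  obtain f f' a where X: "X = AE_class \<mu> f" "X' = AE_class \<mu> f'" and f: "maxrel f f' a"
    using assms by (rule S_memE)
  note bf = maxrel_cmult[OF f, of b]
  have eq: "b \<odot>\<^bsub>L2 \<mu>\<^esub> X = AE_class \<mu> (\<lambda>t. b * f t)" "b \<odot>\<^bsub>L2 \<mu>\<^esub> X' = AE_class \<mu> (\<lambda>t. b * f' t)"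
    using X maxrelD(1,2)[OF f] by (simp_all add: smult_L2)
  show "(b \<odot>\<^bsub>L2 \<mu>\<^esub> X, b \<odot>\<^bsub>L2 \<mu>\<^esub> X') \<in> S" unfolding eq by (rule S_memI[OF bf])
  have cX: "c X = a" unfolding X by (rule c_eq[OF f])
  then show "c (b \<odot>\<^bsub>L2 \<mu>\<^esub> X) = b * c X" unfolding eq c_eq[OF bf] by simp
  have lX: "l X = (\<integral>t. f t - a * of_real (r t) \<partial>\<mu>)" unfolding X by (rule l_eq[OF f])
  have "b * f t - (b * a) * of_real (r t) = b * (f t - a * of_real (r t))" for t
    by (simp add: algebra_simps)
  then show "l (b \<odot>\<^bsub>L2 \<mu>\<^esub> X) = b * l X"
    unfolding eq l_eq[OF bf] lX by simp
qed

lemma lin_op_S: "lin_op (L2 \<mu>) S"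
  unfolding lin_op_def
proof (intro conjI)
  show "S \<subseteq> carrier (L2 \<mu>) \<times> carrier (L2 \<mu>)"
    by (auto elim!: S_memE simp: maxrel_def AE_class_in_L2)
  show "single_valued S"
  proof (rule single_valuedI)
    fix X Y Z assume XY: "(X, Y) \<in> S" and XZ: "(X, Z) \<in> S"
    obtain f g a where 1: "X = AE_class \<mu> f" "Y = AE_class \<mu> g" "maxrel f g a"
      using XY by (rule S_memE)
    obtain f' g' a' where 2: "X = AE_class \<mu> f'" "Z = AE_class \<mu> g'" "maxrel f' g' a'"
      using XZ by (rule S_memE)
    show "Y = Z" using maxrel_unique(2)[OF 1(3) 2(3)] 1 2 by simp
  qed
  have "maxrel (\<lambda>t. 0) (\<lambda>t. 0) 0" by (simp add: maxrel_def L2_fun_zero)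
  then show "(\<zero>\<^bsub>L2 \<mu>\<^esub>, \<zero>\<^bsub>L2 \<mu>\<^esub>) \<in> S" unfolding zero_L2 by (rule S_memI)
qed (auto intro: S_add(1) S_smult(1))

text \<open>On the kernel of \<open>c\<close> the operator is multiplication by \<open>t\<close>, so
  its resolvent is multiplication by the bounded function \<open>G z\<close>.\<close>

lemma S_surj:
  assumes z: "Im z \<noteq> 0" and "h \<in> carrier (L2 \<mu>)"
  shows "\<exists>f g. (f, g) \<in> S \<and> c f = 0 \<and> g \<ominus>\<^bsub>L2 \<mu>\<^esub> z \<odot>\<^bsub>L2 \<mu>\<^esub> f = h"
proof -
  obtain k where k: "k \<in> L2_fun \<mu>" "h = AE_class \<mu> k" using assms by (auto simp: carrier_L2)
  define f where "f t = G z t * k t" for t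
  \<comment> \<open>In this form \<open>g\<close> is visibly square integrable; that it equals
    \<open>t * f t\<close> is checked afterwards.\<close>
  define g where "g t = k t + z * f t" for t
  have f: "f \<in> L2_fun \<mu>"
    unfolding f_def[abs_def] by (rule L2_fun_mult_bounded[OF k(1) _ G_bounded[OF z]]) simp
  have g: "g \<in> L2_fun \<mu>"
    unfolding g_def[abs_def] by (rule L2_fun_add[OF k(1) L2_fun_cmult[OF f]])
  have "(of_real t - z) * G z t = 1" for t
    using denom_ne[OF z, of t] by (simp add: G_def)
  then have "(of_real t - z) * f t = k t" for t
    by (simp add: f_def flip: mult.assoc)
  then have "g t = of_real t * f t" for t
    by (simp add: g_def algebra_simps)
  then have fg: "maxrel f g 0" using f g by (simp add: maxrel_def)
  have "AE_class \<mu> g \<ominus>\<^bsub>L2 \<mu>\<^esub> z \<odot>\<^bsub>L2 \<mu>\<^esub> AE_class \<mu> f = h"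
    using f g k by (simp add: smult_L2 minus_L2 L2_fun_cmult g_def)
  then show ?thesis using S_memI[OF fg] c_eq[OF fg] by blast
qed

lemma boundary_triple: "boundary_triple (L2 \<mu>) S c l \<gamma> q"
proof (intro boundary_triple.intro hilbert_space_L2 boundary_triple_axioms.intro)
  fix z :: complex assume z: "Im z \<noteq> 0"
  have "z \<odot>\<^bsub>L2 \<mu>\<^esub> \<gamma> z = AE_class \<mu> (\<lambda>t. z * G z t)"
    unfolding \<gamma>_def by (rule smult_L2[OF G_L2[OF z]])
  then show "(\<gamma> z, z \<odot>\<^bsub>L2 \<mu>\<^esub> \<gamma> z) \<in> S"
    using S_memI[OF maxrel_G[OF z]] by (simp add: \<gamma>_def)
  show "c (\<gamma> z) = 1" unfolding \<gamma>_def by (rule c_eq[OF maxrel_G[OF z]])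
qed (use lin_op_S green_S adjoint_minimal dense_minimal l_\<gamma>_unit q_pos S_surj
    in \<open>auto intro: S_add S_smult\<close>)

end

theorem theorem14:
  fixes \<kappa> :: real and V :: "complex \<Rightarrow> complex"
  assumes "0 \<le> \<kappa>" and "\<kappa> < 1" and "V \<in> generalized_Donoghue \<kappa>"
  shows "\<exists>(H :: (real \<Rightarrow> complex) set inner_module) Adot AA K.
     L_system H Adot AA K \<and>
     hypothesis_H H Adot (main_operator H Adot AA) (quasi_kernel H Adot (re_pm H Adot AA))
       (complex_of_real \<kappa>) \<and>
     (\<forall>z. 0 < Im z \<longrightarrow>
        V z = impedance H Adot AA K z \<and>
        (\<forall>g \<in> defect_space H Adot \<i>. hnorm H g = 1 \<longrightarrow>
           impedance H Adot AA K z =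
             complex_of_real ((1 - \<kappa>) / (1 + \<kappa>)) *
             weyl_titchmarsh H (quasi_kernel H Adot (re_pm H Adot AA)) g z))"
proof -
  from assms(3) obtain \<mu> :: "real measure" where \<mu>: "sets \<mu> = sets borel" "emeasure \<mu> UNIV = \<infinity>"
      "(\<integral>\<^sup>+ t. ennreal (1 / (1 + t\<^sup>2)) \<partial>\<mu>) = ennreal ((1 - \<kappa>) / (1 + \<kappa>))"
    and V: "\<And>z. 0 < Im z \<Longrightarrow> V z = (\<integral>t. 1 / (of_real t - z) - of_real (t / (1 + t\<^sup>2)) \<partial>\<mu>)"
    unfolding generalized_Donoghue_def by blast
  interpret donoghue_measure \<mu> "(1 - \<kappa>) / (1 + \<kappa>)"
    by unfold_locales (use \<mu> assms in auto)
  have "l (\<gamma> z) = V z" if "0 < Im z" for z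
    using that l_\<gamma>_integral[of z] V[OF that] by simp
  from boundary_triple.realization[OF boundary_triple assms(1,2) refl this]
  show ?thesis by blast
qed

end
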